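(* Let $p$ be a prime. Let $\{B_n\}_{n \geq 1}$ be any sequence of matrices such that $B_n \in \mathrm{M}_n(\mathbb{Z}_p)$ and $$ \lim_{n \rightarrow \infty} \bigl(n - \log_p n - r_p(\operatorname{cok}(B_n))\bigr) = \infty. $$ Then for all finite abelian $p$-groups $H_1$ and $H_2$, $$ \lim_{n \rightarrow \infty} \operatorname{Prob}_{A \in \mathrm{M}_n(\mathbb{Z}_p)} \bigl( \operatorname{cok}(A) \cong H_1 \text{ and } \operatorname{cok}(A + B_n) \cong H_2 \bigr) = \prod_{j=1}^{2} \left( \frac{1}{|\operatorname{Aut}_{\mathbb{Z}_p}(H_j)|} \prod_{i=1}^{\infty} (1 - p^{-i}) \right). $$
   Context: $\mathrm{M}_n(\mathbb{Z}_p)$ is the set of $n \times n$ matrices over the $p$-adic integers $\mathbb{Z}_p$, and $\operatorname{Prob}_{A \in \mathrm{M}_n(\mathbb{Z}_p)}$ denotes probability with respect to the Haar probability measure on $\mathrm{M}_n(\mathbb{Z}_p)$. For $M \in \mathrm{M}_n(\mathbb{Z}_p)$, $\operatorname{cok}(M) = \mathbb{Z}_p^n / M\mathbb{Z}_p^n$. For a finitely generated $\mathbb{Z}_p$-module $N$, its $p$-rank is $r_p(N) := \dim_{\mathbb{F}_p}(N/pN)$. $\operatorname{Aut}_{\mathbb{Z}_p}(H)$ is the group of $\mathbb{Z}_p$-module (equivalently, group) automorphisms of $H$. *)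

theory Defs
  imports
    "HOL-Probability.Probability"
    "HOL-Algebra.Product_Groups"
    "HOL-Algebra.Bij"
    "HOL-Number_Theory.Residues"
    "Jordan_Normal_Form.Missing_VectorSpace"
begin

section \<open>The ring of p-adic integers\<close>

text \<open>
  The inverse limit of the rings \<open>\<int>/p\<^sup>k\<int>\<close>: a p-adic integer is the sequence of its
  residues modulo \<open>p\<^sup>k\<close>, each represented in \<open>{0..<p\<^sup>k}\<close>. At level \<open>k = 0\<close> the ring is trivial,
  so the unit has to be reduced as well.
\<close>

definition padic_int :: "nat \<Rightarrow> (nat \<Rightarrow> int) ring" where
  "padic_int p =
     \<lparr>carrier = {x. \<forall>k. x k \<in> {0..<int p ^ k} \<and> x (Suc k) mod int p ^ k = x k},
      monoid.mult = (\<lambda>x y k. (x k * y k) mod int p ^ k),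
      one = (\<lambda>k. 1 mod int p ^ k),
      ring.zero = (\<lambda>k. 0),
      ring.add = (\<lambda>x y k. (x k + y k) mod int p ^ k)\<rparr>"

text \<open>The inverse limit topology, which is the p-adic topology.\<close>

definition padic_topology :: "nat \<Rightarrow> (nat \<Rightarrow> int) topology" where
  "padic_topology p =
     subtopology (product_topology (\<lambda>k. discrete_topology {0..<int p ^ k}) UNIV)
       (carrier (padic_int p))"


section \<open>Vectors, matrices and cokernels\<close>

text \<open>
  Vectors and matrices are extensional functions on \<open>{..<n}\<close> and \<open>{..<n} \<times> {..<n}\<close>. Both are
  regarded as groups under entrywise addition, so \<open>\<otimes>\<close> of these groups is addition.
\<close>

definition padic_vec :: "nat \<Rightarrow> nat \<Rightarrow> (nat \<Rightarrow> nat \<Rightarrow> int) monoid" where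
  "padic_vec p n = product_group {..<n} (\<lambda>_. add_monoid (padic_int p))"

definition padic_mat :: "nat \<Rightarrow> nat \<Rightarrow> (nat \<times> nat \<Rightarrow> nat \<Rightarrow> int) monoid" where
  "padic_mat p n = product_group ({..<n} \<times> {..<n}) (\<lambda>_. add_monoid (padic_int p))"

definition padic_mat_topology :: "nat \<Rightarrow> nat \<Rightarrow> (nat \<times> nat \<Rightarrow> nat \<Rightarrow> int) topology" where
  "padic_mat_topology p n = product_topology (\<lambda>_. padic_topology p) ({..<n} \<times> {..<n})"

definition padic_mult_mat_vec ::
    "nat \<Rightarrow> nat \<Rightarrow> (nat \<times> nat \<Rightarrow> nat \<Rightarrow> int) \<Rightarrow> (nat \<Rightarrow> nat \<Rightarrow> int) \<Rightarrow> nat \<Rightarrow> nat \<Rightarrow> int" where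
  "padic_mult_mat_vec p n M v =
     (\<lambda>i\<in>{..<n}. \<Oplus>\<^bsub>padic_int p\<^esub>j\<in>{..<n}. M (i, j) \<otimes>\<^bsub>padic_int p\<^esub> v j)"

definition cok :: "nat \<Rightarrow> nat \<Rightarrow> (nat \<times> nat \<Rightarrow> nat \<Rightarrow> int) \<Rightarrow> (nat \<Rightarrow> nat \<Rightarrow> int) set monoid" where
  "cok p n M = padic_vec p n Mod (padic_mult_mat_vec p n M ` carrier (padic_vec p n))"


section \<open>The p-rank\<close>

text \<open>
  For a commutative group \<open>N\<close>, written multiplicatively, \<open>mod_p p N\<close> is \<open>N/pN\<close> with its vector
  space structure over \<open>residue_ring p\<close>, that is \<open>\<int>/p\<int>\<close>. The scalar \<open>a\<close> acts by the \<open>a\<close>-fold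
  group operation. The fields \<open>monoid.mult\<close> and \<open>one\<close> exist only because module records
  extend ring records; they play no role in a module.
\<close>

definition mod_p :: "nat \<Rightarrow> 'a monoid \<Rightarrow> (int, 'a set) module" where
  "mod_p p N =
     (let V = N Mod ((\<lambda>x. x [^]\<^bsub>N\<^esub> p) ` carrier N)
      in \<lparr>carrier = carrier V, monoid.mult = undefined, one = undefined,
          ring.zero = \<one>\<^bsub>V\<^esub>, ring.add = (\<otimes>\<^bsub>V\<^esub>), smult = (\<lambda>a x. x [^]\<^bsub>V\<^esub> a)\<rparr>)"

definition p_rank :: "nat \<Rightarrow> 'a monoid \<Rightarrow> nat" where
  "p_rank p N = vectorspace.dim (residue_ring (int p)) (mod_p p N)"


section \<open>Haar probability measure\<close>

definition haar_probability ::
    "('a, 'b) monoid_scheme \<Rightarrow> 'a topology \<Rightarrow> 'a measure \<Rightarrow> bool" where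
  "haar_probability G T \<mu> \<longleftrightarrow>
     prob_space \<mu> \<and>
     sets \<mu> = sigma_sets (carrier G) {U. openin T U} \<and>
     (\<forall>g\<in>carrier G. \<forall>S\<in>sets \<mu>. emeasure \<mu> ((\<lambda>x. g \<otimes>\<^bsub>G\<^esub> x) ` S) = emeasure \<mu> S)"

text \<open>Existence and uniqueness are established at the end of this theory.\<close>

definition padic_mat_haar :: "nat \<Rightarrow> nat \<Rightarrow> (nat \<times> nat \<Rightarrow> nat \<Rightarrow> int) measure" where
  "padic_mat_haar p n = (THE \<mu>. haar_probability (padic_mat p n) (padic_mat_topology p n) \<mu>)"


section \<open>Finite abelian p-groups\<close>

definition finite_abelian_p_group :: "nat \<Rightarrow> 'a monoid \<Rightarrow> bool" where
  "finite_abelian_p_group p H \<longleftrightarrow>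
     comm_group H \<and> finite (carrier H) \<and> (\<exists>k. order H = p ^ k)"


section \<open>The vector space \<open>N/pN\<close>\<close>

lemma subgroup_pow_image:
  fixes p :: nat
  assumes "comm_group N"
  shows "subgroup ((\<lambda>x. x [^]\<^bsub>N\<^esub> p) ` carrier N) N"
proof -
  interpret comm_group N by fact
  have "group_hom N N (\<lambda>x. x [^]\<^bsub>N\<^esub> p)"
    by unfold_locales (auto simp: hom_def nat_pow_distrib)
  then show ?thesis by (rule group_hom.img_is_subgroup)
qed

lemma mod_p_vectorspace:
  assumes "prime p" "comm_group N"
  shows "vectorspace (residue_ring (int p)) (mod_p p N)"
proof -
  interpret R: residues_prime p "residue_ring (int p)"
    using assms(1) by unfold_locales simp_all
  define P where "P = (\<lambda>x. x [^]\<^bsub>N\<^esub> p) ` carrier N"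
  have P: "subgroup P N" unfolding P_def by (rule subgroup_pow_image[OF assms(2)])
  interpret N: comm_group N by fact
  interpret P: normal P N using P by (simp add: N.normal_iff_subgroup)
  interpret V: comm_group "N Mod P" by (rule N.abelian_FactGroup[OF P])
  have V: "mod_p p N = \<lparr>carrier = carrier (N Mod P), monoid.mult = undefined, one = undefined,
      ring.zero = \<one>\<^bsub>N Mod P\<^esub>, ring.add = (\<otimes>\<^bsub>N Mod P\<^esub>), smult = (\<lambda>a x. x [^]\<^bsub>N Mod P\<^esub> a)\<rparr>"
    by (simp add: mod_p_def P_def Let_def)
  have period: "x [^]\<^bsub>N Mod P\<^esub> int p = \<one>\<^bsub>N Mod P\<^esub>" if x: "x \<in> carrier (N Mod P)" for x
  proof -
    obtain a where a: "a \<in> carrier N" "x = P #>\<^bsub>N\<^esub> a" using x by (auto simp: carrier_FactGroup)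
    have "x [^]\<^bsub>N Mod P\<^esub> int p = P #>\<^bsub>N\<^esub> (a [^]\<^bsub>N\<^esub> p)"
      using P.FactGroup_pow[OF a(1), of p] by (simp add: a(2) int_pow_int)
    also have "\<dots> = P"
      using a(1) P by (intro P.rcos_const) (auto simp: P_def)
    finally show ?thesis by simp
  qed
  have reduce: "x [^]\<^bsub>N Mod P\<^esub> (a mod int p) = x [^]\<^bsub>N Mod P\<^esub> a"
    if x: "x \<in> carrier (N Mod P)" for x a
  proof -
    have "x [^]\<^bsub>N Mod P\<^esub> a = x [^]\<^bsub>N Mod P\<^esub> (int p * (a div int p) + a mod int p)" by simp
    also have "\<dots> = (x [^]\<^bsub>N Mod P\<^esub> int p) [^]\<^bsub>N Mod P\<^esub> (a div int p) \<otimes>\<^bsub>N Mod P\<^esub> x [^]\<^bsub>N Mod P\<^esub> (a mod int p)"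
      by (simp only: V.int_pow_mult[OF x] V.int_pow_pow[OF x])
    also have "\<dots> = x [^]\<^bsub>N Mod P\<^esub> (a mod int p)"
      unfolding period[OF x] V.int_pow_one by (rule V.l_one[OF V.int_pow_closed[OF x]])
    finally show ?thesis ..
  qed
  have "module (residue_ring (int p)) (mod_p p N)"
  proof (rule moduleI)
    show "cring (residue_ring (int p))" by (rule R.cring)
    show "abelian_group (mod_p p N)"
    proof (rule abelian_groupI)
      show "\<exists>y\<in>carrier (mod_p p N). y \<oplus>\<^bsub>mod_p p N\<^esub> x = \<zero>\<^bsub>mod_p p N\<^esub>"
        if "x \<in> carrier (mod_p p N)" for x
        using V.inv_closed[of x] V.l_inv[of x] that unfolding V by auto
    qed (use V.m_closed V.one_closed V.m_assoc V.m_comm V.l_one in \<open>auto simp: V simp del: one_FactGroup mult_FactGroup\<close>)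
  qed (auto simp: V residue_ring_def reduce V.int_pow_mult V.int_pow_distrib V.int_pow_pow mult.commute
      simp del: one_FactGroup mult_FactGroup)
  then show ?thesis by (intro vectorspace.intro R.field_axioms)
qed


section \<open>Ring and group structure\<close>

lemma padic_int_iff:
  "x \<in> carrier (padic_int p) \<longleftrightarrow> (\<forall>k. 0 \<le> x k \<and> x k < int p ^ k \<and> x (Suc k) mod int p ^ k = x k)"
  by (auto simp: padic_int_def)

lemma padic_int_level:
  assumes "x \<in> carrier (padic_int p)" "j \<le> k"
  shows "x k mod int p ^ j = x j"
  using assms(2)
proof (induction k rule: dec_induct)
  case base
  then show ?case using assms(1) by (simp add: padic_int_iff)
next
  case (step k)
  have "x (Suc k) mod int p ^ j = x (Suc k) mod int p ^ k mod int p ^ j"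
    using step.hyps by (simp add: mod_mod_cancel le_imp_power_dvd)
  then show ?case using step.IH assms(1) by (simp add: padic_int_iff)
qed

lemma padic_int_closed_aux:
  assumes "p > 0" "\<And>k. f (Suc k) mod int p ^ k = f k mod int p ^ k"
  shows "(\<lambda>k. f k mod int p ^ k) \<in> carrier (padic_int p)"
  using assms by (auto simp: padic_int_iff mod_mod_cancel)

lemma padic_int_cring:
  assumes "p > 0"
  shows "cring (padic_int p)"
proof (intro cringI abelian_groupI comm_monoidI)
  show "x \<oplus>\<^bsub>padic_int p\<^esub> y \<in> carrier (padic_int p)"
    if "x \<in> carrier (padic_int p)" "y \<in> carrier (padic_int p)" for x y
    using padic_int_closed_aux[OF assms, of "\<lambda>k. x k + y k"] that
    by (simp add: padic_int_def) (metis mod_add_eq)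
  show "x \<otimes>\<^bsub>padic_int p\<^esub> y \<in> carrier (padic_int p)"
    if "x \<in> carrier (padic_int p)" "y \<in> carrier (padic_int p)" for x y
    using padic_int_closed_aux[OF assms, of "\<lambda>k. x k * y k"] that
    by (simp add: padic_int_def) (metis mod_mult_eq)
  show "\<one>\<^bsub>padic_int p\<^esub> \<in> carrier (padic_int p)"
    using padic_int_closed_aux[OF assms, of "\<lambda>k. 1"] by (simp add: padic_int_def)
  show "\<zero>\<^bsub>padic_int p\<^esub> \<in> carrier (padic_int p)"
    using assms by (simp add: padic_int_def)
  show "\<exists>y\<in>carrier (padic_int p). y \<oplus>\<^bsub>padic_int p\<^esub> x = \<zero>\<^bsub>padic_int p\<^esub>"
    if "x \<in> carrier (padic_int p)" for x
  proof
    show "(\<lambda>k. (- x k) mod int p ^ k) \<in> carrier (padic_int p)"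
      using padic_int_closed_aux[OF assms, of "\<lambda>k. - x k"] that
      by (simp add: padic_int_iff) (metis mod_minus_eq)
    show "(\<lambda>k. (- x k) mod int p ^ k) \<oplus>\<^bsub>padic_int p\<^esub> x = \<zero>\<^bsub>padic_int p\<^esub>"
      by (simp add: padic_int_def mod_add_left_eq)
  qed
  show "\<zero>\<^bsub>padic_int p\<^esub> \<oplus>\<^bsub>padic_int p\<^esub> x = x" if "x \<in> carrier (padic_int p)" for x
    using that by (auto simp: padic_int_def)
  show "\<one>\<^bsub>padic_int p\<^esub> \<otimes>\<^bsub>padic_int p\<^esub> x = x" if "x \<in> carrier (padic_int p)" for x
    using that by (auto simp: padic_int_def mod_mult_left_eq)
qed (auto simp: padic_int_def fun_eq_iff mod_simps algebra_simps)

lemma cok_comm_group: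
  assumes "p > 0" "M \<in> carrier (padic_mat p n)"
  shows "comm_group (cok p n M)"
proof -
  interpret R: cring "padic_int p" by (rule padic_int_cring[OF assms(1)])
  let ?V = "padic_vec p n"
  have car: "carrier ?V = (\<Pi>\<^sub>E i\<in>{..<n}. carrier (padic_int p))"
    by (simp add: padic_vec_def)
  have V: "comm_group ?V"
  proof (rule group.group_comm_groupI)
    show "group ?V" unfolding padic_vec_def by (rule product_group) (rule R.a_group)
  qed (auto simp: padic_vec_def PiE_iff R.a_comm intro!: restrict_ext)
  interpret V: comm_group ?V by (rule V)
  have M: "M (i, j) \<in> carrier (padic_int p)" if "i < n" "j < n" for i j
    using assms(2) that by (auto simp: padic_mat_def)
  have "group_hom ?V ?V (padic_mult_mat_vec p n M)"
  proof (unfold_locales, rule homI)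
    fix x y assume x: "x \<in> carrier ?V" and y: "y \<in> carrier ?V"
    have xy: "x j \<in> carrier (padic_int p)" "y j \<in> carrier (padic_int p)" if "j < n" for j
      using x y that by (auto simp: car)
    show "padic_mult_mat_vec p n M x \<in> carrier ?V"
      using M xy by (auto simp: padic_mult_mat_vec_def car intro!: R.finsum_closed)
    have "(\<Oplus>\<^bsub>padic_int p\<^esub>j\<in>{..<n}. M (i, j) \<otimes>\<^bsub>padic_int p\<^esub> (x \<otimes>\<^bsub>?V\<^esub> y) j) =
        (\<Oplus>\<^bsub>padic_int p\<^esub>j\<in>{..<n}. M (i, j) \<otimes>\<^bsub>padic_int p\<^esub> x j) \<oplus>\<^bsub>padic_int p\<^esub>
        (\<Oplus>\<^bsub>padic_int p\<^esub>j\<in>{..<n}. M (i, j) \<otimes>\<^bsub>padic_int p\<^esub> y j)" if i: "i < n" for i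
    proof -
      have "(\<Oplus>\<^bsub>padic_int p\<^esub>j\<in>{..<n}. M (i, j) \<otimes>\<^bsub>padic_int p\<^esub> (x \<otimes>\<^bsub>?V\<^esub> y) j) =
          (\<Oplus>\<^bsub>padic_int p\<^esub>j\<in>{..<n}. M (i, j) \<otimes>\<^bsub>padic_int p\<^esub> x j \<oplus>\<^bsub>padic_int p\<^esub>
            M (i, j) \<otimes>\<^bsub>padic_int p\<^esub> y j)"
        using M[OF i] xy by (intro R.finsum_cong') (auto simp: padic_vec_def R.r_distr)
      also have "\<dots> = (\<Oplus>\<^bsub>padic_int p\<^esub>j\<in>{..<n}. M (i, j) \<otimes>\<^bsub>padic_int p\<^esub> x j) \<oplus>\<^bsub>padic_int p\<^esub>
          (\<Oplus>\<^bsub>padic_int p\<^esub>j\<in>{..<n}. M (i, j) \<otimes>\<^bsub>padic_int p\<^esub> y j)"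
        using M[OF i] xy by (intro R.finsum_addf) auto
      finally show ?thesis .
    qed
    then show "padic_mult_mat_vec p n M (x \<otimes>\<^bsub>?V\<^esub> y) =
        padic_mult_mat_vec p n M x \<otimes>\<^bsub>?V\<^esub> padic_mult_mat_vec p n M y"
      by (auto simp: padic_mult_mat_vec_def padic_vec_def intro!: restrict_ext)
  qed
  then show ?thesis
    unfolding cok_def by (intro V.abelian_FactGroup group_hom.img_is_subgroup)
qed


section \<open>Existence and uniqueness of the Haar probability measure\<close>

lemma topspace_padic: "topspace (padic_topology p) = carrier (padic_int p)"
  by (auto simp: padic_topology_def padic_int_def)

lemma openin_padic_level: "openin (padic_topology p) {y \<in> carrier (padic_int p). y k = a}"
proof -
  have "continuous_map (product_topology (\<lambda>k. discrete_topology {0..<int p ^ k}) UNIV)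
      (discrete_topology {0..<int p ^ k}) (\<lambda>x. x k)"
    by (rule continuous_map_product_projection) simp
  from openin_continuous_map_preimage[OF this, of "{a} \<inter> {0..<int p ^ k}"]
  have "openin (product_topology (\<lambda>k. discrete_topology {0..<int p ^ k}) UNIV)
      {x \<in> (\<Pi>\<^sub>E k\<in>UNIV. {0..<int p ^ k}). x k \<in> {a} \<inter> {0..<int p ^ k}}"
    by simp
  moreover have "{y \<in> carrier (padic_int p). y k = a} =
      {x \<in> (\<Pi>\<^sub>E k\<in>UNIV. {0..<int p ^ k}). x k \<in> {a} \<inter> {0..<int p ^ k}} \<inter> carrier (padic_int p)"
    by (auto simp: padic_int_def)
  ultimately show ?thesis
    unfolding padic_topology_def openin_subtopology by blast
qed

lemma openin_padic_imp_level:
  assumes "openin (padic_topology p) V" "x \<in> V"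
  shows "\<exists>k. {y \<in> carrier (padic_int p). y k = x k} \<subseteq> V"
proof -
  obtain W where W: "openin (product_topology (\<lambda>k. discrete_topology {0..<int p ^ k}) UNIV) W"
    "V = W \<inter> carrier (padic_int p)"
    using assms(1) by (auto simp: padic_topology_def openin_subtopology)
  then obtain U where U: "finite {i \<in> UNIV. U i \<noteq> topspace (discrete_topology {0..<int p ^ i})}"
    "x \<in> Pi\<^sub>E UNIV U" "Pi\<^sub>E UNIV U \<subseteq> W"
    using assms(2) unfolding openin_product_topology_alt by blast
  define k where "k = Max (insert 0 {i. U i \<noteq> {0..<int p ^ i}})"
  have fin: "finite (insert 0 {i. U i \<noteq> {0..<int p ^ i}})" using U(1) by simp
  have "y \<in> Pi\<^sub>E UNIV U" if y: "y \<in> carrier (padic_int p)" "y k = x k" for y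
  proof -
    have "y i \<in> U i" for i
    proof (cases "U i = {0..<int p ^ i}")
      case True
      then show ?thesis using y by (simp add: padic_int_iff)
    next
      case False
      then have "i \<le> k" unfolding k_def by (intro Max_ge[OF fin]) simp
      then have "y i = x i"
        using y assms(2) W(2) padic_int_level by (metis IntD2)
      then show ?thesis using U(2) by auto
    qed
    then show ?thesis by (simp add: PiE_iff)
  qed
  then show ?thesis using U(3) W(2) by blast
qed

text \<open>The additive group of \<open>\<int>\<^sub>p\<^sup>I\<close> for a finite index set \<open>I\<close>.\<close>

definition padic_prod :: "nat \<Rightarrow> 'i set \<Rightarrow> ('i \<Rightarrow> nat \<Rightarrow> int) monoid" where
  "padic_prod p I = product_group I (\<lambda>_. add_monoid (padic_int p))"

definition padic_cyl :: "nat \<Rightarrow> 'i set \<Rightarrow> nat \<Rightarrow> ('i \<Rightarrow> nat \<Rightarrow> int) \<Rightarrow> ('i \<Rightarrow> nat \<Rightarrow> int) set" where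
  "padic_cyl p I k A = {M \<in> carrier (padic_prod p I). \<forall>i\<in>I. M i k = A i k}"

definition padic_cyls :: "nat \<Rightarrow> 'i set \<Rightarrow> nat \<Rightarrow> ('i \<Rightarrow> nat \<Rightarrow> int) set set" where
  "padic_cyls p I k = padic_cyl p I k ` carrier (padic_prod p I)"

lemma padic_prod_carrier: "carrier (padic_prod p I) = (\<Pi>\<^sub>E i\<in>I. carrier (padic_int p))"
  by (simp add: padic_prod_def)

lemma padic_prod_group:
  assumes "p > 0"
  shows "group (padic_prod p I)"
proof -
  interpret cring "padic_int p" by (rule padic_int_cring[OF assms])
  show ?thesis unfolding padic_prod_def by (rule product_group) (rule a_group)
qed

lemma padic_prod_mult_level:
  "i \<in> I \<Longrightarrow> (x \<otimes>\<^bsub>padic_prod p I\<^esub> y) i k = (x i k + y i k) mod int p ^ k"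
  by (simp add: padic_prod_def padic_int_def)

lemma padic_prod_level_mod:
  "x \<in> carrier (padic_prod p I) \<Longrightarrow> i \<in> I \<Longrightarrow> x i k mod int p ^ k = x i k"
  unfolding padic_prod_carrier by (metis PiE_mem padic_int_level order_refl)

lemma padic_cyl_translate:
  assumes "p > 0" "g \<in> carrier (padic_prod p I)" "A \<in> carrier (padic_prod p I)"
  shows "(\<lambda>x. g \<otimes>\<^bsub>padic_prod p I\<^esub> x) ` padic_cyl p I k A = padic_cyl p I k (g \<otimes>\<^bsub>padic_prod p I\<^esub> A)"
proof -
  interpret G: group "padic_prod p I" by (rule padic_prod_group[OF assms(1)])
  have *: "g \<otimes>\<^bsub>padic_prod p I\<^esub> M \<in> padic_cyl p I k (g \<otimes>\<^bsub>padic_prod p I\<^esub> A)"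
    if "M \<in> padic_cyl p I k A" "g \<in> carrier (padic_prod p I)" for g M A
    using that by (auto simp: padic_cyl_def padic_prod_mult_level)
  show ?thesis
  proof (intro equalityI subsetI)
    fix M assume M: "M \<in> padic_cyl p I k (g \<otimes>\<^bsub>padic_prod p I\<^esub> A)"
    then have Mc: "M \<in> carrier (padic_prod p I)" by (simp add: padic_cyl_def)
    have "inv\<^bsub>padic_prod p I\<^esub> g \<otimes>\<^bsub>padic_prod p I\<^esub> M \<in>
        padic_cyl p I k (inv\<^bsub>padic_prod p I\<^esub> g \<otimes>\<^bsub>padic_prod p I\<^esub> (g \<otimes>\<^bsub>padic_prod p I\<^esub> A))"
      using *[OF M] assms by simp
    also have "inv\<^bsub>padic_prod p I\<^esub> g \<otimes>\<^bsub>padic_prod p I\<^esub> (g \<otimes>\<^bsub>padic_prod p I\<^esub> A) = A"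
      using assms by (simp add: G.m_assoc[symmetric])
    finally show "M \<in> (\<lambda>x. g \<otimes>\<^bsub>padic_prod p I\<^esub> x) ` padic_cyl p I k A"
      using assms Mc
      by (intro image_eqI[where x="inv\<^bsub>padic_prod p I\<^esub> g \<otimes>\<^bsub>padic_prod p I\<^esub> M"])
        (simp_all add: G.m_assoc[symmetric])
  qed (use * assms in auto)
qed

lemma padic_cyls_finite:
  assumes "finite I"
  shows "finite (padic_cyls p I k)"
proof -
  have "padic_cyls p I k \<subseteq>
      (\<lambda>a. {M \<in> carrier (padic_prod p I). \<forall>i\<in>I. M i k = a i}) ` (\<Pi>\<^sub>E i\<in>I. {0..<int p ^ k})"
  proof
    fix S assume "S \<in> padic_cyls p I k"
    then obtain A where A: "A \<in> carrier (padic_prod p I)" "S = padic_cyl p I k A"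
      by (auto simp: padic_cyls_def)
    show "S \<in> (\<lambda>a. {M \<in> carrier (padic_prod p I). \<forall>i\<in>I. M i k = a i}) ` (\<Pi>\<^sub>E i\<in>I. {0..<int p ^ k})"
      using A by (intro image_eqI[where x="\<lambda>i\<in>I. A i k"])
        (auto simp: padic_cyl_def padic_prod_carrier PiE_iff padic_int_iff)
  qed
  then show ?thesis
    by (rule finite_subset) (intro finite_imageI finite_PiE assms, simp)
qed

lemma padic_cyls_Union: "\<Union>(padic_cyls p I k) = carrier (padic_prod p I)"
  by (auto simp: padic_cyls_def padic_cyl_def)

lemma padic_cyl_self: "A \<in> carrier (padic_prod p I) \<Longrightarrow> A \<in> padic_cyl p I k A"
  by (simp add: padic_cyl_def)

lemma padic_cyl_eq: "M \<in> padic_cyl p I k A \<Longrightarrow> padic_cyl p I k M = padic_cyl p I k A"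
  by (auto simp: padic_cyl_def)

lemma padic_cyl_mono:
  assumes "j \<le> k" "A \<in> carrier (padic_prod p I)"
  shows "padic_cyl p I k A \<subseteq> padic_cyl p I j A"
proof
  fix M assume M: "M \<in> padic_cyl p I k A"
  have "M i j = A i j" if "i \<in> I" for i
    using M assms that padic_int_level[of "M i" p j k] padic_int_level[of "A i" p j k]
    by (auto simp: padic_cyl_def padic_prod_carrier PiE_iff)
  then show "M \<in> padic_cyl p I j A" using M by (simp add: padic_cyl_def)
qed

lemma openin_padic_cyl:
  assumes "finite I"
  shows "openin (product_topology (\<lambda>_. padic_topology p) I) (padic_cyl p I k A)"
proof -
  have "padic_cyl p I k A = (\<Pi>\<^sub>E i\<in>I. {y \<in> carrier (padic_int p). y k = A i k})"
    by (auto simp: padic_cyl_def padic_prod_carrier PiE_iff extensional_def)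
  then show ?thesis
    by (simp add: openin_PiE_gen assms openin_padic_level)
qed

lemma openin_imp_padic_cyl:
  assumes "finite I" "openin (product_topology (\<lambda>_. padic_topology p) I) U" "A \<in> U"
  shows "\<exists>k. padic_cyl p I k A \<subseteq> U"
proof -
  have Ac: "A \<in> carrier (padic_prod p I)"
    using openin_subset[OF assms(2)] assms(3) by (auto simp: topspace_padic padic_prod_carrier)
  have "\<exists>V. finite {i \<in> I. V i \<noteq> topspace (padic_topology p)} \<and>
      (\<forall>i\<in>I. openin (padic_topology p) (V i)) \<and> A \<in> Pi\<^sub>E I V \<and> Pi\<^sub>E I V \<subseteq> U"
    using openin_product_topology_alt[THEN iffD1, OF assms(2)] assms(3) by (rule bspec)
  then obtain V where V: "\<And>i. i \<in> I \<Longrightarrow> openin (padic_topology p) (V i)" "A \<in> Pi\<^sub>E I V" "Pi\<^sub>E I V \<subseteq> U"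
    by auto
  have "\<forall>i\<in>I. \<exists>k. {y \<in> carrier (padic_int p). y k = A i k} \<subseteq> V i"
    using V by (intro ballI openin_padic_imp_level) auto
  from bchoice[OF this] obtain k
    where "\<forall>i\<in>I. {y \<in> carrier (padic_int p). y (k i) = A i (k i)} \<subseteq> V i" ..
  then have k: "{y \<in> carrier (padic_int p). y (k i) = A i (k i)} \<subseteq> V i" if "i \<in> I" for i
    using that by (rule bspec)
  have "padic_cyl p I (Max (insert 0 (k ` I))) A \<subseteq> Pi\<^sub>E I V"
  proof
    fix M assume M: "M \<in> padic_cyl p I (Max (insert 0 (k ` I))) A"
    have "M i \<in> V i" if i: "i \<in> I" for i
    proof -
      have "k i \<le> Max (insert 0 (k ` I))" using i assms(1) by (intro Max_ge) auto
      then have "M \<in> padic_cyl p I (k i) A" using padic_cyl_mono[OF _ Ac] M by blast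
      then show ?thesis
        using k[OF i] i by (auto simp: padic_cyl_def padic_prod_carrier)
    qed
    then show "M \<in> Pi\<^sub>E I V" using M by (auto simp: padic_cyl_def padic_prod_carrier PiE_iff)
  qed
  then show ?thesis using V(3) by blast
qed

definition padic_basis :: "nat \<Rightarrow> 'i set \<Rightarrow> ('i \<Rightarrow> nat \<Rightarrow> int) set set" where
  "padic_basis p I = insert {} (\<Union>k. padic_cyls p I k)"

lemma padic_basis_Pow: "padic_basis p I \<subseteq> Pow (carrier (padic_prod p I))"
  by (auto simp: padic_basis_def padic_cyls_def padic_cyl_def)

lemma padic_borel_generator:
  assumes "finite I"
  shows "sigma_sets (carrier (padic_prod p I)) {U. openin (product_topology (\<lambda>_. padic_topology p) I) U} =
    sigma_sets (carrier (padic_prod p I)) (padic_basis p I)"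
proof (rule sigma_sets_eqI)
  fix U assume "U \<in> {U. openin (product_topology (\<lambda>_. padic_topology p) I) U}"
  then have U: "openin (product_topology (\<lambda>_. padic_topology p) I) U" by simp
  have "U = \<Union>{S \<in> padic_basis p I. S \<subseteq> U}"
  proof (intro equalityI subsetI)
    fix A assume A: "A \<in> U"
    then have Ac: "A \<in> carrier (padic_prod p I)"
      using openin_subset[OF U] by (auto simp: topspace_padic padic_prod_carrier)
    obtain k where "padic_cyl p I k A \<subseteq> U" using openin_imp_padic_cyl[OF assms U A] by blast
    then show "A \<in> \<Union>{S \<in> padic_basis p I. S \<subseteq> U}"
      using Ac padic_cyl_self[OF Ac, of k] by (auto simp: padic_basis_def padic_cyls_def)
  qed auto
  moreover have "countable (padic_basis p I)"
    unfolding padic_basis_def using padic_cyls_finite[OF assms] by (auto intro: countable_finite)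
  then have "countable {S \<in> padic_basis p I. S \<subseteq> U}"
    by (rule countable_subset[rotated]) auto
  ultimately show "U \<in> sigma_sets (carrier (padic_prod p I)) (padic_basis p I)"
    by (metis (no_types, lifting) mem_Collect_eq sigma_sets.Basic sigma_sets_UNION)
next
  fix S assume "S \<in> padic_basis p I"
  then show "S \<in> sigma_sets (carrier (padic_prod p I))
      {U. openin (product_topology (\<lambda>_. padic_topology p) I) U}"
    using openin_padic_cyl[OF assms, of p] by (auto simp: padic_basis_def padic_cyls_def)
qed

lemma padic_basis_Int_stable: "Int_stable (padic_basis p I)"
proof (rule Int_stableI)
  fix S T assume ST: "S \<in> padic_basis p I" "T \<in> padic_basis p I"
  show "S \<inter> T \<in> padic_basis p I"
  proof (cases "S \<inter> T = {}")
    case False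
    then obtain M where MST: "M \<in> S" "M \<in> T" by blast
    obtain j A where S: "S = padic_cyl p I j A"
      using ST(1) MST(1) by (auto simp: padic_basis_def padic_cyls_def)
    obtain k B where T: "T = padic_cyl p I k B"
      using ST(2) MST(2) by (auto simp: padic_basis_def padic_cyls_def)
    note M = MST S T
    then have Mc: "M \<in> carrier (padic_prod p I)" by (simp add: padic_cyl_def)
    have "S = padic_cyl p I j M" "T = padic_cyl p I k M"
      using M padic_cyl_eq by blast+
    then have "S \<inter> T = padic_cyl p I (max j k) M"
      using padic_cyl_mono[of j k M p I] padic_cyl_mono[of k j M p I] Mc
      by (cases "j \<le> k") (auto simp: max_def)
    then show ?thesis using Mc by (auto simp: padic_basis_def padic_cyls_def)
  qed (simp add: padic_basis_def)
qed

lemma padic_measure_eqI: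
  assumes "finite I" "p > 0" "prob_space M"
    and sets: "sets M = sigma_sets (carrier (padic_prod p I)) (padic_basis p I)"
      "sets N = sigma_sets (carrier (padic_prod p I)) (padic_basis p I)"
    and eq: "\<And>A k. A \<in> carrier (padic_prod p I) \<Longrightarrow>
      emeasure M (padic_cyl p I k A) = emeasure N (padic_cyl p I k A)"
  shows "M = N"
proof (rule measure_eqI_generator_eq_countable[OF padic_basis_Int_stable padic_basis_Pow])
  show "padic_cyls p I 0 \<subseteq> padic_basis p I" by (auto simp: padic_basis_def)
  show "\<Union>(padic_cyls p I 0) = carrier (padic_prod p I)" by (rule padic_cyls_Union)
  show "countable (padic_cyls p I 0)" using padic_cyls_finite[OF assms(1)] by (rule countable_finite)
  interpret prob_space M by fact
  show "emeasure M a \<noteq> \<infinity>" for a by simp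
qed (use eq sets in \<open>auto simp: padic_basis_def padic_cyls_def\<close>)

lemma haar_probability_cyl:
  assumes "finite I" "p > 0"
    and haar: "haar_probability (padic_prod p I) (product_topology (\<lambda>_. padic_topology p) I) M"
    and A: "A \<in> carrier (padic_prod p I)"
  shows "emeasure M (padic_cyl p I k A) = 1 / of_nat (card (padic_cyls p I k))"
proof -
  let ?G = "padic_prod p I"
  interpret G: group ?G by (rule padic_prod_group[OF assms(2)])
  interpret prob_space M using haar by (simp add: haar_probability_def)
  have sets: "sets M = sigma_sets (carrier ?G) (padic_basis p I)"
    using haar padic_borel_generator[OF assms(1)] by (simp add: haar_probability_def)
  have space: "space M = carrier ?G"
    using sets_eq_imp_space_eq[of M "sigma (carrier ?G) (padic_basis p I)"] sets
      padic_basis_Pow[of p I] by (simp add: sets_measure_of space_measure_of)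
  have meas: "padic_cyl p I k B \<in> sets M" if "B \<in> carrier ?G" for B
    unfolding sets using that by (auto simp: padic_basis_def padic_cyls_def)
  have eq: "emeasure M (padic_cyl p I k B) = emeasure M (padic_cyl p I k A)"
    if B: "B \<in> carrier ?G" for B
  proof -
    define g where "g = B \<otimes>\<^bsub>?G\<^esub> inv\<^bsub>?G\<^esub> A"
    have g: "g \<in> carrier ?G" "g \<otimes>\<^bsub>?G\<^esub> A = B"
      using A B by (simp_all add: g_def G.m_assoc)
    have "emeasure M ((\<lambda>x. g \<otimes>\<^bsub>?G\<^esub> x) ` padic_cyl p I k A) = emeasure M (padic_cyl p I k A)"
      using haar g(1) meas[OF A] by (simp add: haar_probability_def)
    then show ?thesis using padic_cyl_translate[OF assms(2) g(1) A, of k] g(2) by simp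
  qed
  have "1 = emeasure M (\<Union>(padic_cyls p I k))"
    using emeasure_space_1 by (simp add: space padic_cyls_Union)
  also have "\<dots> = (\<Sum>S\<in>padic_cyls p I k. emeasure M S)"
  proof -
    have "disjoint_family_on (\<lambda>S. S) (padic_cyls p I k)"
      unfolding disjoint_family_on_def padic_cyls_def using padic_cyl_eq by blast
    then show ?thesis
      using sum_emeasure[of "\<lambda>S. S" "padic_cyls p I k" M] meas padic_cyls_finite[OF assms(1), of p k]
      by (simp add: padic_cyls_def image_subset_iff)
  qed
  also have "\<dots> = (\<Sum>S\<in>padic_cyls p I k. emeasure M (padic_cyl p I k A))"
    by (rule sum.cong) (auto simp: padic_cyls_def eq)
  finally have one: "1 = of_nat (card (padic_cyls p I k)) * emeasure M (padic_cyl p I k A)"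
    by simp
  have "card (padic_cyls p I k) \<noteq> 0"
    using one by (intro notI) simp
  then show ?thesis
    using ennreal_mult_divide_eq[of "of_nat (card (padic_cyls p I k))" "emeasure M (padic_cyl p I k A)"]
    by (simp add: one mult.commute)
qed

text \<open>The measure is realised by choosing all base-\<open>p\<close> digits independently and uniformly.\<close>

definition padic_of_digits :: "nat \<Rightarrow> (nat \<Rightarrow> int) \<Rightarrow> nat \<Rightarrow> int" where
  "padic_of_digits p d = (\<lambda>k. \<Sum>l<k. d l * int p ^ l)"

lemma padic_of_digits_bound:
  assumes "p > 0" "\<And>l. d l \<in> {0..<int p}"
  shows "padic_of_digits p d k \<in> {0..<int p ^ k}"
proof (induction k)
  case (Suc k)
  have "d k * int p ^ k \<le> (int p - 1) * int p ^ k" "0 \<le> d k * int p ^ k"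
    using assms(2)[of k] by (auto intro!: mult_right_mono)
  then show ?case using Suc by (auto simp: padic_of_digits_def algebra_simps)
qed (simp add: padic_of_digits_def)

lemma padic_of_digits_carrier:
  assumes "p > 0" "\<And>l. d l \<in> {0..<int p}"
  shows "padic_of_digits p d \<in> carrier (padic_int p)"
proof -
  have "padic_of_digits p d (Suc k) mod int p ^ k = padic_of_digits p d k" for k
    using padic_of_digits_bound[where k=k, OF assms] by (simp add: padic_of_digits_def)
  then show ?thesis using padic_of_digits_bound[OF assms] by (simp add: padic_int_iff)
qed

lemma padic_of_digits_eq_iff:
  assumes "p > 0" "\<And>l. d l \<in> {0..<int p}" "x \<in> carrier (padic_int p)"
  shows "padic_of_digits p d k = x k \<longleftrightarrow> (\<forall>l<k. d l = x (Suc l) div int p ^ l)"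
proof (induction k)
  case 0
  then show ?case using assms(3) by (auto simp: padic_of_digits_def padic_int_iff dest: spec[of _ 0])
next
  case (Suc k)
  have x: "x (Suc k) = x k + x (Suc k) div int p ^ k * int p ^ k"
    using assms(3) div_mult_mod_eq[of "x (Suc k)" "int p ^ k"] by (simp add: padic_int_iff)
  have S: "padic_of_digits p d (Suc k) = padic_of_digits p d k + d k * int p ^ k"
    by (simp add: padic_of_digits_def)
  have b: "padic_of_digits p d k \<in> {0..<int p ^ k}" by (rule padic_of_digits_bound[OF assms(1,2)])
  have "padic_of_digits p d (Suc k) = x (Suc k) \<longleftrightarrow>
      padic_of_digits p d k = x k \<and> d k = x (Suc k) div int p ^ k"
  proof
    assume eq: "padic_of_digits p d (Suc k) = x (Suc k)"
    have "padic_of_digits p d k = x (Suc k) mod int p ^ k"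
      using b by (simp add: eq[symmetric] S)
    moreover have "d k = x (Suc k) div int p ^ k"
      using b assms(1) by (simp add: eq[symmetric] S)
    ultimately show "padic_of_digits p d k = x k \<and> d k = x (Suc k) div int p ^ k"
      using assms(3) by (simp add: padic_int_iff)
  qed (use x S in simp)
  then show ?case using Suc by (auto simp: less_Suc_eq)
qed

lemma padic_digit_range:
  assumes "p > 0" "x \<in> carrier (padic_int p)"
  shows "x (Suc l) div int p ^ l \<in> {0..<int p}"
proof -
  have x: "0 \<le> x (Suc l)" "x (Suc l) < int p * int p ^ l"
    using assms(2) unfolding padic_int_iff by (metis, metis power_Suc)
  have "x (Suc l) div int p ^ l * int p ^ l \<le> x (Suc l)"
    using assms(1) by (simp add: div_times_less_eq_dividend minus_mod_eq_div_mult[symmetric])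
  with x(2) have "x (Suc l) div int p ^ l * int p ^ l < int p * int p ^ l" by linarith
  then have "x (Suc l) div int p ^ l < int p" by (rule mult_right_less_imp_less) simp
  moreover have "0 \<le> x (Suc l) div int p ^ l"
    using x(1) assms(1) by (simp add: pos_imp_zdiv_nonneg_iff)
  ultimately show ?thesis by simp
qed

lemma haar_probability_exists:
  fixes I :: "'i set"
  assumes "finite I" "p > 0"
  shows "\<exists>M. haar_probability (padic_prod p I) (product_topology (\<lambda>_. padic_topology p) I) M"
proof -
  let ?G = "padic_prod p I"
  let ?N = "sigma (carrier ?G) (padic_basis p I)"
  interpret G: group ?G by (rule padic_prod_group[OF assms(2)])
  define C where "C = uniform_count_measure {0..<int p}"
  define D where "D = (\<Pi>\<^sub>M i\<in>I \<times> (UNIV :: nat set). C)"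
  define \<phi> where "\<phi> = (\<lambda>d. \<lambda>i\<in>I. padic_of_digits p (\<lambda>l. d (i, l)))"
  have C: "prob_space C" unfolding C_def by (rule prob_space_uniform_count_measure) (use assms in auto)
  interpret P: product_prob_space "\<lambda>_. C" "I \<times> (UNIV :: nat set)"
    using C by (rule product_prob_spaceI)
  have setsC: "sets C = Pow {0..<int p}" by (simp add: C_def sets_uniform_count_measure)
  have spaceD: "space D = (\<Pi>\<^sub>E i\<in>I \<times> (UNIV :: nat set). {0..<int p})"
    by (simp add: D_def space_PiM C_def space_uniform_count_measure)
  have N: "sets ?N = sigma_sets (carrier ?G) (padic_basis p I)" "space ?N = carrier ?G"
    using padic_basis_Pow[of p I] by (simp_all add: sets_measure_of space_measure_of)
  have \<phi>_carrier: "\<phi> d \<in> carrier ?G" if "d \<in> space D" for d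
  proof -
    have "padic_of_digits p (\<lambda>l. d (i, l)) \<in> carrier (padic_int p)" if "i \<in> I" for i
      using \<open>d \<in> space D\<close> that by (intro padic_of_digits_carrier[OF assms(2)]) (auto simp: spaceD)
    then show ?thesis by (auto simp: \<phi>_def padic_prod_carrier)
  qed
  have vimage: "\<phi> -` padic_cyl p I k A \<inter> space D =
      {d \<in> space D. \<forall>i\<in>I \<times> {..<k}. d i \<in> {A (fst i) (Suc (snd i)) div int p ^ snd i}}"
    if A: "A \<in> carrier ?G" for A k
  proof -
    have "\<phi> d \<in> padic_cyl p I k A \<longleftrightarrow>
        (\<forall>i\<in>I \<times> {..<k}. d i \<in> {A (fst i) (Suc (snd i)) div int p ^ snd i})" if d: "d \<in> space D" for d
    proof -
      have "padic_of_digits p (\<lambda>l. d (i, l)) k = A i k \<longleftrightarrow>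
          (\<forall>l<k. d (i, l) = A i (Suc l) div int p ^ l)" if "i \<in> I" for i
        using d A that by (intro padic_of_digits_eq_iff[OF assms(2)])
          (auto simp: spaceD padic_prod_carrier)
      then show ?thesis using \<phi>_carrier[OF d] by (auto simp: padic_cyl_def \<phi>_def)
    qed
    then show ?thesis by blast
  qed
  have digit: "A (fst i) (Suc (snd i)) div int p ^ snd i \<in> {0..<int p}"
    if "A \<in> carrier ?G" "i \<in> I \<times> {..<k}" for A i k
    using that by (intro padic_digit_range[OF assms(2)]) (auto simp: padic_prod_carrier)
  have \<phi>: "\<phi> \<in> measurable D ?N"
  proof (rule measurable_measure_of)
    fix S assume "S \<in> padic_basis p I"
    then consider "S = {}" | A k where "A \<in> carrier ?G" "S = padic_cyl p I k A"
      by (auto simp: padic_basis_def padic_cyls_def)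
    then show "\<phi> -` S \<inter> space D \<in> sets D"
    proof cases
      case 2
      have "{d \<in> space D. d i \<in> {A (fst i) (Suc (snd i)) div int p ^ snd i}} \<in> sets D"
        if "i \<in> I \<times> {..<k}" for i
      proof -
        have "(\<lambda>d. d i) \<in> measurable D C"
          unfolding D_def using that by (intro measurable_component_singleton) auto
        then show ?thesis
          using measurable_sets[of "\<lambda>d. d i" D C "{A (fst i) (Suc (snd i)) div int p ^ snd i}"]
            digit[OF 2(1) that] setsC by (simp add: vimage_def Int_def conj_commute)
      qed
      then show ?thesis
        unfolding 2(2) vimage[OF 2(1)] using assms(1)
        by (intro sets.sets_Collect_finite_All) auto
    qed simp
  qed (use padic_basis_Pow \<phi>_carrier in auto)
  define M where "M = distr D ?N \<phi>"
  have D: "prob_space D" unfolding D_def by (rule P.P.prob_space_axioms)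
  have M: "prob_space M" unfolding M_def by (rule prob_space.prob_space_distr[OF D \<phi>])
  have Msets: "sets M = sigma_sets (carrier ?G) (padic_basis p I)" using N by (simp add: M_def)
  have Mspace: "space M = carrier ?G" using N by (simp add: M_def)
  have Mcyl: "emeasure M (padic_cyl p I k A) = (\<Prod>i\<in>I \<times> {..<k}. ennreal (1 / real p))"
    if A: "A \<in> carrier ?G" for A k
  proof -
    have "padic_cyl p I k A \<in> sets ?N"
      unfolding N using A by (auto simp: padic_basis_def padic_cyls_def)
    then have "emeasure M (padic_cyl p I k A) = emeasure D (\<phi> -` padic_cyl p I k A \<inter> space D)"
      unfolding M_def by (rule emeasure_distr[OF \<phi>])
    also have "\<dots> = (\<Prod>i\<in>I \<times> {..<k}. emeasure C {A (fst i) (Suc (snd i)) div int p ^ snd i})"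
      using assms(1) digit[OF A] setsC
      by (subst vimage[OF A], unfold D_def, intro P.emeasure_PiM_Collect) auto
    also have "\<dots> = (\<Prod>i\<in>I \<times> {..<k}. ennreal (1 / real p))"
      using digit[OF A, of _ k]
      by (intro prod.cong) (auto simp: C_def emeasure_uniform_count_measure)
    finally show ?thesis .
  qed
  have "emeasure M ((\<lambda>x. g \<otimes>\<^bsub>?G\<^esub> x) ` S) = emeasure M S"
    if g: "g \<in> carrier ?G" and S: "S \<in> sets M" for g S
  proof -
    let ?h = "inv\<^bsub>?G\<^esub> g"
    let ?T = "\<lambda>x. ?h \<otimes>\<^bsub>?G\<^esub> x"
    have vT: "?T -` S \<inter> carrier ?G = (\<lambda>x. g \<otimes>\<^bsub>?G\<^esub> x) ` S" if "S \<subseteq> carrier ?G" for S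
    proof (intro equalityI subsetI)
      fix x assume "x \<in> ?T -` S \<inter> carrier ?G"
      then show "x \<in> (\<lambda>x. g \<otimes>\<^bsub>?G\<^esub> x) ` S"
        using g by (intro image_eqI[where x="?T x"]) (simp_all add: G.m_assoc[symmetric])
    next
      fix x assume "x \<in> (\<lambda>x. g \<otimes>\<^bsub>?G\<^esub> x) ` S"
      then obtain s where s: "s \<in> S" "x = g \<otimes>\<^bsub>?G\<^esub> s" by blast
      then have "s \<in> carrier ?G" using that by blast
      then show "x \<in> ?T -` S \<inter> carrier ?G"
        using s g by (simp add: G.m_assoc[symmetric])
    qed
    have T: "?T \<in> measurable M M"
    proof -
      have "?T \<in> measurable M ?N"
      proof (rule measurable_measure_of)
        fix S assume B: "S \<in> padic_basis p I"
        then consider "S = {}" | A k where "A \<in> carrier ?G" "S = padic_cyl p I k A"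
          by (auto simp: padic_basis_def padic_cyls_def)
        then show "?T -` S \<inter> space M \<in> sets M"
        proof cases
          case 2
          have "S \<subseteq> carrier ?G" using B padic_basis_Pow by blast
          then have "?T -` S \<inter> space M = padic_cyl p I k (g \<otimes>\<^bsub>?G\<^esub> A)"
            using vT[of S] padic_cyl_translate[OF assms(2) g 2(1), of k] 2(2) by (simp add: Mspace)
          then show ?thesis unfolding Msets using g 2(1)
            by (auto simp: padic_basis_def padic_cyls_def)
        qed simp
      qed (use padic_basis_Pow g Mspace in auto)
      then show ?thesis using N Msets measurable_cong_sets[of M M M ?N] by simp
    qed
    have "M = distr M M ?T"
    proof (rule padic_measure_eqI[OF assms M Msets])
      show "sets (distr M M ?T) = sigma_sets (carrier ?G) (padic_basis p I)"
        using Msets by simp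
      fix A k assume A: "A \<in> carrier ?G"
      have c: "padic_cyl p I k A \<in> sets M"
        unfolding Msets using A by (auto simp: padic_basis_def padic_cyls_def)
      have "emeasure (distr M M ?T) (padic_cyl p I k A) = emeasure M (padic_cyl p I k (g \<otimes>\<^bsub>?G\<^esub> A))"
        using emeasure_distr[OF T c] vT[of "padic_cyl p I k A"] sets.sets_into_space[OF c]
          padic_cyl_translate[OF assms(2) g A] by (simp add: Mspace)
      then show "emeasure M (padic_cyl p I k A) = emeasure (distr M M ?T) (padic_cyl p I k A)"
        using Mcyl A g by simp
    qed
    then have "emeasure M S = emeasure M (?T -` S \<inter> space M)"
      using emeasure_distr[OF T S] by simp
    then show ?thesis using vT[of S] sets.sets_into_space[OF S] by (simp add: Mspace)
  qed
  then have "haar_probability ?G (product_topology (\<lambda>_. padic_topology p) I) M"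
    using M Msets padic_borel_generator[OF assms(1), of p] by (simp add: haar_probability_def)
  then show ?thesis ..
qed

lemma haar_probability_ex1:
  assumes "finite I" "p > 0"
  shows "\<exists>!M. haar_probability (padic_prod p I) (product_topology (\<lambda>_. padic_topology p) I) M"
proof (rule ex_ex1I[OF haar_probability_exists[OF assms]])
  fix M N
  assume MN: "haar_probability (padic_prod p I) (product_topology (\<lambda>_. padic_topology p) I) M"
    "haar_probability (padic_prod p I) (product_topology (\<lambda>_. padic_topology p) I) N"
  show "M = N"
  proof (rule padic_measure_eqI[OF assms])
    show "prob_space M"
      using MN(1) unfolding haar_probability_def by (rule conjunct1)
    show "sets M = sigma_sets (carrier (padic_prod p I)) (padic_basis p I)"
      using MN(1) unfolding haar_probability_def padic_borel_generator[OF assms(1)]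
      by (elim conjE)
    show "sets N = sigma_sets (carrier (padic_prod p I)) (padic_basis p I)"
      using MN(2) unfolding haar_probability_def padic_borel_generator[OF assms(1)]
      by (elim conjE)
    show "emeasure M (padic_cyl p I k A) = emeasure N (padic_cyl p I k A)"
      if "A \<in> carrier (padic_prod p I)" for A k
      unfolding haar_probability_cyl[OF assms MN(1) that] haar_probability_cyl[OF assms MN(2) that] ..
  qed
qed

theorem haar_probability_padic_mat:
  assumes "p > 0"
  shows "haar_probability (padic_mat p n) (padic_mat_topology p n) (padic_mat_haar p n)"
  using theI'[OF haar_probability_ex1[of "{..<n} \<times> {..<n}", OF _ assms]]
  by (simp add: padic_mat_haar_def padic_mat_def padic_prod_def padic_mat_topology_def)

end

theory Submission
  imports Defs "HOL-Real_Asymp.Real_Asymp"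
begin

text \<open>
  Fix \<open>k\<close> such that \<open>p\<^sup>k\<^sup>-\<^sup>1\<close> kills \<open>H\<^sub>1\<close> and \<open>H\<^sub>2\<close>. By Nakayama's lemma the event
  \<open>cok A \<cong> H\<^sub>j\<close> depends only on \<open>A\<close> modulo \<open>q = p\<^sup>k\<close>, so the probability is an average over
  matrices over \<open>\<int>/q\<int>\<close>. Both events are invariant under \<open>A \<mapsto> U A V\<close> for unimodular \<open>U\<close> and \<open>V\<close>, so
  \<open>B\<close> may be replaced by \<open>U B V\<close> with random \<open>U\<close> and \<open>V\<close>. By Plancherel and Cauchy-Schwarz the
  difference between the joint probability and the product of the two probabilities is at most
  the largest average over \<open>U, V\<close> of a nontrivial additive character at \<open>U B V\<close>. This is at most
  the proportion of vectors killed by \<open>B\<close> modulo \<open>p\<close>, which is \<open>p\<close> to the power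
  \<open>r\<^sub>p(cok B) - n\<close>, plus an exponentially small error.
  The law of a single cokernel comes from double counting the pairs of a matrix \<open>A\<close> and a
  surjection onto \<open>H\<close> whose kernel is the column space of \<open>A\<close>.
\<close>

section \<open>Finite Fourier analysis\<close>

text \<open>For a fixed \<open>B\<close> the two cokernel conditions are dependent, and the Fourier
  expansion of the joint probability has \<open>q^(n^2)\<close> terms, so a term-by-term bound is
  too weak. Parseval caps the total Fourier mass of an indicator at 1, which is why one uniform
  bound on nontrivial character averages suffices. The exponent \<open>k\<close> is chosen so that
  already \<open>p^(k-1)\<close>, not merely \<open>p^k\<close>, kills both groups. The spare factor
  \<open>p\<close> is used twice. It lets the inclusion of \<open>p^(k-1) V\<close> in
  \<open>A V + p^k V\<close> be iterated into its inclusion in \<open>A V\<close>. It also forces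
  the kernel of every surjection from \<open>(Z/q)^n\<close> onto \<open>H\<close> to contain the
  whole p-torsion, so all these kernels have p-rank exactly \<open>n\<close> and equally many
  generating \<open>n\<close>-tuples. In the limit law, the product of the factors
  \<open>1 - p^(-i)\<close> is the proportion of \<open>n\<close>-tuples that generate such a
  kernel, while the proportion of \<open>n\<close>-tuples generating \<open>H\<close> itself tends
  to 1.\<close>

definition mod_box :: "'i set \<Rightarrow> int \<Rightarrow> ('i \<Rightarrow> int) set" where
  "mod_box I q = (\<Pi>\<^sub>E i\<in>I. {0..<q})"

text \<open>The field of values is left open because events are averaged in the reals and characters
  in the complex numbers.\<close>

definition avg :: "'a set \<Rightarrow> ('a \<Rightarrow> 'b::real_normed_field) \<Rightarrow> 'b" where
  "avg S f = (\<Sum>x\<in>S. f x) / of_nat (card S)"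

definition echar :: "int \<Rightarrow> int \<Rightarrow> complex" where
  "echar q t = cis (2 * pi * of_int t / of_int q)"

lemma finite_mod_box [simp]: "finite I \<Longrightarrow> finite (mod_box I q)"
  by (simp add: mod_box_def finite_PiE)

lemma mod_box_nonempty: "q > 0 \<Longrightarrow> mod_box I q \<noteq> {}"
  by (simp add: mod_box_def PiE_eq_empty_iff)

lemma card_mod_box: "finite I \<Longrightarrow> card (mod_box I q) = nat q ^ card I"
  by (simp add: mod_box_def card_PiE)

lemma card_mod_box_pos: "finite I \<Longrightarrow> q > 0 \<Longrightarrow> card (mod_box I q) > 0"
  by (simp add: card_mod_box)

lemma mod_box_D: "x \<in> mod_box I q \<Longrightarrow> i \<in> I \<Longrightarrow> 0 \<le> x i \<and> x i < q"
  by (auto simp: mod_box_def)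

lemma mod_box_eqI:
  assumes "x \<in> mod_box I q" "y \<in> mod_box I q" "\<And>i. i \<in> I \<Longrightarrow> [x i = y i] (mod q)"
  shows "x = y"
proof (rule PiE_ext)
  show "x \<in> PiE I (\<lambda>_. {0..<q})" "y \<in> PiE I (\<lambda>_. {0..<q})" using assms by (auto simp: mod_box_def)
  show "x i = y i" if "i \<in> I" for i
    using assms(3)[OF that] mod_box_D[OF assms(1) that] mod_box_D[OF assms(2) that] by (simp add: cong_def)
qed

lemma avg_add: "avg S (\<lambda>x. f x + g x) = avg S f + avg S g"
  by (simp add: avg_def sum.distrib add_divide_distrib)

lemma avg_cmult: "avg S (\<lambda>x. c * f x) = c * avg S f"
  by (simp add: avg_def sum_distrib_left)

lemma avg_cmult_right: "avg S (\<lambda>x. f x * c) = avg S f * c"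
  by (simp add: avg_def sum_distrib_right)

lemma avg_const: "finite S \<Longrightarrow> S \<noteq> {} \<Longrightarrow> avg S (\<lambda>x. c) = c"
  by (simp add: avg_def)

lemma avg_cong: "(\<And>x. x \<in> S \<Longrightarrow> f x = g x) \<Longrightarrow> avg S f = avg S g"
  by (simp add: avg_def)

lemma avg_swap: "avg S (\<lambda>x. avg T (f x)) = avg T (\<lambda>y. avg S (\<lambda>x. f x y))"
  unfolding avg_def sum_divide_distrib[symmetric] by (subst sum.swap) (simp add: mult.commute)

lemma avg_Times: "avg (S \<times> T) f = avg S (\<lambda>x. avg T (\<lambda>y. f (x, y)))"
  unfolding avg_def sum_divide_distrib[symmetric]
  by (simp add: sum.cartesian_product card_cartesian_product mult.commute)

lemma norm_avg: "norm (avg S f) \<le> avg S (\<lambda>x. norm (f x))"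
  by (simp add: avg_def norm_divide divide_right_mono norm_sum)

lemma avg_mono:
  fixes f g :: "'a \<Rightarrow> real"
  shows "(\<And>x. x \<in> S \<Longrightarrow> f x \<le> g x) \<Longrightarrow> avg S f \<le> avg S g"
  by (simp add: avg_def divide_right_mono sum_mono)

text \<open>An empty or infinite \<open>S\<close> has average 0, which is why \<open>c\<close> must
  be nonnegative.\<close>

lemma avg_le_const:
  fixes f :: "'a \<Rightarrow> real"
  assumes "\<And>x. x \<in> S \<Longrightarrow> f x \<le> c" "0 \<le> c"
  shows "avg S f \<le> c"
proof -
  have "(\<Sum>x\<in>S. f x) \<le> of_nat (card S) * c" using assms(1) by (rule sum_bounded_above)
  then show ?thesis using assms(2) unfolding avg_def
    by (cases "card S = 0") (simp_all add: divide_le_eq mult.commute)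
qed

lemma avg_of_bool:
  "finite S \<Longrightarrow> avg S (\<lambda>x. of_bool (P x)) = of_nat (card {x \<in> S. P x}) / of_nat (card S)"
  by (simp add: avg_def of_bool_def sum.If_cases Int_def)

section \<open>Additive characters modulo \<open>q\<close>\<close>

lemma echar_0 [simp]: "echar q 0 = 1"
  by (simp add: echar_def)

lemma norm_echar [simp]: "norm (echar q t) = 1"
  by (simp add: echar_def)

lemma echar_add: "echar q (s + t) = echar q s * echar q t"
  by (simp add: echar_def cis_mult add_divide_distrib distrib_left)

lemma cnj_echar: "cnj (echar q t) = echar q (- t)"
  by (simp add: echar_def cis_cnj)

lemma echar_sum: "echar q (\<Sum>i\<in>I. f i) = (\<Prod>i\<in>I. echar q (f i))"
  by (induction I rule: infinite_finite_induct) (auto simp: echar_add)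

lemma echar_eq_1_iff:
  assumes "q > 0"
  shows "echar q t = 1 \<longleftrightarrow> q dvd t"
proof -
  have "echar q t = 1 \<longleftrightarrow> (\<exists>m::int. 2 * pi * of_int t / of_int q = of_int (2 * m) * pi)"
    by (simp add: echar_def cis_conv_exp exp_eq_1)
  also have "\<dots> \<longleftrightarrow> (\<exists>m::int. real_of_int t = real_of_int (q * m))"
    using assms by (intro ex_cong1) (auto simp: field_simps)
  also have "\<dots> \<longleftrightarrow> q dvd t" unfolding of_int_eq_iff dvd_def ..
  finally show ?thesis .
qed

lemma echar_cong:
  assumes "q > 0" "[s = t] (mod q)"
  shows "echar q s = echar q t"
proof -
  have "echar q (s - t) = 1"
    using assms by (simp add: echar_eq_1_iff cong_iff_dvd_diff)
  then show ?thesis using echar_add[of q "s - t" t] by simp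
qed

lemma echar_power: "echar q t ^ n = echar q (int n * t)"
  by (induction n) (auto simp: echar_add algebra_simps)

text \<open>A geometric series whose ratio \<open>echar q c\<close> is a \<open>q\<close>-th root of
  unity, different from 1 unless \<open>q dvd c\<close>.\<close>

lemma sum_echar_residues:
  assumes "q > 0"
  shows "(\<Sum>x\<in>{0..<q}. echar q (x * c)) = (if q dvd c then of_int q else 0)"
proof (cases "q dvd c")
  case True
  then have "echar q (x * c) = 1" for x using assms by (simp add: echar_eq_1_iff)
  then show ?thesis using True assms by simp
next
  case False
  have "(\<Sum>x\<in>{0..<q}. echar q (x * c)) = (\<Sum>i<nat q. echar q (int i * c))"
    using assms by (intro sum.reindex_bij_witness[of _ int nat]) auto
  also have "\<dots> = (\<Sum>i<nat q. echar q c ^ i)" by (simp add: echar_power)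
  also have "\<dots> = 0"
    using False assms by (subst geometric_sum) (simp_all add: echar_eq_1_iff echar_power)
  finally show ?thesis using False by simp
qed

text \<open>Orthogonality of characters; the sum factors over the coordinates. Divisibility events
  enter and leave character sums through this identity.\<close>

lemma avg_echar_mod_box:
  assumes "finite I" "q > 0"
  shows "avg (mod_box I q) (\<lambda>x. echar q (\<Sum>i\<in>I. x i * c i)) = of_bool (\<forall>i\<in>I. q dvd c i)"
proof -
  have "(\<Sum>x\<in>mod_box I q. echar q (\<Sum>i\<in>I. x i * c i)) = (\<Prod>i\<in>I. \<Sum>x\<in>{0..<q}. echar q (x * c i))"
    by (simp add: mod_box_def echar_sum prod_sum_PiE assms)
  also have "\<dots> = (\<Prod>i\<in>I. if q dvd c i then of_int q else 0)"
    using assms by (simp add: sum_echar_residues)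
  also have "\<dots> = of_bool (\<forall>i\<in>I. q dvd c i) * of_nat (card (mod_box I q))"
    using assms by (auto simp: card_mod_box)
  finally show ?thesis using card_mod_box_pos[OF assms] by (simp add: avg_def)
qed

section \<open>Discrete Fourier transform, Parseval and decorrelation\<close>

definition pairing :: "'i set \<Rightarrow> ('i \<Rightarrow> int) \<Rightarrow> ('i \<Rightarrow> int) \<Rightarrow> int" where
  "pairing I C A = (\<Sum>i\<in>I. C i * A i)"

text \<open>Normalised as an average, so that inversion and Parseval carry a plain sum over the
  frequencies \<open>C\<close>.\<close>

definition dft :: "'i set \<Rightarrow> int \<Rightarrow> (('i \<Rightarrow> int) \<Rightarrow> complex) \<Rightarrow> ('i \<Rightarrow> int) \<Rightarrow> complex" where
  "dft I q f C = avg (mod_box I q) (\<lambda>A. f A * echar q (pairing I C A))"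

text \<open>The shift comes before the point, so that \<open>mod_shift I q W\<close> is translation
  by \<open>W\<close>.\<close>

definition mod_shift :: "'i set \<Rightarrow> int \<Rightarrow> ('i \<Rightarrow> int) \<Rightarrow> ('i \<Rightarrow> int) \<Rightarrow> 'i \<Rightarrow> int" where
  "mod_shift I q W A = (\<lambda>i\<in>I. (A i + W i) mod q)"

lemma mod_shift_in: "q > 0 \<Longrightarrow> mod_shift I q W A \<in> mod_box I q"
  by (auto simp: mod_shift_def mod_box_def)

lemma pairing_add: "pairing I C (\<lambda>i. A i + B i) = pairing I C A + pairing I C B"
  and pairing_minus: "pairing I C (\<lambda>i. - A i) = - pairing I C A"
  by (simp_all add: pairing_def sum.distrib distrib_left sum_negf)

lemma avg_point:
  assumes "finite I" "q > 0"
  shows "avg (mod_box I q) (\<lambda>A'. g A' * of_bool (A' = mod_shift I q W A)) * of_nat (card (mod_box I q)) =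
    g (mod_shift I q W A)"
proof -
  have "(\<Sum>A'\<in>mod_box I q. g A' * of_bool (A' = mod_shift I q W A)) = g (mod_shift I q W A)"
    using assms mod_shift_in[OF assms(2), of I W A] by (subst sum.remove[of _ "mod_shift I q W A"]) auto
  then show ?thesis using card_mod_box_pos[OF assms] by (simp add: avg_def)
qed

text \<open>Fourier expansion of a point mass: orthogonality applied to the coordinates of
  \<open>A + W - A'\<close>.\<close>

lemma of_bool_mod_shift_eq:
  assumes "finite I" "q > 0" "A' \<in> mod_box I q"
  shows "of_bool (A' = mod_shift I q W A) =
    avg (mod_box I q) (\<lambda>C. echar q (pairing I C A) * echar q (pairing I C W) * cnj (echar q (pairing I C A')))"
proof -
  have "A' = mod_shift I q W A \<longleftrightarrow> (\<forall>i\<in>I. q dvd A i + W i + - A' i)"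
  proof
    assume eq: "A' = mod_shift I q W A"
    have "q dvd A i + W i - (A i + W i) mod q" for i by (simp add: minus_mod_eq_mult_div)
    then show "\<forall>i\<in>I. q dvd A i + W i + - A' i" by (simp add: eq mod_shift_def)
  next
    assume "\<forall>i\<in>I. q dvd A i + W i + - A' i"
    then have "[A i + W i = A' i] (mod q)" if "i \<in> I" for i
      using that by (simp add: cong_iff_dvd_diff)
    then show "A' = mod_shift I q W A"
      by (intro mod_box_eqI[OF assms(3) mod_shift_in[OF assms(2)]])
        (simp add: mod_shift_def cong_def)
  qed
  then have "of_bool (A' = mod_shift I q W A) =
      avg (mod_box I q) (\<lambda>C. echar q (pairing I C (\<lambda>i. (A i + W i) + - A' i)))"
    using avg_echar_mod_box[OF assms(1,2), of "\<lambda>i. A i + W i + - A' i"] by (simp add: pairing_def)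
  then show ?thesis by (simp only: pairing_add pairing_minus echar_add cnj_echar)
qed

text \<open>Expanding the point mass at \<open>A + W\<close> separates \<open>A\<close> from
  \<open>A'\<close>. Conjugating both inside and outside \<open>dft\<close> turns the second factor
  into the average of \<open>g\<close> against the conjugate character.\<close>

lemma avg_correlation:
  assumes "finite I" "q > 0"
  shows "avg (mod_box I q) (\<lambda>A. f A * g (mod_shift I q W A)) =
    (\<Sum>C\<in>mod_box I q. dft I q f C * cnj (dft I q (\<lambda>A. cnj (g A)) C) * echar q (pairing I C W))"
proof -
  let ?X = "mod_box I q" and ?e = "\<lambda>C A. echar q (pairing I C A)"
  let ?N = "of_nat (card ?X) :: complex"
  have N: "?N \<noteq> 0" using card_mod_box_pos[OF assms] by simp
  have "avg ?X (\<lambda>A. f A * g (mod_shift I q W A)) =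
      avg ?X (\<lambda>A. f A * (avg ?X (\<lambda>A'. g A' * of_bool (A' = mod_shift I q W A)) * ?N))"
    by (simp only: avg_point[OF assms])
  also have "\<dots> = avg ?X (\<lambda>A. avg ?X (\<lambda>A'. avg ?X (\<lambda>C. f A * ?e C A * (g A' * cnj (?e C A')) * ?e C W))) * ?N"
    unfolding avg_cmult[symmetric] avg_cmult_right[symmetric]
    by (intro avg_cong) (simp add: of_bool_mod_shift_eq[OF assms] avg_cmult[symmetric] avg_cmult_right[symmetric] mult_ac)
  also have "\<dots> = avg ?X (\<lambda>C. avg ?X (\<lambda>A. avg ?X (\<lambda>A'. f A * ?e C A * (g A' * cnj (?e C A')) * ?e C W))) * ?N"
    by (simp only: avg_swap[where T="?X" and f="\<lambda>A C. avg ?X (\<lambda>A'. f A * ?e C A * (g A' * cnj (?e C A')) * ?e C W)", symmetric]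
       avg_swap[where f="\<lambda>A' C. f _ * ?e C _ * (g A' * cnj (?e C A')) * ?e C W"])
  also have "\<dots> = avg ?X (\<lambda>C. dft I q f C * avg ?X (\<lambda>A'. g A' * cnj (?e C A')) * ?e C W) * ?N"
    by (simp only: dft_def avg_cmult avg_cmult_right)
  also have "\<dots> = avg ?X (\<lambda>C. dft I q f C * cnj (dft I q (\<lambda>A. cnj (g A)) C) * ?e C W) * ?N"
    by (simp add: dft_def avg_def)
  finally show ?thesis using N by (simp add: avg_def)
qed

text \<open>Parseval, read off from the correlation identity at shift 0 with \<open>g\<close> the
  conjugate of \<open>f\<close>.\<close>

lemma sum_norm_dft_square:
  assumes "finite I" "q > 0"
  shows "(\<Sum>C\<in>mod_box I q. (norm (dft I q f C))\<^sup>2) = avg (mod_box I q) (\<lambda>A. (norm (f A))\<^sup>2)"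
proof -
  have sh: "mod_shift I q (\<lambda>_. 0) A = A" if "A \<in> mod_box I q" for A
    by (rule mod_box_eqI[OF mod_shift_in[OF assms(2)] that]) (simp add: mod_shift_def)
  have "complex_of_real (\<Sum>C\<in>mod_box I q. (norm (dft I q f C))\<^sup>2) =
      (\<Sum>C\<in>mod_box I q. dft I q f C * cnj (dft I q f C) * echar q (pairing I C (\<lambda>_. 0)))"
    by (simp add: pairing_def flip: complex_norm_square)
  also have "\<dots> = avg (mod_box I q) (\<lambda>A. f A * cnj (f (mod_shift I q (\<lambda>_. 0) A)))"
    by (subst avg_correlation[OF assms, of f "\<lambda>A. cnj (f A)"]) simp
  also have "\<dots> = avg (mod_box I q) (\<lambda>A. f A * cnj (f A))"
    by (intro avg_cong) (simp add: sh)
  also have "\<dots> = complex_of_real (avg (mod_box I q) (\<lambda>A. (norm (f A))\<^sup>2))"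
    by (simp add: avg_def flip: complex_norm_square)
  finally show ?thesis by (simp only: of_real_eq_iff)
qed

text \<open>The zero frequency contributes exactly the product of the two means. All others together
  cost at most \<open>\<epsilon>\<close> times the Fourier mass, which is at most 1 because
  \<open>f\<close> and \<open>g\<close> have modulus at most 1.\<close>

lemma decorrelation:
  fixes f g :: "('i \<Rightarrow> int) \<Rightarrow> complex"
  assumes I: "finite I" "q > 0"
    and f: "\<And>A. norm (f A) \<le> 1" and g: "\<And>A. norm (g A) \<le> 1"
    and \<Omega>: "finite \<Omega>" "\<Omega> \<noteq> {}"
    and \<epsilon>: "\<And>C. \<lbrakk>C \<in> mod_box I q; \<exists>i\<in>I. C i \<noteq> 0\<rbrakk> \<Longrightarrow> norm (avg \<Omega> (\<lambda>w. echar q (pairing I C (W w)))) \<le> \<epsilon>"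
      "0 \<le> \<epsilon>"
  shows "norm (avg \<Omega> (\<lambda>w. avg (mod_box I q) (\<lambda>A. f A * g (mod_shift I q (W w) A))) -
      avg (mod_box I q) f * avg (mod_box I q) g) \<le> \<epsilon>"
proof -
  let ?X = "mod_box I q"
  let ?w = "\<lambda>C. avg \<Omega> (\<lambda>w. echar q (pairing I C (W w)))"
  let ?F = "dft I q f" and ?G = "dft I q (\<lambda>A. cnj (g A))"
  \<comment> \<open>The zero frequency, written extensionally so that it lies in the box.\<close>
  define Z where "Z = (\<lambda>i\<in>I. 0 :: int)"
  have Z: "Z \<in> ?X" using I by (auto simp: Z_def mod_box_def)
  have pO: "pairing I Z A = 0" for A by (simp add: Z_def pairing_def)
  have "avg \<Omega> (\<lambda>w. avg ?X (\<lambda>A. f A * g (mod_shift I q (W w) A))) = (\<Sum>C\<in>?X. ?F C * cnj (?G C) * ?w C)"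
    unfolding avg_correlation[OF I]
    by (simp add: avg_def sum_distrib_left sum_divide_distrib) (rule sum.swap)
  also have "\<dots> = ?F Z * cnj (?G Z) * ?w Z + (\<Sum>C\<in>?X - {Z}. ?F C * cnj (?G C) * ?w C)"
    by (rule sum.remove) (use I Z in auto)
  also have "?F Z * cnj (?G Z) * ?w Z = avg ?X f * avg ?X g"
    using \<Omega> by (simp add: dft_def pO avg_const) (simp add: avg_def)
  finally have "norm (avg \<Omega> (\<lambda>w. avg ?X (\<lambda>A. f A * g (mod_shift I q (W w) A))) - avg ?X f * avg ?X g) =
      norm (\<Sum>C\<in>?X - {Z}. ?F C * cnj (?G C) * ?w C)" by simp
  \<comment> \<open>Termwise \<open>2ab <= a^2 + b^2\<close> serves as Cauchy-Schwarz and leaves a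
    sum to which Parseval applies for each transform separately.\<close>
  also have "\<dots> \<le> (\<Sum>C\<in>?X - {Z}. ((norm (?F C))\<^sup>2 + (norm (?G C))\<^sup>2) / 2 * \<epsilon>)"
  proof (rule sum_norm_le)
    fix C assume C: "C \<in> ?X - {Z}"
    have "\<exists>i\<in>I. C i \<noteq> 0"
    proof (rule ccontr)
      assume "\<not> ?thesis"
      then have "C = Z" using C Z by (intro mod_box_eqI[of _ I q]) (auto simp: Z_def)
      then show False using C by simp
    qed
    then have "norm (?w C) \<le> \<epsilon>" using C by (intro \<epsilon>) auto
    moreover have "norm (?F C) * norm (?G C) \<le> ((norm (?F C))\<^sup>2 + (norm (?G C))\<^sup>2) / 2"
      using sum_squares_bound[of "norm (?F C)" "norm (?G C)"] by simp
    ultimately show "norm (?F C * cnj (?G C) * ?w C) \<le> ((norm (?F C))\<^sup>2 + (norm (?G C))\<^sup>2) / 2 * \<epsilon>"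
      unfolding norm_mult complex_mod_cnj by (intro mult_mono) auto
  qed
  also have "\<dots> \<le> (\<Sum>C\<in>?X. ((norm (?F C))\<^sup>2 + (norm (?G C))\<^sup>2) / 2 * \<epsilon>)"
    by (rule sum_mono2) (use I \<epsilon>(2) in auto)
  also have "\<dots> = (avg ?X (\<lambda>A. (norm (f A))\<^sup>2) + avg ?X (\<lambda>A. (norm (g A))\<^sup>2)) / 2 * \<epsilon>"
    using sum_norm_dft_square[OF I, of f] sum_norm_dft_square[OF I, of "\<lambda>A. cnj (g A)"]
    by (simp add: sum_distrib_right[symmetric] sum_divide_distrib[symmetric] sum.distrib)
  also have "\<dots> \<le> (1 + 1) / 2 * \<epsilon>"
    using \<epsilon>(2) f g
    by (intro mult_right_mono divide_right_mono add_mono avg_le_const) (auto simp: power_le_one)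
  finally show ?thesis by simp
qed

section \<open>Decorrelation of events invariant under row and column operations\<close>

text \<open>Only the summation index is cut off at \<open>n\<close>. Hence associativity is an
  equation of functions, whereas the identity laws need the free index below \<open>n\<close> and
  \<open>unimod\<close> compares entries on the square only.\<close>

definition mmul :: "nat \<Rightarrow> (nat \<times> nat \<Rightarrow> int) \<Rightarrow> (nat \<times> nat \<Rightarrow> int) \<Rightarrow> nat \<times> nat \<Rightarrow> int" where
  "mmul n A B = (\<lambda>(i, j). \<Sum>l<n. A (i, l) * B (l, j))"

definition mone :: "nat \<times> nat \<Rightarrow> int" where
  "mone = (\<lambda>(i, j). of_bool (i = j))"

definition unip :: "(nat \<times> nat) set \<Rightarrow> (nat \<times> nat \<Rightarrow> int) \<Rightarrow> nat \<times> nat \<Rightarrow> int" where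
  "unip I X = (\<lambda>ij. mone ij + (if ij \<in> I then X ij else 0))"

abbreviation sq :: "nat \<Rightarrow> (nat \<times> nat) set" where
  "sq n \<equiv> {..<n} \<times> {..<n}"

definition unimod :: "nat \<Rightarrow> (nat \<times> nat \<Rightarrow> int) \<Rightarrow> bool" where
  "unimod n U \<longleftrightarrow> (\<exists>U'. \<forall>ij\<in>sq n. mmul n U U' ij = mone ij \<and> mmul n U' U ij = mone ij)"

lemma mmul_assoc: "mmul n (mmul n A B) C = mmul n A (mmul n B C)"
  unfolding mmul_def
  by (auto simp: sum_distrib_left sum_distrib_right mult.assoc intro!: ext sum.swap)

lemma mmul_cong:
  assumes "\<And>l. l < n \<Longrightarrow> A (i, l) = A' (i, l)" "\<And>l. l < n \<Longrightarrow> B (l, j) = B' (l, j)"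
  shows "mmul n A B (i, j) = mmul n A' B' (i, j)"
  using assms by (simp add: mmul_def)

lemma mmul_mone_left: "i < n \<Longrightarrow> mmul n mone A (i, j) = A (i, j)"
  by (simp add: mmul_def mone_def of_bool_def if_distrib[of "\<lambda>x. x * _"] cong: if_cong)

lemma mmul_mone_right: "j < n \<Longrightarrow> mmul n A mone (i, j) = A (i, j)"
  by (simp add: mmul_def mone_def of_bool_def if_distrib[of "\<lambda>x. _ * x"] cong: if_cong)

lemma mmul_unip:
  assumes "i < n" "S \<subseteq> {..<n}" "T \<subseteq> {..<n}"
  shows "mmul n (unip (S \<times> T) X) R (i, j) =
    R (i, j) + (if i \<in> S then \<Sum>t\<in>T. X (i, t) * R (t, j) else 0)"
proof -
  have "mmul n (unip (S \<times> T) X) R (i, j) = mmul n mone R (i, j) +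
      (\<Sum>l<n. (if i \<in> S \<and> l \<in> T then X (i, l) * R (l, j) else 0))"
    by (simp add: mmul_def unip_def distrib_right sum.distrib if_distrib[of "\<lambda>x. x * _"] cong: if_cong)
  also have "(\<Sum>l<n. (if i \<in> S \<and> l \<in> T then X (i, l) * R (l, j) else 0)) =
      (if i \<in> S then \<Sum>l\<in>T. X (i, l) * R (l, j) else 0)"
    using assms(3) by (auto simp: sum.If_cases Int_absorb1)
  finally show ?thesis using assms(1) by (simp add: mmul_mone_left)
qed

text \<open>Disjointness of \<open>S\<close> and \<open>T\<close> makes the off-diagonal block
  square to zero, so negating \<open>X\<close> gives the inverse.\<close>

lemma unimod_unip:
  assumes "S \<subseteq> {..<n}" "T \<subseteq> {..<n}" "S \<inter> T = {}"
  shows "unimod n (unip (S \<times> T) X)"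
proof -
  have *: "mmul n (unip (S \<times> T) X) (unip (S \<times> T) (\<lambda>ij. - X ij)) (i, j) = mone (i, j)"
    if "i < n" "j < n" for i j and X :: "nat \<times> nat \<Rightarrow> int"
  proof -
    have "(\<Sum>t\<in>T. X (i, t) * unip (S \<times> T) (\<lambda>ij. - X ij) (t, j)) = (\<Sum>t\<in>T. if t = j then X (i, t) else 0)"
      using assms(3) by (intro sum.cong) (auto simp: unip_def mone_def)
    also have "\<dots> = (if j \<in> T then X (i, j) else 0)"
      using finite_subset[OF assms(2)] by (simp add: sum.delta')
    finally show ?thesis using that
      unfolding mmul_unip[OF that(1) assms(1,2)] by (simp add: unip_def)
  qed
  show ?thesis unfolding unimod_def
    using *[of _ _ X] *[of _ _ "\<lambda>ij. - X ij"]
    by (intro exI[of _ "unip (S \<times> T) (\<lambda>ij. - X ij)"]) auto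
qed

lemma unimod_mmul:
  assumes "unimod n A" "unimod n B"
  shows "unimod n (mmul n A B)"
proof -
  have *: "mmul n (mmul n A B) (mmul n B' A') (i, j) = mone (i, j)"
    if "\<forall>ij\<in>sq n. mmul n A A' ij = mone ij" "\<forall>ij\<in>sq n. mmul n B B' ij = mone ij" "i < n" "j < n"
    for A A' B B' :: "nat \<times> nat \<Rightarrow> int" and i j
  proof -
    have "mmul n (mmul n A B) (mmul n B' A') (i, j) = mmul n A (mmul n (mmul n B B') A') (i, j)"
      by (simp add: mmul_assoc)
    also have "\<dots> = mmul n A A' (i, j)"
    proof (rule mmul_cong)
      fix l assume "l < n"
      then show "mmul n (mmul n B B') A' (l, j) = A' (l, j)"
        using that by (subst mmul_cong[of n _ l mone A' j A']) (auto simp: mmul_mone_left)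
    qed simp
    finally show ?thesis using that by simp
  qed
  obtain A' where "\<forall>ij\<in>sq n. mmul n A A' ij = mone ij \<and> mmul n A' A ij = mone ij"
    using assms(1) by (auto simp: unimod_def)
  moreover obtain B' where "\<forall>ij\<in>sq n. mmul n B B' ij = mone ij \<and> mmul n B' B ij = mone ij"
    using assms(2) by (auto simp: unimod_def)
  ultimately show ?thesis unfolding unimod_def
    using *[of A A' B B'] *[of B' B A' A] by (intro exI[of _ "mmul n B' A'"]) auto
qed

lemma unimod_mone: "unimod n mone"
  unfolding unimod_def by (rule exI[of _ mone]) (auto simp: mmul_mone_left)

text \<open>The pairing is the trace form, for which the adjoint of left multiplication by
  \<open>A\<close> is left multiplication by its transpose.\<close>

lemma pairing_mmul:
  "pairing (sq n) C (mmul n A D) = pairing (sq n) D (mmul n (\<lambda>(i, j). A (j, i)) C)"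
proof -
  have "pairing (sq n) C (mmul n A D) = (\<Sum>i<n. \<Sum>j<n. \<Sum>l<n. D (l, j) * (A (i, l) * C (i, j)))"
    by (simp add: pairing_def mmul_def sum.cartesian_product' sum_distrib_left mult_ac)
  also have "\<dots> = (\<Sum>i<n. \<Sum>l<n. \<Sum>j<n. D (l, j) * (A (i, l) * C (i, j)))"
    by (rule sum.cong[OF refl], rule sum.swap)
  also have "\<dots> = (\<Sum>l<n. \<Sum>i<n. \<Sum>j<n. D (l, j) * (A (i, l) * C (i, j)))"
    by (rule sum.swap)
  also have "\<dots> = (\<Sum>l<n. \<Sum>j<n. \<Sum>i<n. D (l, j) * (A (i, l) * C (i, j)))"
    by (rule sum.cong[OF refl], rule sum.swap)
  also have "\<dots> = pairing (sq n) D (mmul n (\<lambda>(i, j). A (j, i)) C)"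
    by (simp add: pairing_def mmul_def sum.cartesian_product' sum_distrib_left mult_ac)
  finally show ?thesis .
qed

lemma row_mmul_unip:
  assumes "i < n" "S \<subseteq> {..<n}" "T \<subseteq> {..<n}"
  shows "(\<Sum>a<n. mmul n (unip (S \<times> T) X) R (i, a) * v a) =
    (\<Sum>a<n. R (i, a) * v a) + (if i \<in> S then \<Sum>t\<in>T. X (i, t) * (\<Sum>a<n. R (t, a) * v a) else 0)"
proof -
  have "(\<Sum>a<n. (\<Sum>t\<in>T. X (i, t) * R (t, a)) * v a) = (\<Sum>t\<in>T. X (i, t) * (\<Sum>a<n. R (t, a) * v a))"
    unfolding sum_distrib_left sum_distrib_right by (subst sum.swap) (simp add: mult_ac)
  then show ?thesis using assms(1)
    by (simp add: mmul_unip[OF _ assms(2,3)] distrib_right sum.distrib)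
qed

text \<open>This makes the pairing affine in \<open>X\<close>: the coefficient of
  \<open>X (i, t)\<close> is the product of row \<open>t\<close> of \<open>R\<close> with row
  \<open>i\<close> of \<open>N\<close>. Averaging a character over \<open>X\<close> therefore leaves
  the indicator that all these products vanish modulo \<open>q\<close>.\<close>

lemma pairing_mmul_unip:
  assumes "S \<subseteq> {..<n}" "T \<subseteq> {..<n}"
  shows "pairing (sq n) (mmul n (unip (S \<times> T) X) R) N = pairing (sq n) R N +
    (\<Sum>it\<in>S \<times> T. X it * (\<Sum>a<n. R (snd it, a) * N (fst it, a)))"
proof -
  have "pairing (sq n) (mmul n (unip (S \<times> T) X) R) N =
      (\<Sum>i<n. \<Sum>a<n. mmul n (unip (S \<times> T) X) R (i, a) * N (i, a))"
    by (simp add: pairing_def sum.cartesian_product')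
  also have "\<dots> = pairing (sq n) R N +
      (\<Sum>i<n. if i \<in> S then \<Sum>t\<in>T. X (i, t) * (\<Sum>a<n. R (t, a) * N (i, a)) else 0)"
    by (simp add: row_mmul_unip[OF _ assms] sum.distrib pairing_def sum.cartesian_product')
  also have "(\<Sum>i<n. if i \<in> S then \<Sum>t\<in>T. X (i, t) * (\<Sum>a<n. R (t, a) * N (i, a)) else 0) =
      (\<Sum>i\<in>S. \<Sum>t\<in>T. X (i, t) * (\<Sum>a<n. R (t, a) * N (i, a)))"
    using assms by (simp add: sum.If_cases Int_absorb1)
  finally show ?thesis by (simp add: sum.cartesian_product')
qed

section \<open>Zeros of random affine forms modulo a prime power\<close>

text \<open>A solution \<open>x\<close> prime to \<open>p\<close> would be a unit modulo
  \<open>p^k\<close> and force \<open>p^k\<close> to divide \<open>d\<close>, so all solutions are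
  multiples of \<open>p\<close>.\<close>

lemma card_dvd_mult_le:
  fixes p :: nat
  assumes "prime p" "k > 0" "\<not> int p ^ k dvd d"
  shows "card {x \<in> {0..<int p ^ k}. int p ^ k dvd x * d} \<le> p ^ (k - 1)"
proof -
  have "{x \<in> {0..<int p ^ k}. int p ^ k dvd x * d} \<subseteq> (\<lambda>y. int p * y) ` {0..<int p ^ (k - 1)}"
  proof
    fix x assume x: "x \<in> {x \<in> {0..<int p ^ k}. int p ^ k dvd x * d}"
    have "int p dvd x"
    proof (rule ccontr)
      assume "\<not> int p dvd x"
      then have "coprime (int p ^ k) x"
        using assms(1) by (simp add: prime_imp_coprime)
      then have "int p ^ k dvd d" using x by (simp add: coprime_dvd_mult_right_iff)
      then show False using assms(3) by simp
    qed
    then obtain y where y: "x = int p * y" by (elim dvdE)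
    have pk: "int p ^ k = int p * int p ^ (k - 1)" using assms(2) by (cases k) auto
    have p0: "int p > 0" using assms(1) by (simp add: prime_gt_0_nat)
    have "0 \<le> y \<and> y < int p ^ (k - 1)" using x p0 unfolding y pk by (auto simp: zero_le_mult_iff)
    then show "x \<in> (\<lambda>y. int p * y) ` {0..<int p ^ (k - 1)}" unfolding y by auto
  qed
  then have "card {x \<in> {0..<int p ^ k}. int p ^ k dvd x * d} \<le> card {0..<int p ^ (k - 1)}"
    by (meson card_image_le card_mono finite_atLeastLessThan_int finite_imageI le_trans)
  then show ?thesis by (simp add: nat_power_eq)
qed

text \<open>If some \<open>d t\<close> is nonzero modulo \<open>q\<close>, the rows of
  \<open>Z\<close> give independent affine forms, each vanishing with probability at most
  \<open>1/p\<close>. Otherwise the forms are the constants \<open>c l\<close>, one of which is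
  nonzero, and the event is empty.\<close>

lemma prob_affine_zero:
  fixes p :: nat and c d :: "nat \<Rightarrow> int"
  assumes p: "prime p" "k > 0" and q: "q = int p ^ k" and fin: "finite S" "finite T"
    and ex: "(\<exists>l\<in>S. \<not> q dvd c l) \<or> (\<exists>t\<in>T. \<not> q dvd d t)"
  shows "avg (mod_box (S \<times> T) q) (\<lambda>Z. of_bool (\<forall>l\<in>S. q dvd c l + (\<Sum>t\<in>T. Z (l, t) * d t))) \<le>
    (1 / real p) ^ card S"
proof (cases "\<exists>t\<in>T. \<not> q dvd d t")
  case False
  then have "q dvd (\<Sum>t\<in>T. Z (l, t) * d t)" for Z :: "nat \<times> nat \<Rightarrow> int" and l
    by (intro dvd_sum) auto
  then have "\<not> (\<forall>l\<in>S. q dvd c l + (\<Sum>t\<in>T. Z (l, t) * d t))" for Z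
    using ex False by (auto simp: dvd_add_left_iff)
  then have "avg (mod_box (S \<times> T) q) (\<lambda>Z. of_bool (\<forall>l\<in>S. q dvd c l + (\<Sum>t\<in>T. Z (l, t) * d t))) =
      avg (mod_box (S \<times> T) q) (\<lambda>_. 0 :: real)"
    by (intro avg_cong) (simp only: of_bool_eq)
  moreover have "avg (mod_box (S \<times> T) q) (\<lambda>_. 0 :: real) = 0" by (simp add: avg_def)
  moreover have "0 \<le> (1 / real p) ^ card S" by simp
  ultimately show ?thesis by (simp only:)
next
  case True
  then obtain t0 where t0: "t0 \<in> T" "\<not> q dvd d t0" by blast
  have q0: "q > 0" using p q by (simp add: prime_gt_0_nat)
  \<comment> \<open>The exponent after expanding the event over dual vectors \<open>x\<close>,
    regrouped so that \<open>Z (l, t)\<close> occurs linearly with coefficient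
    \<open>x l * d t\<close>.\<close>
  let ?\<Phi> = "\<lambda>Z x. (\<Sum>l\<in>S. x l * c l) + (\<Sum>lt\<in>S \<times> T. Z lt * (x (fst lt) * d (snd lt)))"
  have 1: "(of_bool (\<forall>l\<in>S. q dvd c l + (\<Sum>t\<in>T. Z (l, t) * d t)) :: complex) =
      avg (mod_box S q) (\<lambda>x. echar q (?\<Phi> Z x))" for Z
  proof -
    have "(\<Sum>l\<in>S. x l * (c l + (\<Sum>t\<in>T. Z (l, t) * d t))) = ?\<Phi> Z x" for x
      by (simp add: distrib_left sum.distrib sum_distrib_left sum.cartesian_product' mult_ac)
    then show ?thesis
      using avg_echar_mod_box[OF fin(1) q0, of "\<lambda>l. c l + (\<Sum>t\<in>T. Z (l, t) * d t)"] by simp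
  qed
  have 2: "avg (mod_box (S \<times> T) q) (\<lambda>Z. echar q (?\<Phi> Z x)) =
      echar q (\<Sum>l\<in>S. x l * c l) * of_bool (\<forall>lt\<in>S \<times> T. q dvd x (fst lt) * d (snd lt))" for x
    using avg_echar_mod_box[of "S \<times> T" q "\<lambda>lt. x (fst lt) * d (snd lt)"] fin q0
    by (simp add: echar_add avg_cmult)
  have "avg (mod_box (S \<times> T) q) (\<lambda>Z. of_bool (\<forall>l\<in>S. q dvd c l + (\<Sum>t\<in>T. Z (l, t) * d t)) :: real) =
      norm (avg (mod_box (S \<times> T) q) (\<lambda>Z. of_bool (\<forall>l\<in>S. q dvd c l + (\<Sum>t\<in>T. Z (l, t) * d t)) :: complex))"
    by (simp add: avg_of_bool fin norm_divide)
  also have "\<dots> = norm (avg (mod_box S q) (\<lambda>x. avg (mod_box (S \<times> T) q) (\<lambda>Z. echar q (?\<Phi> Z x))))"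
    unfolding 1 by (subst avg_swap) (rule refl)
  \<comment> \<open>Of the conditions \<open>q dvd x l * d t\<close> only those at \<open>t0\<close>
    are kept; they restrict each coordinate of \<open>x\<close> separately.\<close>
  also have "\<dots> \<le> avg (mod_box S q) (\<lambda>x. of_bool (\<forall>l\<in>S. q dvd x l * d t0))"
    unfolding 2 using t0(1) by (intro order_trans[OF norm_avg] avg_mono) (auto simp: norm_mult)
  also have "\<dots> = real (card {x \<in> mod_box S q. \<forall>l\<in>S. q dvd x l * d t0}) / real (card (mod_box S q))"
    by (rule avg_of_bool) (use fin in simp)
  also have "{x \<in> mod_box S q. \<forall>l\<in>S. q dvd x l * d t0} = (\<Pi>\<^sub>E l\<in>S. {x \<in> {0..<q}. q dvd x * d t0})"
    by (auto simp: mod_box_def PiE_iff extensional_def)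
  also have "real (card \<dots>) / real (card (mod_box S q)) =
      (real (card {x \<in> {0..<q}. q dvd x * d t0}) / real p ^ k) ^ card S"
    using q by (simp add: card_PiE fin card_mod_box power_divide nat_power_eq)
  also have "\<dots> \<le> (1 / real p) ^ card S"
  proof (intro power_mono)
    have "real (card {x \<in> {0..<q}. q dvd x * d t0}) \<le> real (p ^ (k - 1))"
      using card_dvd_mult_le[OF p, of "d t0"] t0(2) unfolding q of_nat_le_iff by simp
    also have "\<dots> = real p ^ k / real p" using p by (cases k) (auto simp: prime_gt_0_nat)
    finally show "real (card {x \<in> {0..<q}. q dvd x * d t0}) / real p ^ k \<le> 1 / real p"
      using prime_gt_0_nat[OF p(1)] by (simp add: field_simps)
  qed simp
  finally show ?thesis .
qed

text \<open>
  Averaging over this explicit family replaces the uniform distribution on invertible matrices,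
  because every sum over one block is a complete character sum.
\<close>

definition ens_index :: "nat \<Rightarrow> int \<Rightarrow> ((nat \<times> nat \<Rightarrow> int) \<times> (nat \<times> nat \<Rightarrow> int) \<times> (nat \<times> nat \<Rightarrow> int)) set" where
  "ens_index n q = mod_box ({..<n div 2} \<times> {n div 2..<n}) q \<times> mod_box ({n div 2..<n} \<times> {..<n div 2}) q \<times>
    mod_box ({..<n div 2} \<times> {n div 2..<n}) q"

text \<open>The last component \<open>X\<close> of the triple is the leftmost factor, so in the
  nested averages it is integrated first. The trailing \<open>mone\<close> lets the formulas for
  \<open>mmul n (unip ..) R\<close> apply to the rightmost factor as well.\<close>

definition ens :: "nat \<Rightarrow> (nat \<times> nat \<Rightarrow> int) \<times> (nat \<times> nat \<Rightarrow> int) \<times> (nat \<times> nat \<Rightarrow> int) \<Rightarrow> nat \<times> nat \<Rightarrow> int" where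
  "ens n = (\<lambda>(Z, Y, X). mmul n (unip ({..<n div 2} \<times> {n div 2..<n}) X)
    (mmul n (unip ({n div 2..<n} \<times> {..<n div 2}) Y) (mmul n (unip ({..<n div 2} \<times> {n div 2..<n}) Z) mone)))"

lemma finite_ens_index [simp]: "finite (ens_index n q)"
  by (simp add: ens_index_def)

lemma ens_index_nonempty: "q > 0 \<Longrightarrow> ens_index n q \<noteq> {}"
  by (simp add: ens_index_def mod_box_nonempty)

lemma unimod_ens: "unimod n (ens n w)"
  by (cases w) (auto simp: ens_def intro!: unimod_mmul unimod_unip unimod_mone)

lemma norm_echar_of_bool_le: "(P \<Longrightarrow> Q) \<Longrightarrow> norm (echar q t * of_bool P) \<le> of_bool Q"
  by (auto simp: norm_mult)

text \<open>Averaging over one block turns the character into a system of divisibility conditions.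
  The neighbouring block makes this a random affine system with at least \<open>n div 2\<close>
  equations, to which \<open>prob_affine_zero\<close> applies.\<close>

lemma ens_char_bound:
  fixes p :: nat and N :: "nat \<times> nat \<Rightarrow> int"
  assumes p: "prime p" "k > 0" and q: "q = int p ^ k" and N: "\<exists>ij\<in>sq n. \<not> q dvd N ij"
  shows "norm (avg (ens_index n q) (\<lambda>w. echar q (pairing (sq n) (ens n w) N))) \<le> (1 / real p) ^ (n div 2)"
proof -
  define S T where "S = {..<n div 2}" and "T = {n div 2..<n}"
  let ?ST = "mod_box (S \<times> T) q" and ?TS = "mod_box (T \<times> S) q"
  have ST: "S \<subseteq> {..<n}" "T \<subseteq> {..<n}" "finite S" "finite T" "S \<inter> T = {}" "{..<n} = S \<union> T"
    by (auto simp: S_def T_def)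
  have card: "card S = n div 2" "card T \<ge> n div 2" by (auto simp: S_def T_def)
  have q0: "q > 0" using p q by (simp add: prime_gt_0_nat)
  have p1: "1 / real p \<le> 1" using prime_gt_1_nat[OF p(1)] by simp
  have ens: "ens n (Z, Y, X) = mmul n (unip (S \<times> T) X) (mmul n (unip (T \<times> S) Y) (mmul n (unip (S \<times> T) Z) mone))"
    for X Y Z by (simp add: ens_def S_def T_def)
  have index: "ens_index n q = ?ST \<times> ?TS \<times> ?ST"
    by (simp add: ens_index_def S_def T_def)
  let ?W = "\<lambda>Z. mmul n (unip (S \<times> T) Z) mone"
  let ?R = "\<lambda>Z Y. mmul n (unip (T \<times> S) Y) (?W Z)"
  have W: "(\<Sum>a<n. ?W Z (i, a) * v a) = v i + (if i \<in> S then \<Sum>t\<in>T. Z (i, t) * v t else 0)"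
    if "i < n" for i v Z
  proof -
    have one: "(\<Sum>a<n. mone (i, a) * v a) = v i" if "i < n" for i
      using that by (simp add: mone_def of_bool_def if_distrib[of "\<lambda>x. x * _"] cong: if_cong)
    show ?thesis using that ST(2) by (simp add: row_mmul_unip[OF that ST(1,2)] one subset_iff)
  qed
  have R: "(\<Sum>a<n. ?R Z Y (t, a) * v a) = v t + (\<Sum>l\<in>S. Y (t, l) * (v l + (\<Sum>t\<in>T. Z (l, t) * v t)))"
    if "t \<in> T" for t v Z Y
  proof -
    have t: "t < n" "t \<notin> S" using ST that by auto
    have "(\<Sum>l\<in>S. Y (t, l) * (\<Sum>a<n. ?W Z (l, a) * v a)) =
        (\<Sum>l\<in>S. Y (t, l) * (v l + (\<Sum>t\<in>T. Z (l, t) * v t)))"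
      using ST by (intro sum.cong refl) (subst W, auto)
    then show ?thesis using that t by (simp add: row_mmul_unip[OF t(1) ST(2,1)] W)
  qed
  \<comment> \<open>If a row of \<open>N\<close> indexed by \<open>S\<close> is nonzero, the averages over \<open>X\<close> and \<open>Y\<close> suffice;
    otherwise \<open>X\<close> drops out of the pairing and the averages over \<open>Y\<close> and \<open>Z\<close> do the job.\<close>
  show ?thesis
  proof (cases "\<exists>i\<in>S. \<exists>a<n. \<not> q dvd N (i, a)")
    case True
    then obtain i0 a0 where i0: "i0 \<in> S" "a0 < n" "\<not> q dvd N (i0, a0)" by blast
    \<comment> \<open>The coefficient of \<open>Y (t, l)\<close> in the condition that comes from
      row \<open>i0\<close> of \<open>N\<close>.\<close>
    let ?c = "\<lambda>Z l. N (i0, l) + (\<Sum>t\<in>T. Z (l, t) * N (i0, t))"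
    have X: "norm (avg (?ST) (\<lambda>X. echar q (pairing (sq n) (ens n (Z, Y, X)) N))) \<le>
        of_bool (\<forall>t\<in>T. q dvd N (i0, t) + (\<Sum>l\<in>S. Y (t, l) * ?c Z l))" for Z Y
    proof -
      have "avg (?ST) (\<lambda>X. echar q (pairing (sq n) (ens n (Z, Y, X)) N)) =
          echar q (pairing (sq n) (?R Z Y) N) *
          of_bool (\<forall>it\<in>S \<times> T. q dvd (\<Sum>a<n. ?R Z Y (snd it, a) * N (fst it, a)))"
        using ST(1-5) q0 by (simp add: ens pairing_mmul_unip echar_add avg_cmult avg_echar_mod_box)
      moreover have "q dvd N (i0, t) + (\<Sum>l\<in>S. Y (t, l) * ?c Z l)"
        if "q dvd (\<Sum>a<n. ?R Z Y (t, a) * N (i0, a))" "t \<in> T" for t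
        using that R[of t Y Z "\<lambda>a. N (i0, a)"] by simp
      ultimately show ?thesis using i0(1) by (simp only:) (rule norm_echar_of_bool_le, force)
    qed
    have Y: "avg (?TS) (\<lambda>Y. of_bool (\<forall>t\<in>T. q dvd N (i0, t) + (\<Sum>l\<in>S. Y (t, l) * ?c Z l))) \<le>
        (1 / real p) ^ (n div 2)" for Z
    proof -
      \<comment> \<open>If all constants and coefficients vanished modulo \<open>q\<close>, then so
        would the entries of row \<open>i0\<close> in \<open>T\<close>, hence also those in
        \<open>S\<close>, contrary to the choice of \<open>i0\<close>.\<close>
      have "(\<exists>t\<in>T. \<not> q dvd N (i0, t)) \<or> (\<exists>l\<in>S. \<not> q dvd ?c Z l)"
      proof (rule ccontr)
        assume "\<not> ?thesis"
        then have T: "\<And>t. t \<in> T \<Longrightarrow> q dvd N (i0, t)" and S: "\<And>l. l \<in> S \<Longrightarrow> q dvd ?c Z l" by auto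
        have "q dvd (\<Sum>t\<in>T. Z (l, t) * N (i0, t))" for l using T by (intro dvd_sum) auto
        then have "q dvd N (i0, l)" if "l \<in> S" for l using S[OF that] by (simp add: dvd_add_left_iff)
        then show False using i0 T ST(6) by auto
      qed
      from prob_affine_zero[OF p q ST(4,3) this]
      have "avg (?TS) (\<lambda>Y. of_bool (\<forall>t\<in>T. q dvd N (i0, t) + (\<Sum>l\<in>S. Y (t, l) * ?c Z l))) \<le>
          (1 / real p) ^ card T" by simp
      also have "\<dots> \<le> (1 / real p) ^ (n div 2)" using card(2) p1 by (intro power_decreasing) auto
      finally show ?thesis .
    qed
    have XY: "avg (?TS) (\<lambda>Y.
          norm (avg (?ST) (\<lambda>X. echar q (pairing (sq n) (ens n (Z, Y, X)) N)))) \<le>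
        (1 / real p) ^ (n div 2)" for Z
      by (rule order_trans[OF avg_mono[OF X] Y])
    have "norm (avg (ens_index n q) (\<lambda>w. echar q (pairing (sq n) (ens n w) N))) \<le>
        avg (?ST) (\<lambda>Z. avg (?TS) (\<lambda>Y.
          norm (avg (?ST) (\<lambda>X. echar q (pairing (sq n) (ens n (Z, Y, X)) N)))))"
      unfolding index avg_Times by (rule order_trans[OF norm_avg]) (intro avg_mono norm_avg)
    also have "\<dots> \<le> avg (?ST) (\<lambda>Z. (1 / real p) ^ (n div 2))"
      by (intro avg_mono XY)
    also have "\<dots> = (1 / real p) ^ (n div 2)"
      using ST q0 by (intro avg_const) (auto simp: mod_box_nonempty)
    finally show ?thesis .
  next
    case False
    then obtain t0 a0 where t0: "t0 \<in> T" "a0 < n" "\<not> q dvd N (t0, a0)" using N ST(6) by blast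
    have X: "echar q (pairing (sq n) (ens n (Z, Y, X)) N) = echar q (pairing (sq n) (?R Z Y) N)" for X Y Z
    proof (rule echar_cong[OF q0])
      have "q dvd (\<Sum>it\<in>S \<times> T. X it * (\<Sum>a<n. ?R Z Y (snd it, a) * N (fst it, a)))"
        using False by (intro dvd_sum dvd_mult) auto
      then show "[pairing (sq n) (ens n (Z, Y, X)) N = pairing (sq n) (?R Z Y) N] (mod q)"
        using ST(1-5) by (simp add: ens pairing_mmul_unip cong_iff_dvd_diff)
    qed
    have Y: "norm (avg (?TS) (\<lambda>Y. echar q (pairing (sq n) (?R Z Y) N))) \<le>
        of_bool (\<forall>l\<in>S. q dvd N (t0, l) + (\<Sum>t\<in>T. Z (l, t) * N (t0, t)))" for Z
    proof -
      have "avg (?TS) (\<lambda>Y. echar q (pairing (sq n) (?R Z Y) N)) =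
          echar q (pairing (sq n) (?W Z) N) *
          of_bool (\<forall>it\<in>T \<times> S. q dvd (\<Sum>a<n. ?W Z (snd it, a) * N (fst it, a)))"
        using ST(1-5) q0 by (simp add: pairing_mmul_unip[OF ST(2,1)] echar_add avg_cmult avg_echar_mod_box)
      moreover have "q dvd N (t0, l) + (\<Sum>t\<in>T. Z (l, t) * N (t0, t))"
        if "q dvd (\<Sum>a<n. ?W Z (l, a) * N (t0, a))" "l \<in> S" for l
        using that W[of l Z "\<lambda>a. N (t0, a)"] ST(1) by auto
      ultimately show ?thesis using t0(1) by (simp only:) (rule norm_echar_of_bool_le, force)
    qed
    have "norm (avg (ens_index n q) (\<lambda>w. echar q (pairing (sq n) (ens n w) N))) \<le>
        avg (?ST) (\<lambda>Z. norm (avg (?TS) (\<lambda>Y. echar q (pairing (sq n) (?R Z Y) N))))"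
      unfolding index avg_Times X using ST(1-5) q0
      by (simp add: avg_const mod_box_nonempty norm_avg)
    also have "\<dots> \<le> avg (?ST)
        (\<lambda>Z. of_bool (\<forall>l\<in>S. q dvd N (t0, l) + (\<Sum>t\<in>T. Z (l, t) * N (t0, t))))"
      by (intro avg_mono Y)
    also have "\<dots> \<le> (1 / real p) ^ card S"
      using t0 ST(6) by (intro prob_affine_zero[OF p q ST(3,4)]) auto
    finally show ?thesis by (simp add: card)
  qed
qed

text \<open>Two applications of \<open>ens_char_bound\<close>. Averaging over the right factor
  leaves, up to an error, the event that the transpose of \<open>U B\<close> times \<open>C\<close>
  vanishes modulo \<open>q\<close>. One column of this event, expanded over \<open>x\<close>, is
  again a pairing with \<open>U\<close>, now against the rank-one matrix formed from a column of
  \<open>C\<close> and the vector \<open>B x\<close>.\<close>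

lemma bilinear_char_bound:
  fixes p :: nat and B C :: "nat \<times> nat \<Rightarrow> int"
  assumes p: "prime p" "k > 0" and q: "q = int p ^ k" and C: "\<exists>ij\<in>sq n. \<not> q dvd C ij"
  shows "norm (avg (ens_index n q \<times> ens_index n q)
      (\<lambda>uv. echar q (pairing (sq n) C (mmul n (ens n (fst uv)) (mmul n B (ens n (snd uv))))))) \<le>
    avg (mod_box {..<n} q) (\<lambda>x. of_bool (\<forall>a<n. int p dvd (\<Sum>b<n. B (a, b) * x b))) + 2 * (1 / real p) ^ (n div 2)"
proof -
  let ?\<delta> = "(1 / real p) ^ (n div 2)"
  let ?E = "ens_index n q"
  have q0: "q > 0" using p q by (simp add: prime_gt_0_nat)
  define N where "N = (\<lambda>u. mmul n (\<lambda>(i, j). mmul n (ens n u) B (j, i)) C)"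
  have N: "pairing (sq n) C (mmul n (ens n u) (mmul n B (ens n v))) = pairing (sq n) (ens n v) (N u)" for u v
    by (simp only: mmul_assoc[symmetric] pairing_mmul[of n C "mmul n (ens n u) B"] N_def)
  obtain i0 j0 where C0: "i0 < n" "j0 < n" "\<not> q dvd C (i0, j0)" using C by auto
  let ?M = "\<lambda>x (i, a). C (i, j0) * (\<Sum>b<n. B (a, b) * x b)"
  have M: "(\<Sum>b<n. x b * N u (b, j0)) = pairing (sq n) (ens n u) (?M x)" for x u
  proof -
    have "(\<Sum>b<n. x b * N u (b, j0)) = (\<Sum>b<n. \<Sum>i<n. \<Sum>a<n. ens n u (i, a) * (C (i, j0) * (B (a, b) * x b)))"
      by (simp add: N_def mmul_def sum_distrib_left sum_distrib_right mult_ac)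
    also have "\<dots> = (\<Sum>i<n. \<Sum>b<n. \<Sum>a<n. ens n u (i, a) * (C (i, j0) * (B (a, b) * x b)))"
      by (rule sum.swap)
    also have "\<dots> = (\<Sum>i<n. \<Sum>a<n. \<Sum>b<n. ens n u (i, a) * (C (i, j0) * (B (a, b) * x b)))"
      by (rule sum.cong[OF refl], rule sum.swap)
    finally show ?thesis by (simp add: pairing_def sum.cartesian_product' sum_distrib_left)
  qed
  have inner: "norm (avg ?E (\<lambda>v. echar q (pairing (sq n) C (mmul n (ens n u) (mmul n B (ens n v)))))) \<le>
      of_bool (\<forall>b<n. q dvd N u (b, j0)) + ?\<delta>" for u
  proof (cases "\<forall>b<n. q dvd N u (b, j0)")
    case True
    have "norm (avg ?E (\<lambda>v. echar q (pairing (sq n) (ens n v) (N u)))) \<le> 1"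
      by (rule order_trans[OF norm_avg]) (intro avg_le_const, auto)
    then show ?thesis using True by (simp add: N add_increasing2)
  next
    case False
    then show ?thesis unfolding N using ens_char_bound[OF p q, of n "N u"] C0(2) by auto
  qed
  have col: "norm (avg ?E (\<lambda>u. echar q (\<Sum>b<n. x b * N u (b, j0)))) \<le>
      of_bool (\<forall>a<n. int p dvd (\<Sum>b<n. B (a, b) * x b)) + ?\<delta>" for x
  proof (cases "\<forall>a<n. int p dvd (\<Sum>b<n. B (a, b) * x b)")
    case True
    have "norm (avg ?E (\<lambda>u. echar q (\<Sum>b<n. x b * N u (b, j0)))) \<le> 1"
      by (rule order_trans[OF norm_avg]) (intro avg_le_const, auto)
    then show ?thesis using True by (simp add: add_increasing2)
  next
    case False
    then obtain a where a: "a < n" "\<not> int p dvd (\<Sum>b<n. B (a, b) * x b)" by blast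
    \<comment> \<open>An entry of \<open>B x\<close> prime to \<open>p\<close> is a unit modulo
      \<open>q\<close>, so its product with \<open>C (i0, j0)\<close> stays nonzero. Hence only the
      kernel of \<open>B\<close> modulo \<open>p\<close> matters, although the matrices live modulo
      \<open>q\<close>.\<close>
    then have "coprime q (\<Sum>b<n. B (a, b) * x b)"
      using p q by (simp add: prime_imp_coprime)
    then have "\<not> q dvd ?M x (i0, a)" using C0 by (simp add: coprime_dvd_mult_left_iff)
    then have "\<exists>ij\<in>sq n. \<not> q dvd ?M x ij" using a(1) C0(1) by (intro bexI[of _ "(i0, a)"]) auto
    from ens_char_bound[OF p q this] False show ?thesis unfolding M by auto
  qed
  have "avg ?E (\<lambda>u. of_bool (\<forall>b<n. q dvd N u (b, j0)) :: real) =
      norm (avg ?E (\<lambda>u. of_bool (\<forall>b<n. q dvd N u (b, j0)) :: complex))"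
    by (simp add: avg_of_bool norm_divide)
  also have "\<dots> = norm (avg (mod_box {..<n} q) (\<lambda>x. avg ?E (\<lambda>u. echar q (\<Sum>b<n. x b * N u (b, j0)))))"
  proof -
    have "(of_bool (\<forall>b<n. q dvd N u (b, j0)) :: complex) =
        avg (mod_box {..<n} q) (\<lambda>x. echar q (\<Sum>b<n. x b * N u (b, j0)))" for u
      using avg_echar_mod_box[of "{..<n}" q "\<lambda>b. N u (b, j0)"] q0 by (simp add: Ball_def)
    then show ?thesis by (subst avg_swap) simp
  qed
  also have "\<dots> \<le> avg (mod_box {..<n} q) (\<lambda>x. of_bool (\<forall>a<n. int p dvd (\<Sum>b<n. B (a, b) * x b)) + ?\<delta>)"
    by (rule order_trans[OF norm_avg]) (intro avg_mono col)
  also have "\<dots> = avg (mod_box {..<n} q) (\<lambda>x. of_bool (\<forall>a<n. int p dvd (\<Sum>b<n. B (a, b) * x b))) + ?\<delta>"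
    using q0 by (simp add: avg_add avg_const mod_box_nonempty)
  finally have outer: "avg ?E (\<lambda>u. of_bool (\<forall>b<n. q dvd N u (b, j0)) :: real) \<le> \<dots>" .
  have "norm (avg (?E \<times> ?E)
      (\<lambda>uv. echar q (pairing (sq n) C (mmul n (ens n (fst uv)) (mmul n B (ens n (snd uv))))))) \<le>
      avg ?E (\<lambda>u. of_bool (\<forall>b<n. q dvd N u (b, j0)) + ?\<delta>)"
    unfolding avg_Times fst_conv snd_conv by (rule order_trans[OF norm_avg]) (intro avg_mono inner)
  also have "\<dots> = avg ?E (\<lambda>u. of_bool (\<forall>b<n. q dvd N u (b, j0))) + ?\<delta>"
    using q0 by (simp add: avg_add avg_const ens_index_nonempty)
  finally show ?thesis using outer by simp
qed

section \<open>Reduction modulo \<open>q\<close> and invariance under row and column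
  operations\<close>

definition mred :: "int \<Rightarrow> nat \<Rightarrow> (nat \<times> nat \<Rightarrow> int) \<Rightarrow> nat \<times> nat \<Rightarrow> int" where
  "mred q n A = (\<lambda>ij\<in>sq n. A ij mod q)"

lemma mred_in: "q > 0 \<Longrightarrow> mred q n A \<in> mod_box (sq n) q"
  by (auto simp: mred_def mod_box_def)

lemma mmul_cong_mod:
  assumes "\<And>l. l < n \<Longrightarrow> [A (i, l) = A' (i, l)] (mod q)" "\<And>l. l < n \<Longrightarrow> [B (l, j) = B' (l, j)] (mod q)"
  shows "[mmul n A B (i, j) = mmul n A' B' (i, j)] (mod q)"
  using assms by (auto simp: mmul_def intro!: cong_sum cong_mult)

lemma mred_cong: "ij \<in> sq n \<Longrightarrow> [mred q n A ij = A ij] (mod q)"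
  by (simp add: mred_def cong_def)

lemma sandwich_cong:
  assumes "\<And>ij. ij \<in> sq n \<Longrightarrow> [A ij = A' ij] (mod q)" "i < n" "j < n"
  shows "[mmul n U (mmul n A V) (i, j) = mmul n U (mmul n A' V) (i, j)] (mod q)"
  using assms by (intro mmul_cong_mod cong_refl) auto

lemma sandwich_add:
  "mmul n U (mmul n (\<lambda>ij. A ij + B ij) V) ij = mmul n U (mmul n A V) ij + mmul n U (mmul n B V) ij"
  by (simp add: mmul_def distrib_left distrib_right sum.distrib split: prod.split)

text \<open>The sandwich with the inverse matrices undoes the map, even with the reduction in
  between; injectivity is enough on a finite box.\<close>

lemma sandwich_bij:
  assumes q: "q > 0" and U: "unimod n U" and V: "unimod n V"
  shows "bij_betw (\<lambda>A. mred q n (mmul n U (mmul n A V))) (mod_box (sq n) q) (mod_box (sq n) q)"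
proof -
  obtain U' where U': "\<forall>ij\<in>sq n. mmul n U U' ij = mone ij \<and> mmul n U' U ij = mone ij"
    using U by (auto simp: unimod_def)
  obtain V' where V': "\<forall>ij\<in>sq n. mmul n V V' ij = mone ij \<and> mmul n V' V ij = mone ij"
    using V by (auto simp: unimod_def)
  have inv: "mred q n (mmul n U' (mmul n (mred q n (mmul n U (mmul n A V))) V')) = A"
    if "A \<in> mod_box (sq n) q" for A
  proof (rule mod_box_eqI[OF mred_in[OF q] that])
    fix ij assume "ij \<in> sq n"
    then obtain i j where ij: "ij = (i, j)" "i < n" "j < n" by auto
    have "[mred q n (mmul n U' (mmul n (mred q n (mmul n U (mmul n A V))) V')) (i, j) =
        mmul n U' (mmul n (mmul n U (mmul n A V)) V') (i, j)] (mod q)"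
      using ij by (intro cong_trans[OF mred_cong] sandwich_cong mred_cong) auto
    also have "mmul n U' (mmul n (mmul n U (mmul n A V)) V') (i, j) =
        mmul n (mmul n U' U) (mmul n A (mmul n V V')) (i, j)"
      by (simp add: mmul_assoc)
    also have "\<dots> = mmul n mone (mmul n A mone) (i, j)"
      using ij U' V' by (intro mmul_cong) auto
    also have "\<dots> = A (i, j)" using ij by (simp add: mmul_mone_left mmul_mone_right)
    finally show "[mred q n (mmul n U' (mmul n (mred q n (mmul n U (mmul n A V))) V')) ij = A ij] (mod q)"
      using ij by simp
  qed
  have "inj_on (\<lambda>A. mred q n (mmul n U (mmul n A V))) (mod_box (sq n) q)"
    by (rule inj_on_inverseI) (rule inv)
  then show ?thesis
    using endo_inj_surj[of "mod_box (sq n) q" "\<lambda>A. mred q n (mmul n U (mmul n A V))"] mred_in[OF q]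
    by (simp add: bij_betw_def image_subset_iff)
qed

lemma sandwich_mod_shift:
  assumes "q > 0"
  shows "mred q n (mmul n U (mmul n (mod_shift (sq n) q B A) V)) =
    mod_shift (sq n) q (mmul n U (mmul n B V)) (mred q n (mmul n U (mmul n A V)))"
proof (rule mod_box_eqI[OF mred_in mod_shift_in])
  fix ij assume ij: "ij \<in> sq n"
  have sh: "[mod_shift (sq n) q B A ij = A ij + B ij] (mod q)" if "ij \<in> sq n" for ij A B
    using that by (simp add: mod_shift_def cong_def)
  have "[mred q n (mmul n U (mmul n (mod_shift (sq n) q B A) V)) ij =
      mmul n U (mmul n (\<lambda>ij. A ij + B ij) V) ij] (mod q)"
    using ij by (cases ij) (auto intro!: cong_trans[OF mred_cong] sandwich_cong sh)
  also have "mmul n U (mmul n (\<lambda>ij. A ij + B ij) V) ij = mmul n U (mmul n A V) ij + mmul n U (mmul n B V) ij"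
    by (rule sandwich_add)
  also have "[mmul n U (mmul n A V) ij + mmul n U (mmul n B V) ij = mred q n (mmul n U (mmul n A V)) ij + mmul n U (mmul n B V) ij] (mod q)"
    using mred_cong[OF ij] by (intro cong_add cong_refl) (rule cong_sym)
  also have "[mred q n (mmul n U (mmul n A V)) ij + mmul n U (mmul n B V) ij =
      mod_shift (sq n) q (mmul n U (mmul n B V)) (mred q n (mmul n U (mmul n A V))) ij] (mod q)"
    using sh[OF ij] by (rule cong_sym)
  finally show "[mred q n (mmul n U (mmul n (mod_shift (sq n) q B A) V)) ij =
    mod_shift (sq n) q (mmul n U (mmul n B V)) (mred q n (mmul n U (mmul n A V))) ij] (mod q)" .
qed (use assms in auto)

theorem biinvariant_decorrelation:
  fixes p :: nat and B :: "nat \<times> nat \<Rightarrow> int"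
  assumes p: "prime p" "k > 0" and q: "q = int p ^ k"
    and P: "\<And>U V A. \<lbrakk>unimod n U; unimod n V; A \<in> mod_box (sq n) q\<rbrakk> \<Longrightarrow>
      P (mred q n (mmul n U (mmul n A V))) \<longleftrightarrow> P A"
    and Q: "\<And>U V A. \<lbrakk>unimod n U; unimod n V; A \<in> mod_box (sq n) q\<rbrakk> \<Longrightarrow>
      Q (mred q n (mmul n U (mmul n A V))) \<longleftrightarrow> Q A"
  shows "\<bar>avg (mod_box (sq n) q) (\<lambda>A. of_bool (P A \<and> Q (mod_shift (sq n) q B A))) -
      avg (mod_box (sq n) q) (\<lambda>A. of_bool (P A)) * avg (mod_box (sq n) q) (\<lambda>A. of_bool (Q A))\<bar> \<le>
    avg (mod_box {..<n} q) (\<lambda>x. of_bool (\<forall>a<n. int p dvd (\<Sum>b<n. B (a, b) * x b))) + 2 * (1 / real p) ^ (n div 2)"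
proof -
  let ?X = "mod_box (sq n) q" and ?E = "ens_index n q"
  let ?W = "\<lambda>uv. mmul n (ens n (fst uv)) (mmul n B (ens n (snd uv)))"
  let ?\<epsilon> = "avg (mod_box {..<n} q) (\<lambda>x. of_bool (\<forall>a<n. int p dvd (\<Sum>b<n. B (a, b) * x b))) + 2 * (1 / real p) ^ (n div 2)"
  have q0: "q > 0" using p q by (simp add: prime_gt_0_nat)
  \<comment> \<open>The joint average at shift \<open>U B V\<close> does not depend on the ensemble
    index, so the ensemble average in \<open>decorrelation\<close> is the joint average for
    \<open>B\<close> itself.\<close>
  have inv: "avg ?X (\<lambda>A. of_bool (P A) * of_bool (Q (mod_shift (sq n) q (?W uv) A)) :: complex) =
      avg ?X (\<lambda>A. of_bool (P A \<and> Q (mod_shift (sq n) q B A)))" for uv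
  proof -
    let ?h = "\<lambda>A. mred q n (mmul n (ens n (fst uv)) (mmul n A (ens n (snd uv))))"
    have "(\<Sum>A\<in>?X. of_bool (P A) * of_bool (Q (mod_shift (sq n) q (?W uv) A)) :: complex) =
        (\<Sum>A\<in>?X. of_bool (P (?h A)) * of_bool (Q (mod_shift (sq n) q (?W uv) (?h A))))"
      by (rule sum.reindex_bij_betw[symmetric]) (rule sandwich_bij[OF q0 unimod_ens unimod_ens])
    also have "\<dots> = (\<Sum>A\<in>?X. of_bool (P A \<and> Q (mod_shift (sq n) q B A)))"
    proof (intro sum.cong refl)
      fix A assume "A \<in> ?X"
      moreover have "Q (mod_shift (sq n) q (?W uv) (?h A)) \<longleftrightarrow> Q (mod_shift (sq n) q B A)"
        using Q[OF unimod_ens unimod_ens mod_shift_in[OF q0]] by (simp only: sandwich_mod_shift[OF q0, symmetric])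
      ultimately show "of_bool (P (?h A)) * of_bool (Q (mod_shift (sq n) q (?W uv) (?h A))) =
          (of_bool (P A \<and> Q (mod_shift (sq n) q B A)) :: complex)"
        using P[OF unimod_ens unimod_ens] by simp
    qed
    finally show ?thesis by (simp add: avg_def)
  qed
  have "norm (avg (?E \<times> ?E) (\<lambda>uv. avg ?X (\<lambda>A. of_bool (P A) * of_bool (Q (mod_shift (sq n) q (?W uv) A)))) -
      avg ?X (\<lambda>A. of_bool (P A) :: complex) * avg ?X (\<lambda>A. of_bool (Q A))) \<le> ?\<epsilon>"
  proof (rule decorrelation)
    fix C assume C: "C \<in> ?X" "\<exists>ij\<in>sq n. C ij \<noteq> 0"
    then have "\<exists>ij\<in>sq n. \<not> q dvd C ij"
      using mod_box_D[OF C(1)] by (metis zdvd_not_zless order_le_less)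
    then show "norm (avg (?E \<times> ?E) (\<lambda>uv. echar q (pairing (sq n) C (?W uv)))) \<le> ?\<epsilon>"
      by (rule bilinear_char_bound[OF p q])
  next
    have "0 \<le> avg (mod_box {..<n} q) (\<lambda>x. of_bool (\<forall>a<n. int p dvd (\<Sum>b<n. B (a, b) * x b)) :: real)"
      by (simp add: avg_of_bool)
    then show "0 \<le> ?\<epsilon>" by simp
  qed (use q0 in \<open>auto simp: ens_index_nonempty\<close>)
  then have "norm (avg ?X (\<lambda>A. of_bool (P A \<and> Q (mod_shift (sq n) q B A)) :: complex) -
      avg ?X (\<lambda>A. of_bool (P A)) * avg ?X (\<lambda>A. of_bool (Q A))) \<le> ?\<epsilon>"
    unfolding inv using q0 by (simp add: avg_const ens_index_nonempty)
  also have "avg ?X (\<lambda>A. of_bool (P A \<and> Q (mod_shift (sq n) q B A)) :: complex) -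
      avg ?X (\<lambda>A. of_bool (P A)) * avg ?X (\<lambda>A. of_bool (Q A)) =
    complex_of_real (avg ?X (\<lambda>A. of_bool (P A \<and> Q (mod_shift (sq n) q B A))) -
      avg ?X (\<lambda>A. of_bool (P A)) * avg ?X (\<lambda>A. of_bool (Q A)))"
    by (simp add: avg_of_bool)
  finally show ?thesis by (simp only: norm_of_real)
qed

section \<open>Generating tuples of finite abelian p-groups\<close>

lemma (in group_hom) order_eq_kernel_image:
  "order G = card (kernel G H h) * card (h ` carrier G)"
proof -
  let ?I = "H\<lparr>carrier := h ` carrier G\<rparr>"
  have I: "group ?I" by (rule H.subgroup_imp_group[OF img_is_subgroup])
  interpret I: group_hom G ?I h
    using I by (intro group_hom.intro G.group_axioms group_hom_axioms.intro) (auto simp: hom_def)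
  have K: "kernel G ?I h = kernel G H h" by (simp add: kernel_def)
  have "card (carrier (G Mod kernel G H h)) = card (h ` carrier G)"
    using I.FactGroup_iso_set[unfolded K] by (auto simp: iso_def dest: bij_betw_same_card)
  then show ?thesis
    using G.lagrange[OF subgroup_kernel] by (simp add: FactGroup_def mult.commute)
qed

text \<open>By Bezout, \<open>x\<close> is a product of powers of \<open>x^p\<close> and
  \<open>x^i\<close>.\<close>

lemma (in group) pow_coprime_mem:
  fixes p i :: nat
  assumes H: "subgroup H G" and x: "x \<in> carrier G" and "x [^] p \<in> H" "x [^] i \<in> H" "coprime p i"
  shows "x \<in> H"
proof -
  obtain a b where ab: "a * int p + b * int i = 1"
    using bezout_int[of "int p" "int i"] assms(5) by (auto simp: coprime_iff_gcd_eq_1)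
  have "x = x [^] (a * int p + b * int i)" using x by (simp only: ab) (simp add: int_pow_1)
  also have "\<dots> = (x [^] p) [^] a \<otimes> (x [^] i) [^] b"
    using x by (simp add: int_pow_mult int_pow_pow mult.commute flip: int_pow_int)
  also have "\<dots> \<in> H"
    using assms by (intro subgroup.m_closed[OF H] subgroup_int_pow_closed[OF H])
  finally show ?thesis .
qed

text \<open>The subgroup generated is the union of the cosets of \<open>H\<close> by
  \<open>x^i\<close> with \<open>i < p\<close>. Two equal ones would put \<open>x^(j-i)\<close> into
  \<open>H\<close> with \<open>j - i\<close> prime to \<open>p\<close>, and then \<open>x\<close>
  itself.\<close>

lemma (in comm_group) card_adjoin:
  fixes p :: nat
  assumes p: "prime p" and fin: "finite (carrier G)" and H: "subgroup H G"
    and x: "x \<in> carrier G" "x \<notin> H" "x [^] p \<in> H"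
  shows "card (generate G (insert x H)) = p * card H"
proof -
  interpret H: subgroup H G by fact
  let ?f = "\<lambda>(h, i::nat). h \<otimes> x [^] i"
  let ?M = "?f ` (H \<times> {..<p})"
  have red: "h \<otimes> x [^] z \<in> ?M" if "h \<in> H" for h and z :: nat
  proof -
    have "x [^] z = x [^] (p * (z div p) + z mod p)" by simp
    also have "\<dots> = (x [^] p) [^] (z div p) \<otimes> x [^] (z mod p)"
      using x(1) by (simp add: nat_pow_mult nat_pow_pow)
    finally have "h \<otimes> x [^] z = ?f (h \<otimes> (x [^] p) [^] (z div p), z mod p)"
      using that x H.subset by (simp add: m_assoc subset_iff)
    moreover have "(x [^] p) [^] (z div p) \<in> H"
      using subgroup_int_pow_closed[OF H x(3), of "int (z div p)"] by (simp add: int_pow_int)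
    ultimately show ?thesis using that p
      by (intro image_eqI[of _ ?f "(h \<otimes> (x [^] p) [^] (z div p), z mod p)"])
        (auto simp: prime_gt_0_nat H.m_closed)
  qed
  have M: "subgroup ?M G"
  proof (rule subgroupI)
    show "?M \<subseteq> carrier G" using x H.subset by auto
    show "?M \<noteq> {}" using prime_gt_0_nat[OF p] H.one_closed by (auto simp del: H.one_closed)
    show "inv a \<in> ?M" if a: "a \<in> ?M" for a
    proof -
      obtain h i where *: "h \<in> H" "a = h \<otimes> x [^] (i::nat)" using a by auto
      \<comment> \<open>The inverse of \<open>x^i\<close> is the inverse of \<open>(x^p)^i\<close>,
        an element of \<open>H\<close>, times \<open>x^((p-1)i)\<close>, so natural exponents
        suffice.\<close>
      have "(x [^] p) [^] i = x [^] i \<otimes> x [^] ((p - 1) * i)"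
        using x(1) prime_gt_0_nat[OF p] by (simp add: nat_pow_pow nat_pow_mult algebra_simps)
      then have "inv a = (inv h \<otimes> inv ((x [^] p) [^] i)) \<otimes> x [^] ((p - 1) * i)"
        using * x H.subset by (simp add: inv_mult m_assoc subset_iff)
      moreover have "(x [^] p) [^] i \<in> H"
        using subgroup_int_pow_closed[OF H x(3), of "int i"] by (simp add: int_pow_int)
      ultimately show ?thesis using red *(1) by simp
    qed
    fix a b assume "a \<in> ?M" "b \<in> ?M"
    then obtain h i h' j where *: "h \<in> H" "h' \<in> H" "a = h \<otimes> x [^] (i::nat)" "b = h' \<otimes> x [^] (j::nat)" by auto
    then have "a \<otimes> b = (h \<otimes> h') \<otimes> x [^] (i + j)"
      using x H.subset by (simp add: m_ac subset_iff flip: nat_pow_mult)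
    then show "a \<otimes> b \<in> ?M" using red[of "h \<otimes> h'" "i + j"] * by simp
  qed
  have "generate G (insert x H) = ?M"
  proof (rule generateI[symmetric, OF M])
    show "insert x H \<subseteq> ?M"
      using red[of \<one> 1] red[of _ 0] x(1) by (auto simp: H.one_closed)
    fix K assume K: "subgroup K G" "insert x H \<subseteq> K"
    have "x [^] i \<in> K" for i :: nat
      using subgroup_int_pow_closed[OF K(1), of x "int i"] K(2) by (simp add: int_pow_int)
    then show "?M \<subseteq> K" using K by (auto intro: subgroup.m_closed[OF K(1)])
  qed
  moreover have "inj_on ?f (H \<times> {..<p})"
  proof -
    have aux: "i = j" if "i \<le> j" "j < p" "h \<in> H" "h' \<in> H" "h \<otimes> x [^] i = h' \<otimes> x [^] j" for h h' and i j :: nat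
    proof (rule ccontr)
      assume "i \<noteq> j"
      then have cop: "coprime p (j - i)" using that p
        by (metis coprime_commute le_neq_implies_less less_imp_diff_less nat_dvd_not_less prime_imp_coprime zero_less_diff)
      have hc: "h \<in> carrier G" "h' \<in> carrier G" using that H.subset by auto
      have "x [^] j = x [^] (j - i) \<otimes> x [^] i" using x(1) that by (simp add: nat_pow_mult)
      then have "h \<otimes> x [^] i = (h' \<otimes> x [^] (j - i)) \<otimes> x [^] i" using that hc x by (simp add: m_assoc)
      then have "h = h' \<otimes> x [^] (j - i)" using x hc by (simp add: right_cancel)
      then have "x [^] (j - i) = inv h' \<otimes> h" using x hc by (simp add: inv_solve_left)
      then have "x [^] (j - i) \<in> H" using that by simp
      then show False using pow_coprime_mem[OF H x(1,3) _ cop] x(2) by simp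
    qed
    have "h = h' \<and> i = j" if *: "i < p" "j < p" "h \<in> H" "h' \<in> H" "h \<otimes> x [^] i = h' \<otimes> x [^] j" for h h' and i j :: nat
    proof -
      have "i = j"
        using aux[of i j h h'] aux[of j i h' h] * by (cases "i \<le> j") auto
      moreover have "h \<in> carrier G" "h' \<in> carrier G" using * H.subset by auto
      ultimately show ?thesis using *(5) x by (simp add: right_cancel)
    qed
    then show ?thesis by (auto simp: inj_on_def)
  qed
  ultimately show ?thesis by (simp add: card_image card_cartesian_product)
qed

lemma (in group) generate_insert_generate:
  assumes "A \<subseteq> carrier G" "x \<in> carrier G"
  shows "generate G (insert x (generate G A)) = generate G (insert x A)"
proof (rule generateI[symmetric])
  show "subgroup (generate G (insert x A)) G" using assms by (intro generate_is_subgroup) auto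
  show "insert x (generate G A) \<subseteq> generate G (insert x A)"
    using mono_generate[of A "insert x A"] by (auto intro: generate.incl)
  show "generate G (insert x A) \<subseteq> K" if "subgroup K G" "insert x (generate G A) \<subseteq> K" for K
    using that by (intro generate_subgroup_incl) (auto intro: generate.incl)
qed

text \<open>Burnside's basis theorem for abelian p-groups. Writing \<open>g = h y^p\<close> and
  treating \<open>y\<close> in the same way gives \<open>g = h y^(p^j)\<close> for every
  \<open>j\<close>; once \<open>p^j\<close> is the group order, the second factor
  disappears.\<close>

lemma (in comm_group) generate_mod_powers:
  fixes p :: nat
  assumes ord: "order G = p ^ e" and X: "X \<subseteq> carrier G"
    and gen: "generate G ((\<lambda>x. x [^] p) ` carrier G \<union> X) = carrier G"
  shows "generate G X = carrier G"
proof -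
  let ?P = "(\<lambda>x. x [^] p) ` carrier G"
  let ?H = "generate G X"
  have H: "subgroup ?H G" by (rule generate_is_subgroup[OF X])
  have P: "subgroup ?P G" by (rule subgroup_pow_image[OF comm_group_axioms])
  have HP: "subgroup (?H <#> ?P) G" by (rule mult_subgroups[OF H P])
  have "?P \<subseteq> ?H <#> ?P" using subgroup.one_closed[OF H] subgroup.subset[OF P]
    by (auto simp: set_mult_def) (metis l_one nat_pow_closed)
  moreover have "X \<subseteq> ?H <#> ?P"
  proof
    fix x assume "x \<in> X"
    then have "x \<in> ?H" "\<one> \<in> ?P" "x \<otimes> \<one> = x"
      using X subgroup.one_closed[OF P] by (auto intro: generate.incl)
    then show "x \<in> ?H <#> ?P" unfolding set_mult_def by blast
  qed
  ultimately have sub: "carrier G \<subseteq> ?H <#> ?P"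
    using generate_subgroup_incl[OF _ HP] gen by (metis Un_least)
  have step: "\<exists>h\<in>?H. \<exists>y\<in>carrier G. g = h \<otimes> y [^] p" if "g \<in> carrier G" for g
  proof -
    have "g \<in> ?H <#> ?P" using sub that by blast
    then show ?thesis by (auto simp: set_mult_def)
  qed
  have "\<exists>h\<in>?H. \<exists>y\<in>carrier G. g = h \<otimes> y [^] (p ^ j)" if "g \<in> carrier G" for g j
  proof (induction j)
    case 0
    then show ?case using that subgroup.one_closed[OF H] by (intro bexI[of _ \<one>] bexI[of _ g]) auto
  next
    case (Suc j)
    then obtain h y where h: "h \<in> ?H" "y \<in> carrier G" "g = h \<otimes> y [^] (p ^ j)" by blast
    obtain h' z where h': "h' \<in> ?H" "z \<in> carrier G" "y = h' \<otimes> z [^] p" using step[OF h(2)] by blast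
    have c: "h \<in> carrier G" "h' \<in> carrier G" using h h' subgroup.subset[OF H] by auto
    have "h' [^] (p ^ j) \<in> ?H"
      using subgroup_int_pow_closed[OF H h'(1), of "int (p ^ j)"] by (simp only: int_pow_int)
    then have "h \<otimes> h' [^] (p ^ j) \<in> ?H" using h by (simp add: subgroup.m_closed[OF H])
    moreover have "g = (h \<otimes> h' [^] (p ^ j)) \<otimes> z [^] (p ^ Suc j)"
      using h h' c by (simp add: nat_pow_distrib nat_pow_pow m_assoc)
    ultimately show ?case using h'(2) by blast
  qed
  then have "\<exists>h\<in>?H. \<exists>y\<in>carrier G. g = h \<otimes> y [^] (order G)" if "g \<in> carrier G" for g
    unfolding ord using that by blast
  then have "carrier G \<subseteq> ?H"
    using pow_order_eq_1 subgroup.subset[OF H] by fastforce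
  then show ?thesis using subgroup.subset[OF H] by auto
qed

text \<open>For building tuples one coordinate at a time: the admissible next entries depend on the
  prefix, but their number does not.\<close>

lemma card_PiE_Suc:
  assumes "finite A" "S \<subseteq> ({..<m} \<rightarrow>\<^sub>E A)"
    and "\<And>x. x \<in> S \<Longrightarrow> T x \<subseteq> A" "\<And>x. x \<in> S \<Longrightarrow> card (T x) = c"
  shows "card {y \<in> {..<Suc m} \<rightarrow>\<^sub>E A. restrict y {..<m} \<in> S \<and> y m \<in> T (restrict y {..<m})} = card S * c"
proof -
  let ?f = "\<lambda>(x, a). x(m := a)"
  let ?R = "{y \<in> {..<Suc m} \<rightarrow>\<^sub>E A. restrict y {..<m} \<in> S \<and> y m \<in> T (restrict y {..<m})}"
  have r: "restrict (x(m := a)) {..<m} = x" if "x \<in> {..<m} \<rightarrow>\<^sub>E A" for x a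
    using PiE_arb[OF that] by (intro ext) (auto simp: restrict_def)
  have u: "(restrict y {..<m})(m := y m) = y" if "y \<in> {..<Suc m} \<rightarrow>\<^sub>E A" for y
    using PiE_arb[OF that] by (intro ext) (auto simp: restrict_def)
  have "bij_betw ?f (Sigma S T) ?R"
  proof (rule bij_betw_byWitness[where f' = "\<lambda>y. (restrict y {..<m}, y m)"])
    show "\<forall>xa\<in>Sigma S T. (restrict (?f xa) {..<m}, ?f xa m) = xa"
    proof
      fix xa assume "xa \<in> Sigma S T"
      then obtain x a where "xa = (x, a)" "x \<in> S" by auto
      moreover have "x \<in> {..<m} \<rightarrow>\<^sub>E A" using assms(2) \<open>x \<in> S\<close> by blast
      ultimately show "(restrict (?f xa) {..<m}, ?f xa m) = xa" by (simp add: r)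
    qed
    show "\<forall>y\<in>?R. ?f (restrict y {..<m}, y m) = y"
    proof
      fix y assume "y \<in> ?R"
      then have "y \<in> {..<Suc m} \<rightarrow>\<^sub>E A" by blast
      from u[OF this] show "?f (restrict y {..<m}, y m) = y" by (simp only: case_prod_conv)
    qed
    show "?f ` Sigma S T \<subseteq> ?R"
    proof
      fix y assume "y \<in> ?f ` Sigma S T"
      then obtain x a where xa: "y = x(m := a)" "x \<in> S" "a \<in> T x" by auto
      have x: "x \<in> {..<m} \<rightarrow>\<^sub>E A" using assms(2) xa(2) by blast
      have "a \<in> A" using assms(3) xa by blast
      then have "y \<in> {..<Suc m} \<rightarrow>\<^sub>E A"
        using x unfolding xa(1) by (auto simp: PiE_iff extensional_def less_Suc_eq)
      then show "y \<in> ?R" using xa r[OF x] by simp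
    qed
    show "(\<lambda>y. (restrict y {..<m}, y m)) ` ?R \<subseteq> Sigma S T" by auto
  qed
  then have "card ?R = card (Sigma S T)"
    by (rule bij_betw_same_card[symmetric])
  also have "\<dots> = (\<Sum>x\<in>S. card (T x))"
    using finite_subset[OF assms(2)] finite_subset[OF assms(3)] assms(1)
    by (intro card_SigmaI) (auto intro: finite_PiE)
  finally show ?thesis using assms(4) by simp
qed

text \<open>The hypothesis on the order says that the quotient by \<open>P\<close> has dimension
  \<open>n\<close> over the field with \<open>p\<close> elements, so the generating
  \<open>n\<close>-tuples are the lifts of its ordered bases. Each new entry has to avoid the
  preimage of the span of the \<open>i\<close> earlier ones, which has \<open>p ^ i * card P\<close>
  elements.\<close>

lemma (in comm_group) card_generating_tuples:
  fixes p :: nat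
  defines "P \<equiv> (\<lambda>x. x [^] p) ` carrier G"
  assumes p: "prime p" and fin: "finite (carrier G)" and ord: "order G = p ^ e"
    and n: "order G = p ^ n * card P"
  shows "real (card {x \<in> {..<n} \<rightarrow>\<^sub>E carrier G. generate G (x ` {..<n}) = carrier G}) =
    real (order G) ^ n * (\<Prod>i<n. 1 - 1 / real p ^ (i + 1))"
proof -
  \<comment> \<open>\<open>H m x\<close> is the preimage of the span of the first \<open>m\<close>
    entries modulo \<open>P\<close>; \<open>S m\<close> below consists of the tuples that are
    independent modulo \<open>P\<close>.\<close>
  define H where "H = (\<lambda>(m::nat) x. generate G (P \<union> x ` {..<m}))"
  define S where "S = (\<lambda>m. {x \<in> {..<m} \<rightarrow>\<^sub>E carrier G. card (H m x) = p ^ m * card P})"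
  have P: "subgroup P G" unfolding P_def by (rule subgroup_pow_image[OF comm_group_axioms])
  have PX: "P \<union> x ` {..<m} \<subseteq> carrier G" if "x \<in> {..<m} \<rightarrow> carrier G" for m and x :: "nat \<Rightarrow> 'a"
    using subgroup.subset[OF P] that by auto
  have H: "subgroup (H m x) G" if "x \<in> {..<m} \<rightarrow> carrier G" for m x
    unfolding H_def by (intro generate_is_subgroup PX that)
  have PH: "P \<subseteq> H m x" for m x unfolding H_def by (auto intro: generate.incl)
  have Hcard_pos: "0 < card (H m x)" if "x \<in> {..<m} \<rightarrow> carrier G" for m x
    using H[OF that] finite_subset[OF subgroup.subset fin] subgroup.one_closed by (metis card_gt_0_iff empty_iff)
  have HSuc: "H (Suc m) x = generate G (insert (x m) (H m x))" if "x \<in> {..<Suc m} \<rightarrow> carrier G" for m x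
    unfolding H_def using that PX[of x m]
    by (subst generate_insert_generate) (auto simp: lessThan_Suc)
  have in_H: "card (H (Suc m) x) = card (H m x)" if "x \<in> {..<Suc m} \<rightarrow> carrier G" "x m \<in> H m x" for m x
  proof -
    have "x \<in> {..<m} \<rightarrow> carrier G" using that(1) by auto
    then have "generate G (H m x) = H m x"
      using H by (intro generateI[symmetric]) auto
    then show ?thesis using HSuc[OF that(1)] that(2) by (simp add: insert_absorb)
  qed
  have notin_H: "card (H (Suc m) x) = p * card (H m x)"
    if "x \<in> {..<Suc m} \<rightarrow> carrier G" "x m \<notin> H m x" for m x
  proof -
    have "x m [^] p \<in> H m x" using PH[of m x] that(1) by (auto simp: P_def)
    then show ?thesis unfolding HSuc[OF that(1)]
      using that by (intro card_adjoin[OF p fin H]) (auto simp: Pi_def)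
  qed
  have Ppos: "card P > 0" using finite_subset[OF subgroup.subset[OF P] fin] subgroup.one_closed[OF P]
    by (auto simp: card_gt_0_iff)
  have le: "card (H m x) \<le> p ^ m * card P" if "x \<in> {..<m} \<rightarrow> carrier G" for m x
    using that
  proof (induction m)
    case 0
    have "generate G P = P" using P by (intro generateI[symmetric]) auto
    then show ?case by (simp add: H_def)
  next
    case (Suc m)
    then have "x \<in> {..<m} \<rightarrow> carrier G" by auto
    then have "card (H m x) \<le> p ^ m * card P" by (rule Suc.IH)
    then have "p * card (H m x) \<le> p ^ Suc m * card P" by simp
    moreover have "card (H m x) \<le> p * card (H m x)" using prime_gt_0_nat[OF p] by simp
    then have "card (H m x) \<le> p ^ Suc m * card P" using calculation by (rule order_trans)
    ultimately show ?case using in_H[OF Suc.prems] notin_H[OF Suc.prems]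
      by (cases "x m \<in> H m x") auto
  qed
  have iff: "card (H (Suc m) x) = p ^ Suc m * card P \<longleftrightarrow> card (H m x) = p ^ m * card P \<and> x m \<notin> H m x"
    if "x \<in> {..<Suc m} \<rightarrow> carrier G" for m x
  proof (cases "x m \<in> H m x")
    case True
    have "card (H m x) \<le> p ^ m * card P" using that by (intro le) auto
    also have "\<dots> < p ^ Suc m * card P" using prime_gt_1_nat[OF p] Ppos by simp
    finally show ?thesis using in_H[OF that True] True by simp
  next
    case False
    then show ?thesis using notin_H[OF that False] prime_gt_0_nat[OF p] by simp
  qed
  have Hrestrict: "H m (restrict x {..<m}) = H m x" for m x
    unfolding H_def by simp
  have S_Suc: "S (Suc m) = {y \<in> {..<Suc m} \<rightarrow>\<^sub>E carrier G. restrict y {..<m} \<in> S m \<and>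
      y m \<in> carrier G - H m (restrict y {..<m})}" for m
  proof -
    have "y \<in> S (Suc m) \<longleftrightarrow> restrict y {..<m} \<in> S m \<and> y m \<in> carrier G - H m (restrict y {..<m})"
      if "y \<in> {..<Suc m} \<rightarrow>\<^sub>E carrier G" for y
      using iff[of y m] that by (auto simp: S_def Hrestrict PiE_iff)
    then show ?thesis by (auto simp: S_def)
  qed
  have count: "real (card (S m)) = (\<Prod>i<m. real (order G) - real p ^ i * real (card P))" for m
  proof (induction m)
    case 0
    have "generate G P = P" using P by (intro generateI[symmetric]) auto
    then show ?case by (simp add: S_def H_def)
  next
    case (Suc m)
    have sub: "p ^ m * card P \<le> order G" if "x \<in> S m" for x
      using that card_mono[OF fin subgroup.subset[OF H[of x m]]] by (auto simp: S_def order_def PiE_def)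
    have "card (S (Suc m)) = card (S m) * (order G - p ^ m * card P)"
      unfolding S_Suc
    proof (rule card_PiE_Suc[OF fin])
      show "card (carrier G - H m x) = order G - p ^ m * card P" if "x \<in> S m" for x
        using that subgroup.subset[OF H[of x m]] finite_subset[OF _ fin, of "H m x"]
        by (subst card_Diff_subset) (auto simp: S_def order_def PiE_def)
    qed (auto simp: S_def)
    then show ?case using Suc sub by (cases "S m = {}") (auto simp: of_nat_diff)
  qed
  have "{x \<in> {..<n} \<rightarrow>\<^sub>E carrier G. generate G (x ` {..<n}) = carrier G} = S n"
  proof -
    have "generate G (x ` {..<n}) = carrier G \<longleftrightarrow> card (H n x) = p ^ n * card P"
      if "x \<in> {..<n} \<rightarrow>\<^sub>E carrier G" for x
    proof
      assume *: "generate G (x ` {..<n}) = carrier G"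
      have "generate G (x ` {..<n}) \<subseteq> H n x" unfolding H_def by (rule mono_generate) auto
      then have "H n x = carrier G" using * subgroup.subset[OF H[of x n]] that by auto
      then show "card (H n x) = p ^ n * card P" using n by (simp add: order_def)
    next
      assume "card (H n x) = p ^ n * card P"
      then have "H n x = carrier G"
        using subgroup.subset[OF H[of x n]] that n fin by (intro card_subset_eq) (auto simp: order_def)
      then have "generate G ((\<lambda>x. x [^] p) ` carrier G \<union> x ` {..<n}) = carrier G"
        unfolding H_def P_def .
      moreover have "x ` {..<n} \<subseteq> carrier G" using that by auto
      ultimately show "generate G (x ` {..<n}) = carrier G"
        by (rule generate_mod_powers[OF ord, rotated])
    qed
    then show ?thesis by (auto simp: S_def)
  qed
  then have "real (card {x \<in> {..<n} \<rightarrow>\<^sub>E carrier G. generate G (x ` {..<n}) = carrier G}) =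
      (\<Prod>i<n. real (order G) - real p ^ i * real (card P))"
    using count by simp
  \<comment> \<open>As \<open>order G = p ^ n * card P\<close>, the removed share at step
    \<open>i\<close> is \<open>p^(i-n)\<close>. Reversing the index afterwards gives the exponents 1
    to \<open>n\<close>.\<close>
  also have "\<dots> = (\<Prod>i<n. real (order G) * (1 - 1 / real p ^ (n - i)))"
  proof (rule prod.cong[OF refl])
    fix i assume "i \<in> {..<n}"
    then have "real p ^ n = real p ^ (n - i) * real p ^ i" by (simp flip: power_add)
    then have "real (order G) = real p ^ (n - i) * (real p ^ i * real (card P))" using n by simp
    then show "real (order G) - real p ^ i * real (card P) = real (order G) * (1 - 1 / real p ^ (n - i))"
      using prime_gt_0_nat[OF p] by (simp add: field_simps)
  qed
  also have "\<dots> = real (order G) ^ n * (\<Prod>i<n. 1 - 1 / real p ^ (n - i))"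
    by (simp add: prod.distrib)
  also have "(\<Prod>i<n. 1 - 1 / real p ^ (n - i)) = (\<Prod>i<n. 1 - 1 / real p ^ (i + 1))"
    by (rule prod.reindex_bij_witness[of _ "\<lambda>i. n - Suc i" "\<lambda>i. n - Suc i"]) (auto simp: Suc_diff_Suc)
  finally show ?thesis .
qed

section \<open>Tuples with a prescribed quotient\<close>

text \<open>Extensionality makes every surjection count once and keeps the set finite for finite
  groups.\<close>

definition epis :: "('a, 'm) monoid_scheme \<Rightarrow> ('b, 'n) monoid_scheme \<Rightarrow> ('a \<Rightarrow> 'b) set" where
  "epis G H = {\<phi> \<in> extensional (carrier G). \<phi> \<in> hom G H \<and> \<phi> ` carrier G = carrier H}"

lemma epis_group_hom: "group G \<Longrightarrow> group H \<Longrightarrow> \<phi> \<in> epis G H \<Longrightarrow> group_hom G H \<phi>"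
  by (simp add: epis_def group_hom_def group_hom_axioms_def)

lemma finite_epis: "finite (carrier G) \<Longrightarrow> finite (carrier H) \<Longrightarrow> finite (epis G H)"
  by (rule finite_subset[OF _ finite_PiE[of "carrier G" "\<lambda>_. carrier H"]])
    (auto simp: epis_def hom_def PiE_def)

lemma (in group_hom) eq_iff_kernel:
  assumes "a \<in> carrier G" "b \<in> carrier G"
  shows "h a = h b \<longleftrightarrow> a \<otimes> inv b \<in> kernel G H h"
proof -
  have "h a = h b \<longleftrightarrow> h a \<otimes>\<^bsub>H\<^esub> inv\<^bsub>H\<^esub> h b = \<one>\<^bsub>H\<^esub>"
    using assms H.inv_solve_right'[of "\<one>\<^bsub>H\<^esub>" "h a" "h b"] by auto
  then show ?thesis using assms by (simp add: kernel_def)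
qed

lemma epis_kernel_iso:
  assumes "group G" "group H" "\<phi> \<in> epis G H"
  shows "G Mod kernel G H \<phi> \<cong> H"
  using group_hom.FactGroup_iso[OF epis_group_hom[OF assms]] assms(3) by (simp add: epis_def)

text \<open>The automorphisms of \<open>H\<close> act simply transitively, by composition, on the
  surjections with kernel \<open>N\<close>; the given isomorphism supplies one of them,
  \<open>\<phi>0\<close>.\<close>

lemma card_epis_kernel:
  assumes N: "normal N G" and H: "group H" and iso: "G Mod N \<cong> H"
  shows "card {\<phi> \<in> epis G H. kernel G H \<phi> = N} = order (AutoGroup H)"
proof -
  interpret N: normal N G by fact
  interpret H: group H by fact
  obtain \<psi> where \<psi>: "\<psi> \<in> hom (G Mod N) H" "bij_betw \<psi> (carrier (G Mod N)) (carrier H)"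
    using iso by (auto simp: is_iso_def iso_def)
  define \<phi>0 where "\<phi>0 = (\<lambda>g\<in>carrier G. \<psi> (N #>\<^bsub>G\<^esub> g))"
  have in_quot: "N #>\<^bsub>G\<^esub> g \<in> carrier (G Mod N)" if "g \<in> carrier G" for g
    using that by (auto simp: carrier_FactGroup)
  have \<phi>0_hom: "\<phi>0 \<in> hom G H"
  proof (rule homI)
    show "\<phi>0 g \<in> carrier H" if "g \<in> carrier G" for g
      using hom_in_carrier[OF \<psi>(1)] in_quot that by (simp add: \<phi>0_def)
    show "\<phi>0 (g \<otimes>\<^bsub>G\<^esub> g') = \<phi>0 g \<otimes>\<^bsub>H\<^esub> \<phi>0 g'" if "g \<in> carrier G" "g' \<in> carrier G" for g g'
      using hom_mult[OF \<psi>(1) in_quot[OF that(1)] in_quot[OF that(2)]] that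
      by (simp add: \<phi>0_def N.rcos_sum)
  qed
  have \<phi>0_surj: "\<phi>0 ` carrier G = carrier H"
  proof -
    have "\<phi>0 ` carrier G = \<psi> ` carrier (G Mod N)"
      by (auto simp: \<phi>0_def carrier_FactGroup)
    then show ?thesis using \<psi>(2) by (simp add: bij_betw_def)
  qed
  have \<phi>0: "\<phi>0 \<in> epis G H" using \<phi>0_hom \<phi>0_surj by (simp add: epis_def \<phi>0_def)
  interpret \<phi>0: group_hom G H \<phi>0 by (rule epis_group_hom[OF N.is_group H \<phi>0])
  have ker: "kernel G H \<phi>0 = N"
  proof -
    have "\<psi> N = \<one>\<^bsub>H\<^esub>"
      using hom_one[OF \<psi>(1) N.factorgroup_is_group H] by simp
    moreover have "N \<in> carrier (G Mod N)" using in_quot[of "\<one>\<^bsub>G\<^esub>"] by (simp add: N.subset)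
    ultimately have "\<psi> (N #>\<^bsub>G\<^esub> g) = \<one>\<^bsub>H\<^esub> \<longleftrightarrow> N #>\<^bsub>G\<^esub> g = N" if "g \<in> carrier G" for g
      using inj_onD[OF bij_betw_imp_inj_on[OF \<psi>(2)]] in_quot[OF that] by metis
    moreover have "N #>\<^bsub>G\<^esub> g = N \<longleftrightarrow> g \<in> N" if "g \<in> carrier G" for g
      using N.rcos_const[of g] N.rcos_self[OF that N.subgroup_axioms] by auto
    ultimately show ?thesis using N.subset by (auto simp: kernel_def \<phi>0_def)
  qed
  have "bij_betw (\<lambda>\<alpha>. compose (carrier G) \<alpha> \<phi>0) (auto H) {\<phi> \<in> epis G H. kernel G H \<phi> = N}"
  proof (rule bij_betwI')
    fix \<alpha> \<beta> assume \<alpha>\<beta>: "\<alpha> \<in> auto H" "\<beta> \<in> auto H"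
    show "(compose (carrier G) \<alpha> \<phi>0 = compose (carrier G) \<beta> \<phi>0) = (\<alpha> = \<beta>)"
    proof
      assume eq: "compose (carrier G) \<alpha> \<phi>0 = compose (carrier G) \<beta> \<phi>0"
      have "\<alpha> (\<phi>0 g) = \<beta> (\<phi>0 g)" if "g \<in> carrier G" for g
        using fun_cong[OF eq, of g] that by (simp add: compose_def)
      then have "\<alpha> h = \<beta> h" if "h \<in> carrier H" for h using that \<phi>0_surj by (metis imageE)
      then show "\<alpha> = \<beta>"
        using \<alpha>\<beta> by (auto simp: auto_def Bij_def intro: extensionalityI)
    qed simp
  next
    fix \<alpha> assume \<alpha>: "\<alpha> \<in> auto H"
    then have \<alpha>_hom: "\<alpha> \<in> hom H H" and \<alpha>_bij: "bij_betw \<alpha> (carrier H) (carrier H)"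
      by (auto simp: auto_def Bij_def)
    interpret \<alpha>: group_hom H H \<alpha> using \<alpha>_hom by unfold_locales
    have "\<alpha> h = \<one>\<^bsub>H\<^esub> \<longleftrightarrow> h = \<one>\<^bsub>H\<^esub>" if "h \<in> carrier H" for h
      using \<alpha>.hom_one inj_onD[OF bij_betw_imp_inj_on[OF \<alpha>_bij]] that H.one_closed by metis
    then have "kernel G H (compose (carrier G) \<alpha> \<phi>0) = kernel G H \<phi>0"
      by (auto simp: kernel_def compose_def)
    moreover have "compose (carrier G) \<alpha> \<phi>0 \<in> hom G H"
      by (intro homI) (simp_all add: compose_def)
    moreover have "compose (carrier G) \<alpha> \<phi>0 ` carrier G = carrier H"
      using \<phi>0_surj \<alpha>_bij by (simp add: compose_def bij_betw_def image_image[symmetric])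
    ultimately show "compose (carrier G) \<alpha> \<phi>0 \<in> {\<phi> \<in> epis G H. kernel G H \<phi> = N}"
      using ker by (simp add: epis_def compose_extensional)
  next
    fix \<phi> assume "\<phi> \<in> {\<phi> \<in> epis G H. kernel G H \<phi> = N}"
    then have \<phi>: "\<phi> \<in> epis G H" "kernel G H \<phi> = N" by auto
    interpret \<phi>: group_hom G H \<phi> by (rule epis_group_hom[OF N.is_group H \<phi>(1)])
    have eq: "\<phi> a = \<phi> b \<longleftrightarrow> \<phi>0 a = \<phi>0 b" if "a \<in> carrier G" "b \<in> carrier G" for a b
      using \<phi>.eq_iff_kernel[OF that] \<phi>0.eq_iff_kernel[OF that] \<phi>(2) ker by simp
    \<comment> \<open>The choice of the preimage does not matter, because by \<open>eq\<close> the
      maps \<open>\<phi>\<close> and \<open>\<phi>0\<close> identify the same pairs.\<close>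
    define \<alpha> where "\<alpha> = (\<lambda>h\<in>carrier H. \<phi> (inv_into (carrier G) \<phi>0 h))"
    have \<alpha>: "\<alpha> (\<phi>0 g) = \<phi> g" if "g \<in> carrier G" for g
    proof -
      have "inv_into (carrier G) \<phi>0 (\<phi>0 g) \<in> carrier G" using that by (intro inv_into_into) auto
      moreover have "\<phi>0 (inv_into (carrier G) \<phi>0 (\<phi>0 g)) = \<phi>0 g" using that by (intro f_inv_into_f) auto
      ultimately show ?thesis using that eq by (simp add: \<alpha>_def)
    qed
    have lift: "\<exists>g\<in>carrier G. h = \<phi>0 g" if "h \<in> carrier H" for h using that \<phi>0_surj by auto
    have "\<alpha> \<in> hom H H"
    proof (rule homI)
      show "\<alpha> h \<in> carrier H" if h: "h \<in> carrier H" for h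
        using lift[OF h] \<alpha> by auto
      show "\<alpha> (h \<otimes>\<^bsub>H\<^esub> h') = \<alpha> h \<otimes>\<^bsub>H\<^esub> \<alpha> h'" if h: "h \<in> carrier H" "h' \<in> carrier H" for h h'
      proof -
        obtain g g' where g: "g \<in> carrier G" "g' \<in> carrier G" "h = \<phi>0 g" "h' = \<phi>0 g'"
          using lift[OF h(1)] lift[OF h(2)] by auto
        then show ?thesis using \<alpha>[of "g \<otimes>\<^bsub>G\<^esub> g'"] \<alpha>[of g] \<alpha>[of g'] by simp
      qed
    qed
    moreover have "inj_on \<alpha> (carrier H)"
    proof (rule inj_onI)
      fix h h' assume h: "h \<in> carrier H" "h' \<in> carrier H" "\<alpha> h = \<alpha> h'"
      obtain g g' where g: "g \<in> carrier G" "g' \<in> carrier G" "h = \<phi>0 g" "h' = \<phi>0 g'"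
        using lift[OF h(1)] lift[OF h(2)] by auto
      then show "h = h'" using \<alpha> eq h(3) by simp
    qed
    moreover have "\<alpha> ` carrier H = carrier H"
    proof -
      have "\<alpha> ` carrier H = \<alpha> ` \<phi>0 ` carrier G" by (simp only: \<phi>0_surj)
      also have "\<dots> = \<phi> ` carrier G" unfolding image_image by (rule image_cong[OF refl \<alpha>])
      finally show ?thesis using \<phi>(1) by (simp add: epis_def)
    qed
    ultimately have "\<alpha> \<in> auto H" by (simp add: auto_def Bij_def bij_betw_def \<alpha>_def)
    moreover have "\<phi> = compose (carrier G) \<alpha> \<phi>0"
    proof (rule extensionalityI[of _ "carrier G"])
      show "\<phi> g = compose (carrier G) \<alpha> \<phi>0 g" if "g \<in> carrier G" for g
        using that \<alpha> by (simp add: compose_def)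
    qed (use \<phi>(1) in \<open>auto simp: epis_def compose_extensional\<close>)
    ultimately show "\<exists>\<alpha>\<in>auto H. \<phi> = compose (carrier G) \<alpha> \<phi>0" by blast
  qed
  then show ?thesis by (simp add: order_def AutoGroup_def bij_betw_same_card)
qed

text \<open>A tuple that generates \<open>K\<close> has its entries in \<open>K\<close>, so the
  count inside the group \<open>K\<close> is also the count among tuples of the ambient
  group.\<close>

lemma (in comm_group) card_generating_tuples_subgroup:
  fixes p :: nat
  assumes p: "prime p" and fin: "finite (carrier G)" and ord: "order G = p ^ e" and K: "subgroup K G"
    and n: "card K = p ^ n * card ((\<lambda>x. x [^] p) ` K)"
  shows "real (card {x \<in> {..<n} \<rightarrow>\<^sub>E carrier G. generate G (x ` {..<n}) = K}) =
    real (card K) ^ n * (\<Prod>i<n. 1 - 1 / real p ^ (i + 1))"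
proof -
  let ?K = "G\<lparr>carrier := K\<rparr>"
  have Ksub: "K \<subseteq> carrier G" by (rule subgroup.subset[OF K])
  interpret K: comm_group ?K
    using Ksub by (intro group.group_comm_groupI[OF subgroup_imp_group[OF K]]) (auto intro: m_comm)
  obtain e' where e': "card K = p ^ e'"
  proof -
    have "card K dvd order G" using lagrange[OF K] by (metis dvd_triv_right)
    then show ?thesis using that p ord divides_primepow_nat by metis
  qed
  have pow: "x [^]\<^bsub>?K\<^esub> m = x [^] m" for x and m :: nat
    by (simp add: nat_pow_def)
  have gen: "generate ?K X = generate G X" if "X \<subseteq> K" for X
    by (rule generate_consistent[OF that K])
  have "{x \<in> {..<n} \<rightarrow>\<^sub>E carrier G. generate G (x ` {..<n}) = K} =
      {x \<in> {..<n} \<rightarrow>\<^sub>E carrier ?K. generate ?K (x ` {..<n}) = carrier ?K}"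
  proof (intro Collect_cong)
    fix x
    have "x \<in> {..<n} \<rightarrow> K" if "generate G (x ` {..<n}) = K"
      using that by (auto intro: generate.incl)
    moreover have "x \<in> {..<n} \<rightarrow> carrier G" if "x \<in> {..<n} \<rightarrow> K" using that Ksub by auto
    moreover have "generate ?K (x ` {..<n}) = generate G (x ` {..<n})" if "x \<in> {..<n} \<rightarrow> K"
      using that by (intro gen) auto
    ultimately show "(x \<in> {..<n} \<rightarrow>\<^sub>E carrier G \<and> generate G (x ` {..<n}) = K) \<longleftrightarrow>
        (x \<in> {..<n} \<rightarrow>\<^sub>E carrier ?K \<and> generate ?K (x ` {..<n}) = carrier ?K)"
      unfolding PiE_def Int_iff by auto
  qed
  then show ?thesis
    using K.card_generating_tuples[OF p, of e' n] e' n finite_subset[OF Ksub fin]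
    by (simp add: order_def pow)
qed

text \<open>A tuple with quotient \<open>H\<close> belongs to as many pairs as \<open>H\<close> has
  automorphisms. A surjection belongs to as many pairs as its kernel has generating tuples, a number
  that \<open>ker\<close> makes the same for all surjections.\<close>

lemma (in comm_group) card_quotient_tuples:
  fixes p :: nat and H :: "('c, 'm) monoid_scheme"
  assumes p: "prime p" and fin: "finite (carrier G)" and ord: "order G = p ^ e"
    and H: "group H" "finite (carrier H)"
    and ker: "\<And>\<phi>. \<phi> \<in> epis G H \<Longrightarrow> card (kernel G H \<phi>) = p ^ n * card ((\<lambda>x. x [^] p) ` kernel G H \<phi>)"
  shows "real (card {x \<in> {..<n} \<rightarrow>\<^sub>E carrier G. G Mod generate G (x ` {..<n}) \<cong> H}) * real (order (AutoGroup H)) =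
    real (card (epis G H)) * (real (order G) / real (order H)) ^ n * (\<Prod>i<n. 1 - 1 / real p ^ (i + 1))"
proof -
  let ?X = "{..<n} \<rightarrow>\<^sub>E carrier G" and ?N = "\<lambda>x. generate G (x ` {..<n})"
  have finX: "finite ?X" using fin by (simp add: finite_PiE)
  have finE: "finite (epis G H)" by (rule finite_epis[OF fin H(2)])
  have normal: "normal (?N x) G" if "x \<in> ?X" for x
  proof -
    have "subgroup (?N x) G" using that by (intro generate_is_subgroup) auto
    then show ?thesis by (rule subgroup_imp_normal)
  qed
  have inner: "card {\<phi> \<in> epis G H. kernel G H \<phi> = ?N x} = of_bool (G Mod ?N x \<cong> H) * order (AutoGroup H)"
    if "x \<in> ?X" for x
  proof (cases "G Mod ?N x \<cong> H")
    case True
    then show ?thesis using card_epis_kernel[OF normal[OF that] H(1)] by simp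
  next
    case False
    then have "{\<phi> \<in> epis G H. kernel G H \<phi> = ?N x} = {}"
      using epis_kernel_iso[OF group_axioms H(1)] by force
    with False show ?thesis by (simp only: of_bool_eq mult_zero_left card.empty)
  qed
  have "card {x \<in> ?X. G Mod ?N x \<cong> H} * order (AutoGroup H) =
      (\<Sum>x\<in>?X. card {\<phi> \<in> epis G H. kernel G H \<phi> = ?N x})"
    using finX by (simp add: inner of_bool_def sum.If_cases Int_def flip: sum_distrib_right)
  also have "\<dots> = (\<Sum>x\<in>?X. \<Sum>\<phi>\<in>epis G H. of_bool (kernel G H \<phi> = ?N x))"
    using finE by (simp add: of_bool_def sum.If_cases Int_def)
  also have "\<dots> = (\<Sum>\<phi>\<in>epis G H. \<Sum>x\<in>?X. of_bool (kernel G H \<phi> = ?N x))" by (rule sum.swap)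
  also have "\<dots> = (\<Sum>\<phi>\<in>epis G H. card {x \<in> ?X. ?N x = kernel G H \<phi>})"
    using finX by (simp add: of_bool_def sum.If_cases Int_def eq_commute)
  finally have "real (card {x \<in> ?X. G Mod ?N x \<cong> H}) * real (order (AutoGroup H)) =
      (\<Sum>\<phi>\<in>epis G H. real (card {x \<in> ?X. ?N x = kernel G H \<phi>}))"
    unfolding of_nat_mult[symmetric] of_nat_sum[symmetric] by (simp only:)
  also have "\<dots> = (\<Sum>\<phi>\<in>epis G H. (real (order G) / real (order H)) ^ n * (\<Prod>i<n. 1 - 1 / real p ^ (i + 1)))"
  proof (rule sum.cong[OF refl])
    fix \<phi> assume \<phi>: "\<phi> \<in> epis G H"
    interpret \<phi>: group_hom G H \<phi> by (rule epis_group_hom[OF group_axioms H(1) \<phi>])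
    have "order G = card (kernel G H \<phi>) * order H"
      using \<phi>.order_eq_kernel_image \<phi> by (simp add: epis_def order_def)
    moreover have "order H > 0" using H group.is_monoid monoid.one_closed
      by (metis card_gt_0_iff empty_iff order_def)
    ultimately have "real (card (kernel G H \<phi>)) = real (order G) / real (order H)" by simp
    then show "real (card {x \<in> ?X. ?N x = kernel G H \<phi>}) =
        (real (order G) / real (order H)) ^ n * (\<Prod>i<n. 1 - 1 / real p ^ (i + 1))"
      using card_generating_tuples_subgroup[OF p fin ord \<phi>.subgroup_kernel ker[OF \<phi>]] by simp
  qed
  finally show ?thesis by simp
qed

section \<open>The group of residue vectors\<close>

definition zvec :: "nat \<Rightarrow> nat \<Rightarrow> (nat \<Rightarrow> int) monoid" where
  "zvec q n = product_group {..<n} (\<lambda>_. integer_mod_group q)"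

text \<open>The reduction modulo \<open>q\<close> keeps the unit vector in the carrier when
  \<open>q = 1\<close>.\<close>

definition zunit :: "nat \<Rightarrow> nat \<Rightarrow> nat \<Rightarrow> nat \<Rightarrow> int" where
  "zunit q n j = (\<lambda>i\<in>{..<n}. of_bool (i = j) mod int q)"

lemma carrier_zvec: "q > 0 \<Longrightarrow> carrier (zvec q n) = mod_box {..<n} (int q)"
  by (simp add: zvec_def mod_box_def carrier_integer_mod_group)

lemma one_zvec: "\<one>\<^bsub>zvec q n\<^esub> = (\<lambda>i\<in>{..<n}. 0)"
  by (simp add: zvec_def)

lemma mult_zvec: "x \<otimes>\<^bsub>zvec q n\<^esub> y = (\<lambda>i\<in>{..<n}. (x i + y i) mod int q)"
  by (simp add: zvec_def)

lemma comm_group_zvec: "comm_group (zvec q n)"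
proof (rule group.group_comm_groupI)
  show "group (zvec q n)" by (simp add: zvec_def)
qed (simp add: mult_zvec add.commute)

lemma order_zvec: "q > 0 \<Longrightarrow> order (zvec q n) = q ^ n"
  by (simp add: order_def carrier_zvec card_mod_box)

lemma pow_zvec:
  fixes m :: nat
  shows "x [^]\<^bsub>zvec q n\<^esub> m = (\<lambda>i\<in>{..<n}. (int m * x i) mod int q)"
proof -
  interpret comm_group "zvec q n" by (rule comm_group_zvec)
  show ?thesis
    by (induction m) (auto simp: one_zvec mult_zvec fun_eq_iff distrib_right mod_add_left_eq mod_add_right_eq add.commute)
qed

lemma zunit_carrier: "q > 0 \<Longrightarrow> zunit q n j \<in> carrier (zvec q n)"
  by (auto simp: carrier_zvec mod_box_def zunit_def)

lemma hom_zvec_formula: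
  assumes q: "q > 0" and H: "comm_group H" and \<phi>: "\<phi> \<in> hom (zvec q n) H" and v: "v \<in> carrier (zvec q n)"
  shows "\<phi> v = finprod H (\<lambda>j. \<phi> (zunit q n j) [^]\<^bsub>H\<^esub> nat (v j)) {..<n}"
proof -
  let ?Z = "zvec q n" and ?e = "zunit q n"
  interpret V: comm_group "?Z" by (rule comm_group_zvec)
  interpret H: comm_group H by fact
  interpret \<phi>: group_hom "?Z" H \<phi> using \<phi> by unfold_locales
  \<comment> \<open>\<open>v\<close> cut off after its first \<open>m\<close> coordinates; each
    induction step adds one multiple of a unit vector.\<close>
  define t where "t = (\<lambda>m. \<lambda>i\<in>{..<n}. if i < m then v i else 0 :: int)"
  have v': "0 \<le> v i \<and> v i < int q" if "i < n" for i
    using v that q by (auto simp: carrier_zvec dest: mod_box_D)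
  have t: "t m \<in> carrier (?Z)" for m
    using v' q by (auto simp: t_def carrier_zvec mod_box_def)
  have "\<phi> (t m) = finprod H (\<lambda>j. \<phi> (?e j) [^]\<^bsub>H\<^esub> nat (v j)) {..<m}" if "m \<le> n" for m
    using that
  proof (induction m)
    case 0
    have "t 0 = \<one>\<^bsub>?Z\<^esub>" by (simp add: t_def one_zvec)
    then show ?case by simp
  next
    case (Suc m)
    have e: "?e j \<in> carrier (?Z)" for j by (rule zunit_carrier[OF q])
    have "t (Suc m) = t m \<otimes>\<^bsub>?Z\<^esub> (?e m [^]\<^bsub>?Z\<^esub> nat (v m))"
      using v' Suc.prems by (auto simp: t_def mult_zvec pow_zvec zunit_def fun_eq_iff mod_mult_right_eq less_Suc_eq)
    then have "\<phi> (t (Suc m)) = \<phi> (t m) \<otimes>\<^bsub>H\<^esub> \<phi> (?e m) [^]\<^bsub>H\<^esub> nat (v m)"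
      using t e by (simp add: \<phi>.hom_nat_pow)
    also have "\<dots> = finprod H (\<lambda>j. \<phi> (?e j) [^]\<^bsub>H\<^esub> nat (v j)) {..<Suc m}"
      using Suc e by (simp add: lessThan_Suc H.m_comm)
    finally show ?case .
  qed
  moreover have "t n = v"
    using v q by (intro extensionalityI[of _ "{..<n}"]) (auto simp: t_def carrier_zvec mod_box_def PiE_def)
  ultimately show ?thesis by (metis order_refl)
qed

section \<open>Homomorphisms out of the residue vectors\<close>

text \<open>The map sending unit vectors to the values of \<open>h\<close>. Representatives in
  \<open>{0..<q}\<close> serve as exponents, so it is additive when \<open>q\<close> kills the
  target.\<close>

definition zvec_hom :: "nat \<Rightarrow> nat \<Rightarrow> ('a, 'm) monoid_scheme \<Rightarrow> (nat \<Rightarrow> 'a) \<Rightarrow> (nat \<Rightarrow> int) \<Rightarrow> 'a" where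
  "zvec_hom q n H h = (\<lambda>v\<in>carrier (zvec q n). finprod H (\<lambda>j. h j [^]\<^bsub>H\<^esub> nat (v j)) {..<n})"

lemma (in group) nat_pow_mod:
  fixes q m :: nat
  assumes "x \<in> carrier G" "x [^] q = \<one>"
  shows "x [^] (m mod q) = x [^] m"
proof -
  have "x [^] m = (x [^] q) [^] (m div q) \<otimes> x [^] (m mod q)"
    using assms(1) by (simp add: nat_pow_pow nat_pow_mult)
  then show ?thesis using assms by simp
qed

context comm_group begin

lemma finprod_mem_subgroup:
  assumes "subgroup K G" "\<And>i. i \<in> A \<Longrightarrow> f i \<in> K"
  shows "finprod G f A \<in> K"
  using assms(2)
proof (induction A rule: infinite_finite_induct)
  case (insert a A)
  then show ?case
    using subgroup.subset[OF assms(1)] by (subst finprod_insert) (auto intro: subgroup.m_closed[OF assms(1)])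
qed (auto simp: subgroup.one_closed[OF assms(1)])

lemma zvec_hom:
  fixes h :: "nat \<Rightarrow> 'a"
  assumes q: "q > 0" and h: "h \<in> {..<n} \<rightarrow> carrier G" "\<And>x. x \<in> carrier G \<Longrightarrow> x [^] q = \<one>"
  shows "zvec_hom q n G h \<in> hom (zvec q n) G"
proof (rule homI)
  interpret V: comm_group "zvec q n" by (rule comm_group_zvec)
  show "zvec_hom q n G h v \<in> carrier G" if "v \<in> carrier (zvec q n)" for v
    using that h by (auto simp: zvec_hom_def intro!: finprod_closed)
  show "zvec_hom q n G h (v \<otimes>\<^bsub>zvec q n\<^esub> w) = zvec_hom q n G h v \<otimes> zvec_hom q n G h w"
    if vw: "v \<in> carrier (zvec q n)" "w \<in> carrier (zvec q n)" for v w
  proof -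
    have "h j [^] nat ((v j + w j) mod int q) = h j [^] nat (v j) \<otimes> h j [^] nat (w j)" if j: "j < n" for j
    proof -
      have vw0: "0 \<le> v j" "0 \<le> w j"
        using vw q j by (auto simp: carrier_zvec dest: mod_box_D)
      then have "nat ((v j + w j) mod int q) = (nat (v j) + nat (w j)) mod q"
        by (simp add: nat_mod_distrib nat_add_distrib)
      moreover have "h j \<in> carrier G" using h j by auto
      ultimately show ?thesis using h(2) by (simp add: nat_pow_mod nat_pow_mult)
    qed
    then have "finprod G (\<lambda>j. h j [^] nat ((v j + w j) mod int q)) {..<n} =
        finprod G (\<lambda>j. h j [^] nat (v j) \<otimes> h j [^] nat (w j)) {..<n}"
      using h(1) by (intro finprod_cong') auto
    also have "\<dots> = finprod G (\<lambda>j. h j [^] nat (v j)) {..<n} \<otimes> finprod G (\<lambda>j. h j [^] nat (w j)) {..<n}"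
      using h(1) by (intro finprod_multf) auto
    also have "finprod G (\<lambda>j. h j [^] nat ((v j + w j) mod int q)) {..<n} =
        finprod G (\<lambda>j. h j [^] nat ((v \<otimes>\<^bsub>zvec q n\<^esub> w) j)) {..<n}"
      using h(1) by (intro finprod_cong') (auto simp: mult_zvec)
    finally show ?thesis using vw by (simp add: zvec_hom_def)
  qed
qed

lemma zvec_hom_zunit:
  fixes h :: "nat \<Rightarrow> 'a"
  assumes q: "q > 1" and h: "h \<in> {..<n} \<rightarrow> carrier G" and j: "j < n"
  shows "zvec_hom q n G h (zunit q n j) = h j"
proof -
  have "finprod G (\<lambda>i. h i [^] nat (zunit q n j i)) {..<n} = finprod G (\<lambda>i. if j = i then h i else \<one>) {..<n}"
    using q funcset_mem[OF h] by (intro finprod_cong') (auto simp: zunit_def)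
  also have "\<dots> = h j" using h j by (intro finprod_singleton) auto
  finally show ?thesis using zunit_carrier[of q n j] q by (simp add: zvec_hom_def)
qed

lemma zvec_hom_image:
  fixes h :: "nat \<Rightarrow> 'a"
  assumes q: "q > 1" and h: "h \<in> {..<n} \<rightarrow> carrier G" "\<And>x. x \<in> carrier G \<Longrightarrow> x [^] q = \<one>"
  shows "zvec_hom q n G h ` carrier (zvec q n) = generate G (h ` {..<n})"
proof
  interpret V: comm_group "zvec q n" by (rule comm_group_zvec)
  have q0: "q > 0" using q by simp
  interpret \<phi>: group_hom "zvec q n" G "zvec_hom q n G h"
    using zvec_hom[OF q0 h] by unfold_locales
  have hG: "h ` {..<n} \<subseteq> carrier G" using h(1) by auto
  have K: "subgroup (generate G (h ` {..<n})) G" by (rule generate_is_subgroup[OF hG])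
  have "h j [^] (m::nat) \<in> generate G (h ` {..<n})" if "j < n" for j m
    using subgroup_int_pow_closed[OF K, of "h j" "int m"] that
    by (simp add: int_pow_int generate.incl)
  then show "zvec_hom q n G h ` carrier (zvec q n) \<subseteq> generate G (h ` {..<n})"
    by (auto simp: zvec_hom_def intro!: finprod_mem_subgroup[OF K])
  have "h j \<in> zvec_hom q n G h ` carrier (zvec q n)" if "j < n" for j
    using zvec_hom_zunit[OF q h(1) that] zunit_carrier[OF q0] by (metis imageI)
  then show "generate G (h ` {..<n}) \<subseteq> zvec_hom q n G h ` carrier (zvec q n)"
    by (intro generate_subgroup_incl \<phi>.img_is_subgroup) auto
qed

text \<open>\<open>zvec q n\<close> is free of rank \<open>n\<close> among abelian groups killed by
  \<open>q\<close>: a homomorphism is its tuple of values at the unit vectors, and its image is what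
  they generate.\<close>

lemma card_epis_zvec:
  assumes q: "q > 1" and exp: "\<And>x. x \<in> carrier G \<Longrightarrow> x [^] q = \<one>"
  shows "card (epis (zvec q n) G) = card {h \<in> {..<n} \<rightarrow>\<^sub>E carrier G. generate G (h ` {..<n}) = carrier G}"
proof -
  let ?T = "{h \<in> {..<n} \<rightarrow>\<^sub>E carrier G. generate G (h ` {..<n}) = carrier G}"
  have q0: "q > 0" using q by simp
  let ?r = "\<lambda>\<phi>. \<lambda>j\<in>{..<n}. \<phi> (zunit q n j)"
  have inverse: "zvec_hom q n G (?r \<phi>) = \<phi>" if \<phi>: "\<phi> \<in> epis (zvec q n) G" for \<phi>
  proof (rule extensionalityI[of _ "carrier (zvec q n)"])
    fix v assume v: "v \<in> carrier (zvec q n)"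
    have "\<phi> v = finprod G (\<lambda>j. \<phi> (zunit q n j) [^] nat (v j)) {..<n}"
      using \<phi> by (intro hom_zvec_formula[OF q0 comm_group_axioms _ v]) (simp add: epis_def)
    also have "\<dots> = finprod G (\<lambda>j. ?r \<phi> j [^] nat (v j)) {..<n}"
      using \<phi> zunit_carrier[OF q0] by (intro finprod_cong') (auto simp: epis_def hom_def)
    finally show "zvec_hom q n G (?r \<phi>) v = \<phi> v" using v by (simp add: zvec_hom_def)
  qed (use \<phi> in \<open>auto simp: epis_def zvec_hom_def\<close>)
  have "bij_betw ?r (epis (zvec q n) G) ?T"
  proof (rule bij_betw_byWitness[where f' = "zvec_hom q n G"])
    show "\<forall>\<phi>\<in>epis (zvec q n) G. zvec_hom q n G (?r \<phi>) = \<phi>" using inverse by blast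
    show "\<forall>h\<in>?T. ?r (zvec_hom q n G h) = h"
    proof
      fix h assume "h \<in> ?T"
      then have h: "h \<in> {..<n} \<rightarrow>\<^sub>E carrier G" by blast
      then have "h \<in> {..<n} \<rightarrow> carrier G" by auto
      then show "?r (zvec_hom q n G h) = h"
        using h zvec_hom_zunit[OF q] by (intro extensionalityI[of _ "{..<n}"]) (auto simp: PiE_def)
    qed
    show "?r ` epis (zvec q n) G \<subseteq> ?T"
    proof
      fix h assume "h \<in> ?r ` epis (zvec q n) G"
      then obtain \<phi> where \<phi>: "\<phi> \<in> epis (zvec q n) G" "h = ?r \<phi>" by blast
      then have h: "h \<in> {..<n} \<rightarrow>\<^sub>E carrier G"
        using zunit_carrier[OF q0] by (auto simp: epis_def hom_def)
      then have "generate G (h ` {..<n}) = zvec_hom q n G h ` carrier (zvec q n)"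
        using exp by (intro zvec_hom_image[OF q, symmetric]) auto
      also have "\<dots> = carrier G" using \<phi> inverse by (simp add: epis_def)
      finally show "h \<in> ?T" using h by blast
    qed
    show "zvec_hom q n G ` ?T \<subseteq> epis (zvec q n) G"
    proof
      fix \<phi> assume "\<phi> \<in> zvec_hom q n G ` ?T"
      then obtain h where h: "h \<in> {..<n} \<rightarrow> carrier G" "generate G (h ` {..<n}) = carrier G" "\<phi> = zvec_hom q n G h"
        by auto
      then show "\<phi> \<in> epis (zvec q n) G"
        using zvec_hom[OF q0 h(1) exp] zvec_hom_image[OF q h(1) exp] by (simp add: epis_def zvec_hom_def)
    qed
  qed
  then show ?thesis by (rule bij_betw_same_card)
qed

text \<open>Union bound: a tuple that does not generate lies in a proper subgroup. Each of these has
  index at least 2, and there are at most \<open>2 ^ order G\<close> of them.\<close>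

lemma card_generating_tuples_lower:
  assumes fin: "finite (carrier G)"
  shows "1 - 2 ^ order G * (1 / 2) ^ n \<le>
    real (card {h \<in> {..<n} \<rightarrow>\<^sub>E carrier G. generate G (h ` {..<n}) = carrier G}) / real (order G) ^ n"
proof -
  let ?X = "{..<n} \<rightarrow>\<^sub>E carrier G" and ?P = "\<lambda>h. generate G (h ` {..<n}) = carrier G"
  let ?S = "{K. subgroup K G \<and> K \<noteq> carrier G}"
  have ord: "order G > 0" using fin one_closed by (auto simp: order_def card_gt_0_iff)
  have S: "?S \<subseteq> Pow (carrier G)" by (auto dest: subgroup.subset)
  have finS: "finite ?S" using S fin by (simp add: finite_subset)
  have finX: "finite ?X" using fin by (simp add: finite_PiE)
  have cX: "card ?X = order G ^ n" by (simp add: card_PiE order_def)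
  have half: "real (card K) \<le> real (order G) / 2" if "K \<in> ?S" for K
  proof -
    have K: "subgroup K G" "K \<subset> carrier G" using that subgroup.subset by auto
    then have "card K < order G" using fin by (simp add: order_def psubset_card_mono)
    moreover obtain c where c: "order G = card K * c" using lagrange[OF K(1)] by (metis mult.commute)
    ultimately have "c \<noteq> 0" "c \<noteq> 1" using ord by auto
    then have "2 \<le> c" by simp
    then have "card K * 2 \<le> order G" using c by simp
    then show ?thesis by simp
  qed
  have "{h \<in> ?X. \<not> ?P h} \<subseteq> (\<Union>K\<in>?S. {..<n} \<rightarrow>\<^sub>E K)"
  proof
    fix h assume "h \<in> {h \<in> ?X. \<not> ?P h}"
    then have h: "h \<in> ?X" "\<not> ?P h" by auto
    have "subgroup (generate G (h ` {..<n})) G" using h by (intro generate_is_subgroup) auto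
    moreover have "h \<in> {..<n} \<rightarrow>\<^sub>E generate G (h ` {..<n})"
      using h by (auto simp: PiE_iff intro: generate.incl)
    ultimately show "h \<in> (\<Union>K\<in>?S. {..<n} \<rightarrow>\<^sub>E K)" using h(2) by blast
  qed
  then have "card {h \<in> ?X. \<not> ?P h} \<le> card (\<Union>K\<in>?S. {..<n} \<rightarrow>\<^sub>E K)"
    using finS S by (intro card_mono finite_UN_I finite_PiE) (auto intro: finite_subset[OF _ fin])
  also have "\<dots> \<le> (\<Sum>K\<in>?S. card ({..<n} \<rightarrow>\<^sub>E K))" by (rule card_UN_le[OF finS])
  also have "\<dots> = (\<Sum>K\<in>?S. card K ^ n)" by (simp add: card_PiE)
  finally have "real (card {h \<in> ?X. \<not> ?P h}) \<le> (\<Sum>K\<in>?S. real (card K) ^ n)"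
    by (metis (no_types, lifting) of_nat_le_iff of_nat_power of_nat_sum sum.cong)
  also have "\<dots> \<le> (\<Sum>K\<in>?S. (real (order G) / 2) ^ n)"
    using half by (intro sum_mono power_mono) auto
  also have "\<dots> = real (card ?S) * (real (order G) / 2) ^ n" by simp
  also have "\<dots> \<le> 2 ^ order G * (real (order G) / 2) ^ n"
  proof (rule mult_right_mono)
    have "card ?S \<le> 2 ^ order G"
      using card_mono[OF _ S] fin by (simp add: card_Pow order_def)
    then show "real (card ?S) \<le> 2 ^ order G" by (metis of_nat_le_iff of_nat_numeral of_nat_power)
  qed simp
  finally have "real (card {h \<in> ?X. \<not> ?P h}) \<le> 2 ^ order G * (real (order G) / 2) ^ n" .
  moreover have "card ({h \<in> ?X. \<not> ?P h} \<union> {h \<in> ?X. ?P h}) = card {h \<in> ?X. \<not> ?P h} + card {h \<in> ?X. ?P h}"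
    using finX by (intro card_Un_disjoint) auto
  moreover have "{h \<in> ?X. \<not> ?P h} \<union> {h \<in> ?X. ?P h} = ?X" by blast
  ultimately have le: "real (card {h \<in> ?X. \<not> ?P h}) \<le> 2 ^ order G * (real (order G) / 2) ^ n"
    and split: "card {h \<in> ?X. \<not> ?P h} + card {h \<in> ?X. ?P h} = order G ^ n"
    by (simp_all only: cX)
  from split have "real (card {h \<in> ?X. \<not> ?P h}) + real (card {h \<in> ?X. ?P h}) = real (order G) ^ n"
    unfolding of_nat_add[symmetric] of_nat_power[symmetric] of_nat_eq_iff .
  with le have "real (order G) ^ n - 2 ^ order G * (real (order G) / 2) ^ n \<le> real (card {h \<in> ?X. ?P h})"
    by linarith
  then have "(real (order G) ^ n - 2 ^ order G * (real (order G) / 2) ^ n) / real (order G) ^ n \<le>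
      real (card {h \<in> ?X. ?P h}) / real (order G) ^ n"
    by (intro divide_right_mono) auto
  moreover have "(real (order G) ^ n - 2 ^ order G * (real (order G) / 2) ^ n) / real (order G) ^ n =
      1 - 2 ^ order G * (1 / 2) ^ n"
    using ord by (simp add: diff_divide_distrib power_divide)
  ultimately show ?thesis by simp
qed

end

lemma (in comm_group) tendsto_generating_tuples:
  assumes fin: "finite (carrier G)"
  shows "(\<lambda>n. real (card {h \<in> {..<n} \<rightarrow>\<^sub>E carrier G. generate G (h ` {..<n}) = carrier G}) / real (order G) ^ n)
    \<longlonglongrightarrow> 1"
proof (rule tendsto_sandwich)
  let ?T = "\<lambda>n. {h \<in> {..<n} \<rightarrow>\<^sub>E carrier G. generate G (h ` {..<n}) = carrier G}"
  have "(\<lambda>n. 1 - 2 ^ order G * (1 / 2) ^ n :: real) \<longlonglongrightarrow> 1 - 2 ^ order G * 0"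
    by (intro tendsto_intros LIMSEQ_realpow_zero) auto
  then show "(\<lambda>n. 1 - 2 ^ order G * (1 / 2) ^ n :: real) \<longlonglongrightarrow> 1" by simp
  show "\<forall>\<^sub>F n in sequentially. real (card (?T n)) /
      real (order G) ^ n \<le> 1"
  proof (rule always_eventually, rule allI)
    fix n :: nat
    have "card (?T n) \<le> card ({..<n} \<rightarrow>\<^sub>E carrier G)"
      using fin by (intro card_mono finite_PiE) auto
    also have "\<dots> = order G ^ n" by (simp add: card_PiE order_def)
    finally have "real (card (?T n)) \<le> real (order G) ^ n"
      unfolding of_nat_power[symmetric] of_nat_le_iff .
    then show "real (card (?T n)) / real (order G) ^ n \<le> 1"
      by (auto simp: divide_le_eq_1 zero_less_power_eq)
  qed
  show "\<forall>\<^sub>F n in sequentially. 1 - 2 ^ order G * (1 / 2) ^ n \<le>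
      real (card (?T n)) / real (order G) ^ n"
    by (rule always_eventually, rule allI, rule card_generating_tuples_lower[OF fin])
qed (rule tendsto_const)

text \<open>The order of the kernel \<open>K\<close> is that of its p-torsion times that of
  \<open>p K\<close>. The p-torsion of the whole group consists of multiples of
  \<open>p^(k-1)\<close>, which \<open>\<phi>\<close> sends to the identity, so all
  \<open>p^n\<close> torsion vectors lie in \<open>K\<close>.\<close>

lemma card_zvec_kernel:
  fixes p :: nat
  assumes p: "prime p" and k: "k > 0" and H: "comm_group H"
    and exp: "\<And>x. x \<in> carrier H \<Longrightarrow> x [^]\<^bsub>H\<^esub> (p ^ (k - 1)) = \<one>\<^bsub>H\<^esub>"
    and \<phi>: "\<phi> \<in> epis (zvec (p ^ k) n) H"
  shows "card (kernel (zvec (p ^ k) n) H \<phi>) =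
    p ^ n * card ((\<lambda>x. x [^]\<^bsub>zvec (p ^ k) n\<^esub> p) ` kernel (zvec (p ^ k) n) H \<phi>)"
proof -
  let ?V = "zvec (p ^ k) n" and ?q = "p ^ k"
  let ?K = "kernel ?V H \<phi>"
  interpret V: comm_group ?V by (rule comm_group_zvec)
  interpret H: comm_group H by fact
  interpret \<phi>: group_hom ?V H \<phi> using \<phi> by unfold_locales (simp add: epis_def)
  have p0: "p > 0" and q0: "?q > 0" using p by (auto simp: prime_gt_0_nat)
  have qp: "?q = p * p ^ (k - 1)" using k by (cases k) auto
  have K: "subgroup ?K ?V" by (rule \<phi>.subgroup_kernel)
  let ?G = "?V\<lparr>carrier := ?K\<rparr>"
  have Ksub: "?K \<subseteq> carrier ?V" by (rule subgroup.subset[OF K])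
  interpret G: comm_group ?G
    using Ksub by (intro group.group_comm_groupI[OF V.subgroup_imp_group[OF K]]) (auto intro: V.m_comm)
  have pow: "x [^]\<^bsub>?G\<^esub> m = x [^]\<^bsub>?V\<^esub> m" for x and m :: nat
    by (simp add: nat_pow_def)
  interpret P: group_hom ?G ?G "\<lambda>x. x [^]\<^bsub>?G\<^esub> p"
  proof (unfold_locales, rule homI)
    show "x [^]\<^bsub>?G\<^esub> p \<in> carrier ?G" if "x \<in> carrier ?G" for x
      using that by (rule G.nat_pow_closed)
    show "(x \<otimes>\<^bsub>?G\<^esub> y) [^]\<^bsub>?G\<^esub> p = x [^]\<^bsub>?G\<^esub> p \<otimes>\<^bsub>?G\<^esub> y [^]\<^bsub>?G\<^esub> p"
      if "x \<in> carrier ?G" "y \<in> carrier ?G" for x y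
      using that by (rule G.nat_pow_distrib)
  qed
  \<comment> \<open>The p-torsion of the integers modulo \<open>p^k\<close>, shown next to be the
    multiples of \<open>p^(k-1)\<close>.\<close>
  let ?T = "{a \<in> {0..<int ?q}. int p * a mod int ?q = 0}"
  have T: "?T = (\<lambda>b. int (p ^ (k - 1)) * b) ` {0..<int p}"
  proof (intro equalityI subsetI)
    fix a assume a: "a \<in> ?T"
    then have "int p * int (p ^ (k - 1)) dvd int p * a" by (auto simp: qp mod_eq_0_iff_dvd)
    then have "int (p ^ (k - 1)) dvd a" using p0 by simp
    then obtain b where b: "a = int (p ^ (k - 1)) * b" by (elim dvdE)
    have pk: "int (p ^ (k - 1)) > 0" using p0 by simp
    have "int (p ^ (k - 1)) * 0 \<le> int (p ^ (k - 1)) * b" using a b by simp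
    then have "0 \<le> b" using pk by (simp only: mult_le_cancel_left_pos)
    moreover have "int (p ^ (k - 1)) * b < int (p ^ (k - 1)) * int p" using a b qp by (simp add: mult.commute)
    then have "b < int p" using pk by (simp only: mult_less_cancel_left_pos)
    ultimately show "a \<in> (\<lambda>b. int (p ^ (k - 1)) * b) ` {0..<int p}" using b by auto
  next
    fix a assume "a \<in> (\<lambda>b. int (p ^ (k - 1)) * b) ` {0..<int p}"
    then obtain b where b: "a = int (p ^ (k - 1)) * b" "0 \<le> b" "b < int p" by auto
    have "int (p ^ (k - 1)) * b < int (p ^ (k - 1)) * int p" using b p0 by (intro mult_strict_left_mono) auto
    moreover have "int p * a mod int ?q = 0" by (simp add: b qp mod_eq_0_iff_dvd)
    ultimately show "a \<in> ?T" using b by (simp add: qp mult.commute)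
  qed
  have "card ?T = p" unfolding T using p0 by (subst card_image) (auto simp: inj_on_def)
  have mem_kernel: "v \<in> kernel ?G ?G (\<lambda>x. x [^]\<^bsub>?G\<^esub> p) \<longleftrightarrow> v \<in> ?K \<and> v [^]\<^bsub>?V\<^esub> p = \<one>\<^bsub>?V\<^esub>" for v
    unfolding kernel_def[of ?G ?G] pow by simp
  have "kernel ?G ?G (\<lambda>x. x [^]\<^bsub>?G\<^esub> p) = {..<n} \<rightarrow>\<^sub>E ?T"
  proof (intro equalityI subsetI)
    fix v assume "v \<in> kernel ?G ?G (\<lambda>x. x [^]\<^bsub>?G\<^esub> p)"
    then have v: "v \<in> carrier ?V" "v [^]\<^bsub>?V\<^esub> p = \<one>\<^bsub>?V\<^esub>"
      unfolding mem_kernel using Ksub by blast+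
    have "int p * v i mod int ?q = 0" if "i < n" for i
      using that fun_cong[OF v(2), of i] by (simp add: pow_zvec one_zvec)
    then show "v \<in> {..<n} \<rightarrow>\<^sub>E ?T" using v(1) q0 by (auto simp: carrier_zvec mod_box_def PiE_iff)
  next
    fix v assume v: "v \<in> {..<n} \<rightarrow>\<^sub>E ?T"
    then have vV: "v \<in> carrier ?V" using q0 by (auto simp: carrier_zvec mod_box_def PiE_iff)
    have "v [^]\<^bsub>?V\<^esub> p = \<one>\<^bsub>?V\<^esub>" using v by (auto simp: pow_zvec one_zvec fun_eq_iff PiE_iff)
    moreover have "v \<in> ?K"
    proof -
      have "\<forall>i\<in>{..<n}. \<exists>b\<in>{0..<int p}. v i = int (p ^ (k - 1)) * b"
        using v unfolding T by (auto simp: PiE_iff)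
      then obtain b where b: "\<forall>i\<in>{..<n}. b i \<in> {0..<int p} \<and> v i = int (p ^ (k - 1)) * b i"
        by metis
      \<comment> \<open>\<open>w\<close> divides \<open>v\<close> by \<open>p^(k-1)\<close>
        coordinatewise, which exhibits \<open>\<phi> v\<close> as a \<open>p^(k-1)\<close>-th power
        in \<open>H\<close>.\<close>
      define w where "w = restrict b {..<n}"
      have "p \<le> ?q" using k p0 by (cases k) auto
      then have "int p \<le> int ?q" by (simp only: of_nat_le_iff)
      have "b i < int ?q" if "i < n" for i
      proof -
        have "b i < int p" using b that by auto
        then show ?thesis using \<open>int p \<le> int ?q\<close> by (rule less_le_trans)
      qed
      moreover have "0 \<le> b i" if "i < n" for i
        using bspec[OF b, of i] that by simp
      ultimately have "b \<in> {..<n} \<rightarrow> {0..<int ?q}" by (intro Pi_I) (simp only: atLeastLessThan_iff lessThan_iff simp_thms)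
      then have w: "w \<in> carrier ?V"
        by (simp add: carrier_zvec[OF q0] mod_box_def w_def del: of_nat_power)
      have "v = w [^]\<^bsub>?V\<^esub> (p ^ (k - 1))"
      proof (rule extensionalityI[of _ "{..<n}"])
        show "v i = (w [^]\<^bsub>?V\<^esub> (p ^ (k - 1))) i" if "i \<in> {..<n}" for i
        proof -
          have "v i \<in> ?T" using v that by (rule PiE_mem)
          then have "v i mod int ?q = v i" by simp
          moreover have "v i = int (p ^ (k - 1)) * b i" using bspec[OF b that] ..
          ultimately show ?thesis using that by (simp add: pow_zvec w_def)
        qed
      qed (use v in \<open>auto simp: pow_zvec PiE_iff\<close>)
      then have "\<phi> v = \<phi> w [^]\<^bsub>H\<^esub> (p ^ (k - 1))" using w by (simp add: \<phi>.hom_nat_pow)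
      also have "\<dots> = \<one>\<^bsub>H\<^esub>" using w exp by simp
      finally show ?thesis using vV by (simp add: kernel_def)
    qed
    ultimately show "v \<in> kernel ?G ?G (\<lambda>x. x [^]\<^bsub>?G\<^esub> p)" by (simp only: mem_kernel)
  qed
  then have "card (kernel ?G ?G (\<lambda>x. x [^]\<^bsub>?G\<^esub> p)) = p ^ n"
    using \<open>card ?T = p\<close> by (simp add: card_PiE)
  then show ?thesis using P.order_eq_kernel_image by (simp add: order_def pow)
qed

section \<open>Cokernels of residue matrices\<close>

lemma tendsto_prodinf_lessThan:
  assumes "p > 1"
  shows "(\<lambda>n. \<Prod>i<n. 1 - 1 / real p ^ (i + 1)) \<longlonglongrightarrow> prodinf (\<lambda>i. 1 - 1 / real p ^ (i + 1))"
proof -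
  have "summable (\<lambda>i. (1 / real p) * (1 / real p) ^ i)"
    using assms by (intro summable_mult summable_geometric) simp
  then have "summable (\<lambda>i. norm ((1 - 1 / real p ^ (i + 1)) - 1))"
    by (simp add: power_divide)
  then have "convergent_prod (\<lambda>i. 1 - 1 / real p ^ (i + 1))"
    by (intro abs_convergent_prod_imp_convergent_prod summable_imp_abs_convergent_prod)
  then show ?thesis
    using convergent_prod_LIMSEQ by (simp only: LIMSEQ_lessThan_iff_atMost)
qed

lemma order_AutoGroup_pos:
  assumes "group H" "finite (carrier H)"
  shows "order (AutoGroup H) > 0"
proof -
  have "auto H \<subseteq> carrier H \<rightarrow>\<^sub>E carrier H"
    by (auto simp: auto_def Bij_def PiE_def hom_def)
  then have "finite (auto H)" using assms(2) by (meson finite_PiE finite_subset)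
  then show ?thesis
    using group.id_in_auto[OF assms(1)] by (auto simp: order_def AutoGroup_def card_gt_0_iff)
qed

text \<open>For every \<open>n\<close> the proportion is exactly the inverse of the number of
  automorphisms, times the proportion of \<open>n\<close>-tuples generating \<open>H\<close>, times
  the finite product. The middle factor tends to 1.\<close>

theorem tendsto_quotient_tuples:
  fixes p :: nat and H :: "('a, 'm) monoid_scheme"
  assumes p: "prime p" and k: "k > 0" and H: "comm_group H" "finite (carrier H)"
    and exp: "\<And>x. x \<in> carrier H \<Longrightarrow> x [^]\<^bsub>H\<^esub> (p ^ (k - 1)) = \<one>\<^bsub>H\<^esub>"
  shows "(\<lambda>n. real (card {x \<in> {..<n} \<rightarrow>\<^sub>E carrier (zvec (p ^ k) n).
      zvec (p ^ k) n Mod generate (zvec (p ^ k) n) (x ` {..<n}) \<cong> H}) / real (p ^ k) ^ (n * n))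
    \<longlonglongrightarrow> 1 / real (order (AutoGroup H)) * prodinf (\<lambda>i. 1 - 1 / real p ^ (i + 1))"
proof -
  interpret H: comm_group H by (rule H(1))
  let ?q = "p ^ k"
  let ?g = "\<lambda>n. real (card {h \<in> {..<n} \<rightarrow>\<^sub>E carrier H. generate H (h ` {..<n}) = carrier H}) / real (order H) ^ n"
  have q1: "?q > 1" using prime_gt_1_nat[OF p] k by (rule one_less_power)
  have q0: "?q > 0" using prime_gt_0_nat[OF p] by simp
  have qp: "?q = p ^ (k - 1) * p" using k by (cases k) auto
  have expq: "x [^]\<^bsub>H\<^esub> ?q = \<one>\<^bsub>H\<^esub>" if "x \<in> carrier H" for x
    unfolding qp using that exp by (simp flip: H.nat_pow_pow)
  have A: "real (order (AutoGroup H)) > 0" using order_AutoGroup_pos[OF H.group_axioms H(2)] by simp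
  have eq: "real (card {x \<in> {..<n} \<rightarrow>\<^sub>E carrier (zvec ?q n).
      zvec ?q n Mod generate (zvec ?q n) (x ` {..<n}) \<cong> H}) / real ?q ^ (n * n) =
    1 / real (order (AutoGroup H)) * (?g n * (\<Prod>i<n. 1 - 1 / real p ^ (i + 1)))" for n
  proof -
    interpret V: comm_group "zvec ?q n" by (rule comm_group_zvec)
    let ?c = "real (card {x \<in> {..<n} \<rightarrow>\<^sub>E carrier (zvec ?q n).
      zvec ?q n Mod generate (zvec ?q n) (x ` {..<n}) \<cong> H})"
    have fin: "finite (carrier (zvec ?q n))" by (simp add: carrier_zvec[OF q0])
    have ord: "order (zvec ?q n) = p ^ (k * n)" by (simp add: order_zvec[OF q0] power_mult)
    have "?c * real (order (AutoGroup H)) = real (card (epis (zvec ?q n) H)) *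
        (real (order (zvec ?q n)) / real (order H)) ^ n * (\<Prod>i<n. 1 - 1 / real p ^ (i + 1))"
      using card_zvec_kernel[OF p k H(1) exp]
      by (intro V.card_quotient_tuples[OF p fin ord H.group_axioms H(2)])
    also have "\<dots> = ?g n * (\<Prod>i<n. 1 - 1 / real p ^ (i + 1)) * real ?q ^ (n * n)"
      using H.card_epis_zvec[OF q1 expq, of n]
      by (simp add: order_zvec[OF q0] power_divide power_mult)
    finally have eq: "?c * real (order (AutoGroup H)) = \<dots>" .
    have "c / Q = 1 / A * (g * P)" if "c * A = g * P * Q" "A > 0" "Q > 0" for c A g P Q :: real
      using that by (simp add: field_simps)
    from this[OF eq A] show ?thesis using q0 by simp
  qed
  have "(\<lambda>n. 1 / real (order (AutoGroup H)) * (?g n * (\<Prod>i<n. 1 - 1 / real p ^ (i + 1))))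
      \<longlonglongrightarrow> 1 / real (order (AutoGroup H)) * (1 * prodinf (\<lambda>i. 1 - 1 / real p ^ (i + 1)))"
    by (intro tendsto_mult tendsto_const H.tendsto_generating_tuples[OF H(2)]
        tendsto_prodinf_lessThan[OF prime_gt_1_nat[OF p]])
  then show ?thesis by (simp only: eq mult_1)
qed

section \<open>Images of residue matrices and their quotients\<close>

definition mvec :: "nat \<Rightarrow> nat \<Rightarrow> (nat \<times> nat \<Rightarrow> int) \<Rightarrow> (nat \<Rightarrow> int) \<Rightarrow> nat \<Rightarrow> int" where
  "mvec q n a w = (\<lambda>i\<in>{..<n}. (\<Sum>j<n. a (i, j) * w j) mod int q)"

lemma mvec_carrier: "q > 0 \<Longrightarrow> mvec q n a w \<in> carrier (zvec q n)"
  by (auto simp: carrier_zvec mod_box_def mvec_def)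

lemma mvec_cong:
  assumes "\<And>i j. i < n \<Longrightarrow> j < n \<Longrightarrow> [a (i, j) = b (i, j)] (mod int q)"
    and "\<And>j. j < n \<Longrightarrow> [v j = w j] (mod int q)"
  shows "mvec q n a v = mvec q n b w"
proof -
  have "[(\<Sum>j<n. a (i, j) * v j) = (\<Sum>j<n. b (i, j) * w j)] (mod int q)" if "i < n" for i
    using assms that by (intro cong_sum cong_mult) auto
  then show ?thesis by (auto simp: mvec_def cong_def fun_eq_iff)
qed

lemma mvec_mvec: "mvec q n a (mvec q n b w) = mvec q n (mmul n a b) w"
proof -
  have "mvec q n a (mvec q n b w) = mvec q n a (\<lambda>j. \<Sum>l<n. b (j, l) * w l)"
    by (rule mvec_cong) (simp_all add: mvec_def cong_def)
  also have "\<dots> = mvec q n (mmul n a b) w"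
    unfolding mvec_def mmul_def
    by (auto simp: fun_eq_iff sum_distrib_left sum_distrib_right mult.assoc intro!: arg_cong2[of _ _ _ _ "(mod)"] sum.swap)
  finally show ?thesis .
qed

lemma mvec_mone: "w \<in> carrier (zvec q n) \<Longrightarrow> q > 0 \<Longrightarrow> mvec q n mone w = w"
proof (rule mod_box_eqI[of _ "{..<n}" "int q"])
  fix i assume "i \<in> {..<n}"
  then have "(\<Sum>j<n. mone (i, j) * w j) = w i"
    by (simp add: mone_def of_bool_def if_distrib[of "\<lambda>x. x * _"] cong: if_cong)
  then show "[mvec q n mone w i = w i] (mod int q)" using \<open>i \<in> {..<n}\<close> by (simp add: mvec_def cong_def)
qed (use mvec_carrier[of q n mone w] carrier_zvec[of q n] in auto)

lemma mvec_hom: "q > 0 \<Longrightarrow> mvec q n a \<in> hom (zvec q n) (zvec q n)"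
proof (rule homI)
  show "mvec q n a (v \<otimes>\<^bsub>zvec q n\<^esub> w) = mvec q n a v \<otimes>\<^bsub>zvec q n\<^esub> mvec q n a w" for v w
  proof -
    have "mvec q n a (v \<otimes>\<^bsub>zvec q n\<^esub> w) = mvec q n a (\<lambda>j. v j + w j)"
      by (rule mvec_cong) (simp_all add: mult_zvec cong_def)
    also have "\<dots> = mvec q n a v \<otimes>\<^bsub>zvec q n\<^esub> mvec q n a w"
      by (simp add: mvec_def mult_zvec distrib_left sum.distrib mod_add_eq cong: restrict_cong)
    finally show ?thesis .
  qed
qed (rule mvec_carrier)

definition mimg :: "nat \<Rightarrow> nat \<Rightarrow> (nat \<times> nat \<Rightarrow> int) \<Rightarrow> (nat \<Rightarrow> int) set" where
  "mimg q n a = mvec q n a ` carrier (zvec q n)"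

lemma subgroup_mimg: "q > 0 \<Longrightarrow> subgroup (mimg q n a) (zvec q n)"
proof -
  assume "q > 0"
  interpret V: comm_group "zvec q n" by (rule comm_group_zvec)
  interpret group_hom "zvec q n" "zvec q n" "mvec q n a" using mvec_hom[OF \<open>q > 0\<close>] by unfold_locales
  show ?thesis unfolding mimg_def by (rule img_is_subgroup)
qed

lemma finprod_zvec:
  assumes "\<And>j. j \<in> S \<Longrightarrow> f j \<in> carrier (zvec q n)" "finite S" "i < n"
  shows "finprod (zvec q n) f S i = (\<Sum>j\<in>S. f j i) mod int q"
proof -
  interpret V: comm_group "zvec q n" by (rule comm_group_zvec)
  from assms(2,1) show ?thesis
  proof (induction S rule: finite_induct)
    case empty
    then show ?case using assms(3) by (simp add: one_zvec)
  next
    case (insert j S)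
    then show ?case using assms(3) by (simp add: Pi_def mult_zvec mod_add_right_eq)
  qed
qed

lemma pow_order_zvec: "x \<in> carrier (zvec q n) \<Longrightarrow> x [^]\<^bsub>zvec q n\<^esub> q = \<one>\<^bsub>zvec q n\<^esub>"
  by (auto simp: pow_zvec one_zvec)

text \<open>Multiplication by \<open>a\<close> is the homomorphism that sends the unit vectors to
  the columns of \<open>a\<close>.\<close>

lemma mimg_eq_generate:
  assumes "q > 1"
  shows "mimg q n a = generate (zvec q n) ((\<lambda>j. \<lambda>i\<in>{..<n}. a (i, j) mod int q) ` {..<n})"
proof -
  interpret V: comm_group "zvec q n" by (rule comm_group_zvec)
  let ?c = "\<lambda>j. \<lambda>i\<in>{..<n}. a (i, j) mod int q"
  have q0: "q > 0" using assms by simp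
  have c: "?c \<in> {..<n} \<rightarrow> carrier (zvec q n)" using q0 by (auto simp: carrier_zvec mod_box_def)
  have "zvec_hom q n (zvec q n) ?c w = mvec q n a w" if w: "w \<in> carrier (zvec q n)" for w
  proof (rule mod_box_eqI[of _ "{..<n}" "int q"])
    have wj: "0 \<le> w j" if "j < n" for j using w that q0 by (auto simp: carrier_zvec dest: mod_box_D)
    fix i assume i: "i \<in> {..<n}"
    have "zvec_hom q n (zvec q n) ?c w i = (\<Sum>j<n. (?c j [^]\<^bsub>zvec q n\<^esub> nat (w j)) i) mod int q"
      using w i c by (simp add: zvec_hom_def) (subst finprod_zvec, auto)
    moreover have "[(\<Sum>j<n. (?c j [^]\<^bsub>zvec q n\<^esub> nat (w j)) i) = (\<Sum>j<n. a (i, j) * w j)] (mod int q)"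
      using i wj by (intro cong_sum) (simp add: pow_zvec cong_def mod_mult_right_eq mult.commute)
    ultimately show "[zvec_hom q n (zvec q n) ?c w i = mvec q n a w i] (mod int q)"
      using i by (simp add: mvec_def cong_def)
  next
    show "zvec_hom q n (zvec q n) ?c w \<in> mod_box {..<n} (int q)"
      using hom_in_carrier[OF V.zvec_hom[OF q0 c pow_order_zvec] w] q0 by (simp add: carrier_zvec)
  qed (use mvec_carrier[OF q0] carrier_zvec[OF q0] in auto)
  then have "zvec_hom q n (zvec q n) ?c ` carrier (zvec q n) = mimg q n a"
    unfolding mimg_def by (rule image_cong[OF refl])
  then show ?thesis
    using V.zvec_hom_image[OF assms c pow_order_zvec] by simp
qed

text \<open>The composite of \<open>h\<close> with the projection is onto and has kernel exactly
  \<open>N\<close>, because \<open>N\<close> already contains the kernel of \<open>h\<close>; the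
  first isomorphism theorem then applies.\<close>

lemma (in group_hom) Mod_image_iso:
  assumes surj: "h ` carrier G = carrier H" and N: "normal N G" and ker: "kernel G H h \<subseteq> N"
    and comm: "comm_group H"
  shows "G Mod N \<cong> H Mod (h ` N)"
proof -
  interpret N: normal N G by fact
  interpret HC: comm_group H by fact
  have hN: "subgroup (h ` N) H" by (rule subgroup_img_is_subgroup[OF N.subgroup_axioms])
  interpret hN: normal "h ` N" H using hN by (rule HC.subgroup_imp_normal)
  have Q: "group (H Mod (h ` N))" by (rule hN.factorgroup_is_group)
  have comp: "(\<lambda>x. (h ` N) #>\<^bsub>H\<^esub> h x) \<in> hom G (H Mod (h ` N))"
    by (rule homI) (auto simp: carrier_FactGroup hN.rcos_sum)
  interpret C: group_hom G "H Mod (h ` N)" "\<lambda>x. (h ` N) #>\<^bsub>H\<^esub> h x"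
    using Q comp by (intro group_hom.intro G.group_axioms group_hom_axioms.intro)
  have "kernel G (H Mod (h ` N)) (\<lambda>x. (h ` N) #>\<^bsub>H\<^esub> h x) = N"
  proof (intro equalityI subsetI)
    fix x assume "x \<in> kernel G (H Mod (h ` N)) (\<lambda>x. (h ` N) #>\<^bsub>H\<^esub> h x)"
    then have x: "x \<in> carrier G" "(h ` N) #>\<^bsub>H\<^esub> h x = h ` N" by (auto simp: kernel_def)
    then have "h x \<in> h ` N" using H.rcos_self[OF _ hN, of "h x"] by auto
    then obtain y where y: "y \<in> N" "h x = h y" by auto
    then have yc: "y \<in> carrier G" using N.subset by auto
    have "x \<otimes> inv y \<in> N" using eq_iff_kernel[OF x(1) yc] y(2) ker by auto
    then have "x \<otimes> inv y \<otimes> y \<in> N" using y(1) by (rule N.m_closed)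
    then show "x \<in> N" using x yc by (simp add: G.m_assoc)
  next
    fix x assume x: "x \<in> N"
    then have "x \<in> carrier G" using N.subset by auto
    then show "x \<in> kernel G (H Mod (h ` N)) (\<lambda>x. (h ` N) #>\<^bsub>H\<^esub> h x)"
      using hN.rcos_const[of "h x"] x by (auto simp: kernel_def)
  qed
  moreover have "(\<lambda>x. (h ` N) #>\<^bsub>H\<^esub> h x) ` carrier G = carrier (H Mod (h ` N))"
    unfolding carrier_FactGroup surj[symmetric] image_image ..
  ultimately show ?thesis using C.FactGroup_iso by simp
qed

text \<open>Right multiplication by \<open>V\<close> preserves the column space, and left
  multiplication by \<open>U\<close> is an automorphism of the residue vectors that carries it
  along.\<close>

lemma zvec_Mod_sandwich:
  assumes q: "q > 0" and U: "unimod n U" and V: "unimod n V"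
  shows "zvec q n Mod mimg q n (mred (int q) n (mmul n U (mmul n a V))) \<cong> zvec q n Mod mimg q n a"
proof -
  let ?Z = "zvec q n" and ?UaV = "mred (int q) n (mmul n U (mmul n a V))"
  interpret Z: comm_group "?Z" by (rule comm_group_zvec)
  interpret M: group_hom "?Z" "?Z" "mvec q n U" using mvec_hom[OF q] by unfold_locales
  let ?C = "carrier (?Z)"
  obtain U' where U': "\<forall>ij\<in>sq n. mmul n U U' ij = mone ij \<and> mmul n U' U ij = mone ij"
    using U by (auto simp: unimod_def)
  obtain V' where V': "\<forall>ij\<in>sq n. mmul n V V' ij = mone ij \<and> mmul n V' V ij = mone ij"
    using V by (auto simp: unimod_def)
  have inv: "mvec q n A (mvec q n A' w) = w"
    if "\<forall>ij\<in>sq n. mmul n A A' ij = mone ij" "w \<in> ?C" for A A' w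
  proof -
    have "mvec q n A (mvec q n A' w) = mvec q n mone w"
      unfolding mvec_mvec using that by (intro mvec_cong) auto
    then show ?thesis using that q by (simp add: mvec_mone)
  qed
  have "mvec q n V ` ?C = ?C"
  proof
    show "?C \<subseteq> mvec q n V ` ?C"
      using inv[of V V'] V' mvec_carrier[OF q] by (metis image_eqI subsetI)
  qed (use mvec_carrier[OF q] in auto)
  moreover have "mvec q n (?UaV) w = mvec q n U (mvec q n a (mvec q n V w))" for w
  proof -
    have "mvec q n (?UaV) w = mvec q n (mmul n U (mmul n a V)) w"
      by (intro mvec_cong mred_cong) auto
    then show ?thesis by (simp add: mvec_mvec)
  qed
  ultimately have img: "mimg q n (?UaV) = mvec q n U ` mimg q n a"
    unfolding mimg_def by (metis (no_types, lifting) image_cong image_image)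
  have "?Z Mod mimg q n a \<cong> ?Z Mod (mvec q n U ` mimg q n a)"
  proof (rule M.Mod_image_iso[OF _ _ _ comm_group_zvec])
    show "mvec q n U ` ?C = ?C"
    proof
      show "?C \<subseteq> mvec q n U ` ?C"
        using inv[of U U'] U' mvec_carrier[OF q] by (metis image_eqI subsetI)
    qed (use mvec_carrier[OF q] in auto)
    show "normal (mimg q n a) (?Z)" using subgroup_mimg[OF q] by (rule Z.subgroup_imp_normal)
    show "kernel (?Z) (?Z) (mvec q n U) \<subseteq> mimg q n a"
    proof
      fix x assume "x \<in> kernel (?Z) (?Z) (mvec q n U)"
      then have x: "x \<in> ?C" "mvec q n U x = \<one>\<^bsub>?Z\<^esub>" by (auto simp: kernel_def)
      interpret M': group_hom "?Z" "?Z" "mvec q n U'" using mvec_hom[OF q] by unfold_locales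
      have "x = mvec q n U' (mvec q n U x)" by (rule inv[symmetric]) (use U' x(1) in auto)
      also have "\<dots> = \<one>\<^bsub>?Z\<^esub>" unfolding x(2) by (rule M'.hom_one)
      finally show "x \<in> mimg q n a" using subgroup.one_closed[OF subgroup_mimg[OF q]] by simp
    qed
  qed
  then show ?thesis unfolding img
    by (rule group.iso_sym[OF normal.factorgroup_is_group[OF Z.subgroup_imp_normal[OF subgroup_mimg[OF q]]]])
qed

text \<open>A matrix is the tuple of its columns, hence the exchanged indices in \<open>?f\<close>
  and \<open>?g\<close>.\<close>

lemma card_mod_box_quotient:
  assumes q: "q > 1"
  shows "card {a \<in> mod_box (sq n) (int q). zvec q n Mod mimg q n a \<cong> H} =
    card {x \<in> {..<n} \<rightarrow>\<^sub>E carrier (zvec q n). zvec q n Mod generate (zvec q n) (x ` {..<n}) \<cong> H}"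
proof (rule bij_betw_same_card)
  let ?S = "{a \<in> mod_box (sq n) (int q). zvec q n Mod mimg q n a \<cong> H}"
  let ?T = "{x \<in> {..<n} \<rightarrow>\<^sub>E carrier (zvec q n). zvec q n Mod generate (zvec q n) (x ` {..<n}) \<cong> H}"
  let ?f = "\<lambda>a. \<lambda>j\<in>{..<n}. \<lambda>i\<in>{..<n}. a (i, j) :: int"
  let ?g = "\<lambda>x. \<lambda>(i, j)\<in>sq n. x j i :: int"
  have q0: "q > 0" using q by simp
  have gen: "generate (zvec q n) (?f a ` {..<n}) = mimg q n a" if "a \<in> mod_box (sq n) (int q)" for a
  proof -
    have "?f a ` {..<n} = (\<lambda>j. \<lambda>i\<in>{..<n}. a (i, j) mod int q) ` {..<n}"
      using mod_box_D[OF that] by (intro image_cong refl) (auto simp: fun_eq_iff)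
    then show ?thesis by (simp only: mimg_eq_generate[OF q])
  qed
  have f_in: "?f a \<in> {..<n} \<rightarrow>\<^sub>E carrier (zvec q n)" if "a \<in> mod_box (sq n) (int q)" for a
    using mod_box_D[OF that] q0 by (auto simp: carrier_zvec mod_box_def)
  have g_in: "?g x \<in> mod_box (sq n) (int q)" if "x \<in> {..<n} \<rightarrow>\<^sub>E carrier (zvec q n)" for x
  proof -
    have xj: "x j \<in> mod_box {..<n} (int q)" if "j < n" for j
      using \<open>x \<in> _\<close> that q0 by (auto simp: carrier_zvec)
    have "0 \<le> x j i \<and> x j i < int q" if "i < n" "j < n" for i j
      using mod_box_D[OF xj[OF that(2)], of i] that(1) by simp
    then show ?thesis by (auto simp: mod_box_def)
  qed
  have fg: "?f (?g x) = x" if x: "x \<in> {..<n} \<rightarrow>\<^sub>E carrier (zvec q n)" for x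
  proof (rule extensionalityI[of _ "{..<n}"])
    fix j assume j: "j \<in> {..<n}"
    then have "x j \<in> extensional {..<n}" using x q0 by (auto simp: carrier_zvec mod_box_def PiE_def)
    then show "?f (?g x) j = x j" using j by (intro extensionalityI[of _ "{..<n}"]) auto
  qed (use x in \<open>auto simp: PiE_def\<close>)
  have gf: "?g (?f a) = a" if a: "a \<in> mod_box (sq n) (int q)" for a
  proof (rule extensionalityI[of _ "sq n"])
    show "a \<in> extensional (sq n)" using a by (simp add: mod_box_def PiE_def)
  qed auto
  show "bij_betw ?f ?S
      ?T"
  proof (rule bij_betw_byWitness[where f' = ?g])
    show "\<forall>a\<in>?S. ?g (?f a) = a"
      using gf by blast
    show "\<forall>x\<in>?T. ?f (?g x) = x"
      using fg by blast
    show "?f ` ?S \<subseteq>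
        ?T"
    proof (rule image_subsetI)
      fix a assume "a \<in> ?S"
      then have a: "a \<in> mod_box (sq n) (int q)" "zvec q n Mod mimg q n a \<cong> H" by auto
      then show "?f a \<in> ?T"
        using f_in[OF a(1)] gen[OF a(1)] by (simp only: mem_Collect_eq simp_thms)
    qed
    show "?g ` ?T \<subseteq>
        ?S"
    proof (rule image_subsetI)
      fix x assume "x \<in> ?T"
      then have x: "x \<in> {..<n} \<rightarrow>\<^sub>E carrier (zvec q n)" "zvec q n Mod generate (zvec q n) (x ` {..<n}) \<cong> H"
        by blast+
      have "generate (zvec q n) (x ` {..<n}) = mimg q n (?g x)"
        using gen[OF g_in[OF x(1)]] by (simp only: fg[OF x(1)])
      then show "?g x \<in> ?S"
        using x(2) g_in[OF x(1)] by (simp only: mem_Collect_eq simp_thms)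
    qed
  qed
qed

section \<open>Reduction of p-adic cokernels to a finite level\<close>

lemma padic_vec_prod: "padic_vec p n = padic_prod p {..<n}"
  by (simp add: padic_vec_def padic_prod_def)

lemma padic_mat_prod: "padic_mat p n = padic_prod p (sq n)"
  by (simp add: padic_mat_def padic_prod_def)

text \<open>Reduction modulo \<open>p^k\<close>, extensional so that the values on p-adic vectors
  fill \<open>mod_box I (int p ^ k)\<close>.\<close>

definition level :: "'i set \<Rightarrow> nat \<Rightarrow> ('i \<Rightarrow> nat \<Rightarrow> int) \<Rightarrow> 'i \<Rightarrow> int" where
  "level I k x = (\<lambda>i\<in>I. x i k)"

lemma padic_prod_bounds:
  "x \<in> carrier (padic_prod p I) \<Longrightarrow> i \<in> I \<Longrightarrow> 0 \<le> x i k \<and> x i k < int p ^ k"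
  by (auto simp: padic_prod_carrier padic_int_iff PiE_iff)

lemma level_in: "x \<in> carrier (padic_prod p I) \<Longrightarrow> level I k x \<in> mod_box I (int p ^ k)"
  using padic_prod_bounds[of x p I] by (auto simp: level_def mod_box_def)

lemma padic_prod_eqI:
  assumes "x \<in> carrier (padic_prod p I)" "y \<in> carrier (padic_prod p I)"
    and "\<And>i k. i \<in> I \<Longrightarrow> [x i k = y i k] (mod int p ^ k)"
  shows "x = y"
proof (rule PiE_ext)
  show "x \<in> PiE I (\<lambda>_. carrier (padic_int p))" "y \<in> PiE I (\<lambda>_. carrier (padic_int p))"
    using assms(1,2) by (simp_all add: padic_prod_carrier)
  show "x i = y i" if "i \<in> I" for i
  proof
    show "x i k = y i k" for k
      using assms(3)[OF that, of k] padic_prod_bounds[OF assms(1) that, of k] padic_prod_bounds[OF assms(2) that, of k]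
      by (simp add: cong_def)
  qed
qed

lemma comm_group_padic_prod: "p > 0 \<Longrightarrow> comm_group (padic_prod p I)"
proof (rule group.group_comm_groupI[OF padic_prod_group])
  fix x y assume p: "p > 0" and xy: "x \<in> carrier (padic_prod p I)" "y \<in> carrier (padic_prod p I)"
  interpret G: group "padic_prod p I" by (rule padic_prod_group[OF p])
  show "x \<otimes>\<^bsub>padic_prod p I\<^esub> y = y \<otimes>\<^bsub>padic_prod p I\<^esub> x"
    using xy by (intro padic_prod_eqI[of _ p I]) (simp_all add: padic_prod_mult_level add.commute)
qed

lemma one_padic_prod_level: "i \<in> I \<Longrightarrow> \<one>\<^bsub>padic_prod p I\<^esub> i k = 0"
  by (simp add: padic_prod_def padic_int_def)

lemma pow_padic_prod_level:
  fixes m :: nat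
  assumes "p > 0" "i \<in> I"
  shows "(x [^]\<^bsub>padic_prod p I\<^esub> m) i k = (int m * x i k) mod int p ^ k"
proof -
  interpret group "padic_prod p I" by (rule padic_prod_group[OF assms(1)])
  show ?thesis
    by (induction m)
      (simp_all add: one_padic_prod_level padic_prod_mult_level assms distrib_right mod_add_left_eq mod_add_right_eq add.commute)
qed

lemma level_mult:
  "level I k (x \<otimes>\<^bsub>padic_prod p I\<^esub> y) = mod_shift I (int p ^ k) (level I k y) (level I k x)"
  by (auto simp: level_def mod_shift_def padic_prod_mult_level)

lemma level_mult_zvec:
  "level {..<n} k (x \<otimes>\<^bsub>padic_prod p {..<n}\<^esub> y) = level {..<n} k x \<otimes>\<^bsub>zvec (p ^ k) n\<^esub> level {..<n} k y"
  by (auto simp: level_def mult_zvec padic_prod_mult_level)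

lemma level_surj:
  assumes "p > 0" "a \<in> mod_box I (int p ^ k)"
  obtains x where "x \<in> carrier (padic_prod p I)" "level I k x = a"
proof
  \<comment> \<open>The integer \<open>a i\<close> as a p-adic integer; level \<open>k\<close>
    returns it unchanged because it lies below \<open>p^k\<close>.\<close>
  let ?x = "\<lambda>i\<in>I. \<lambda>l. a i mod int p ^ l"
  show "?x \<in> carrier (padic_prod p I)"
    using padic_int_closed_aux[OF assms(1), of "\<lambda>_. a _"] by (auto simp: padic_prod_carrier)
  show "level I k ?x = a"
    using assms(2) mod_box_D[OF assms(2)]
    by (intro extensionalityI[of _ I]) (auto simp: level_def mod_box_def PiE_def)
qed

lemma level_image: "p > 0 \<Longrightarrow> level I k ` carrier (padic_prod p I) = mod_box I (int p ^ k)"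
  using level_in level_surj by (metis (no_types, lifting) image_subsetI subsetI subset_antisym image_eqI)

lemma level_hom: "p > 0 \<Longrightarrow> level {..<n} k \<in> hom (padic_prod p {..<n}) (zvec (p ^ k) n)"
  by (rule homI) (use level_in[of _ p "{..<n}" k] in \<open>simp_all add: carrier_zvec level_mult_zvec\<close>)

lemma finsum_padic_int_level:
  assumes "p > 0" "finite S" "\<And>j. j \<in> S \<Longrightarrow> g j \<in> carrier (padic_int p)"
  shows "(\<Oplus>\<^bsub>padic_int p\<^esub>j\<in>S. g j) l = (\<Sum>j\<in>S. g j l) mod int p ^ l"
proof -
  interpret R: cring "padic_int p" by (rule padic_int_cring[OF assms(1)])
  from assms(2,3) show ?thesis
  proof (induction S rule: finite_induct)
    case empty
    show ?case by (simp only: R.finsum_empty) (simp add: padic_int_def)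
  next
    case (insert j S)
    have "(\<Oplus>\<^bsub>padic_int p\<^esub>j\<in>insert j S. g j) = g j \<oplus>\<^bsub>padic_int p\<^esub> (\<Oplus>\<^bsub>padic_int p\<^esub>j\<in>S. g j)"
      using insert by (intro R.finsum_insert) auto
    moreover have "(x \<oplus>\<^bsub>padic_int p\<^esub> y) l = (x l + y l) mod int p ^ l" for x y
      by (simp add: padic_int_def)
    ultimately show ?case using insert by (simp add: mod_add_right_eq)
  qed
qed

context
  fixes p n :: nat and A :: "nat \<times> nat \<Rightarrow> nat \<Rightarrow> int"
  assumes p: "p > 0" and A: "A \<in> carrier (padic_mat p n)"
begin

lemma padic_mat_entry: "i < n \<Longrightarrow> j < n \<Longrightarrow> A (i, j) \<in> carrier (padic_int p)"
  using A by (auto simp: padic_mat_def)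

lemma padic_mult_mat_vec_in:
  assumes "v \<in> carrier (padic_prod p {..<n})"
  shows "padic_mult_mat_vec p n A v \<in> carrier (padic_prod p {..<n})"
proof -
  interpret R: cring "padic_int p" by (rule padic_int_cring[OF p])
  show ?thesis
    using assms padic_mat_entry
    by (auto simp: padic_mult_mat_vec_def padic_prod_carrier intro!: R.finsum_closed)
qed

lemma level_padic_mult_mat_vec:
  assumes v: "v \<in> carrier (padic_prod p {..<n})"
  shows "level {..<n} k (padic_mult_mat_vec p n A v) = mvec (p ^ k) n (level (sq n) k A) (level {..<n} k v)"
proof -
  interpret R: cring "padic_int p" by (rule padic_int_cring[OF p])
  have "(\<Oplus>\<^bsub>padic_int p\<^esub>j\<in>{..<n}. A (i, j) \<otimes>\<^bsub>padic_int p\<^esub> v j) k = (\<Sum>j<n. A (i, j) k * v j k) mod int p ^ k"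
    if i: "i < n" for i
  proof -
    have "(\<Oplus>\<^bsub>padic_int p\<^esub>j\<in>{..<n}. A (i, j) \<otimes>\<^bsub>padic_int p\<^esub> v j) k =
        (\<Sum>j<n. (A (i, j) \<otimes>\<^bsub>padic_int p\<^esub> v j) k) mod int p ^ k"
      using padic_mat_entry[OF i] v by (intro finsum_padic_int_level[OF p]) (auto simp: padic_prod_carrier)
    also have "\<dots> = (\<Sum>j<n. (A (i, j) k * v j k) mod int p ^ k) mod int p ^ k"
      by (simp add: padic_int_def)
    finally show ?thesis by (simp add: mod_sum_eq)
  qed
  then show ?thesis by (auto simp: level_def mvec_def padic_mult_mat_vec_def fun_eq_iff)
qed

lemma padic_mult_mat_vec_hom: "padic_mult_mat_vec p n A \<in> hom (padic_prod p {..<n}) (padic_prod p {..<n})"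
proof (rule homI)
  let ?V = "padic_prod p {..<n}"
  fix v w assume vw: "v \<in> carrier (?V)" "w \<in> carrier (?V)"
  interpret V: group "?V" by (rule padic_prod_group[OF p])
  let ?f = "padic_mult_mat_vec p n A"
  have eq: "level {..<n} k (?f (v \<otimes>\<^bsub>?V\<^esub> w)) =
      level {..<n} k (?f v \<otimes>\<^bsub>?V\<^esub> ?f w)" for k
    using vw level_in[OF vw(1), of k] level_in[OF vw(2), of k] p
    by (simp add: level_padic_mult_mat_vec level_mult_zvec hom_mult[OF mvec_hom] carrier_zvec)
  show "?f (v \<otimes>\<^bsub>?V\<^esub> w) = ?f v \<otimes>\<^bsub>?V\<^esub> ?f w"
  proof (rule padic_prod_eqI[of _ p "{..<n}"])
    show "[?f (v \<otimes>\<^bsub>?V\<^esub> w) i k = (?f v \<otimes>\<^bsub>?V\<^esub> ?f w) i k] (mod int p ^ k)"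
      if "i \<in> {..<n}" for i k
      using fun_cong[OF eq[of k], of i] that by (simp add: level_def)
  qed (use vw in \<open>simp_all add: padic_mult_mat_vec_in\<close>)
qed (rule padic_mult_mat_vec_in)

lemma subgroup_padic_image:
  "subgroup (padic_mult_mat_vec p n A ` carrier (padic_prod p {..<n})) (padic_prod p {..<n})"
proof -
  interpret V: group "padic_prod p {..<n}" by (rule padic_prod_group[OF p])
  interpret group_hom "padic_prod p {..<n}" "padic_prod p {..<n}" "padic_mult_mat_vec p n A"
    using padic_mult_mat_vec_hom by unfold_locales
  show ?thesis by (rule img_is_subgroup)
qed

lemma level_padic_image:
  "level {..<n} k ` padic_mult_mat_vec p n A ` carrier (padic_prod p {..<n}) = mimg (p ^ k) n (level (sq n) k A)"
proof -
  have "level {..<n} k ` padic_mult_mat_vec p n A ` carrier (padic_prod p {..<n}) =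
      mvec (p ^ k) n (level (sq n) k A) ` level {..<n} k ` carrier (padic_prod p {..<n})"
    unfolding image_image by (intro image_cong refl) (rule level_padic_mult_mat_vec)
  then show ?thesis using p by (simp add: mimg_def level_image carrier_zvec)
qed

end

text \<open>Division by \<open>p^k\<close> costs \<open>k\<close> digits, so level \<open>l\<close>
  of the quotient is read off from level \<open>l + k\<close> of \<open>v\<close>.\<close>

lemma level_kernel_pow:
  assumes p: "p > 0" and v: "v \<in> carrier (padic_prod p I)" and 0: "\<And>i. i \<in> I \<Longrightarrow> v i k = 0"
  shows "\<exists>u\<in>carrier (padic_prod p I). v = u [^]\<^bsub>padic_prod p I\<^esub> (p ^ k)"
proof
  interpret V: group "padic_prod p I" by (rule padic_prod_group[OF p])
  let ?u = "\<lambda>i\<in>I. \<lambda>l. v i (l + k) div int p ^ k"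
  have vi: "v i \<in> carrier (padic_int p)" if "i \<in> I" for i using v that by (auto simp: padic_prod_carrier)
  have "(\<lambda>l. v i (l + k) div int p ^ k) \<in> carrier (padic_int p)" if i: "i \<in> I" for i
    unfolding padic_int_iff
  proof (intro allI conjI)
    fix l
    show 0: "0 \<le> v i (l + k) div int p ^ k"
      using padic_prod_bounds[OF v i] p by (simp add: pos_imp_zdiv_nonneg_iff)
    have "v i (l + k) div int p ^ k * int p ^ k \<le> v i (l + k)"
      using p by (simp add: minus_mod_eq_div_mult[symmetric])
    also have "\<dots> < int p ^ l * int p ^ k"
      using padic_prod_bounds[OF v i, of "l + k"] by (simp add: power_add)
    finally show lt: "v i (l + k) div int p ^ k < int p ^ l"
      by (rule mult_right_less_imp_less) simp
    have "v i (Suc l + k) = int p ^ (l + k) * (v i (Suc l + k) div int p ^ (l + k)) + v i (Suc l + k) mod int p ^ (l + k)"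
      by (rule mult_div_mod_eq[symmetric])
    also have "v i (Suc l + k) mod int p ^ (l + k) = v i (l + k)"
      by (rule padic_int_level[OF vi[OF i]]) simp
    finally obtain c where "v i (Suc l + k) = int p ^ (l + k) * c + v i (l + k)" by blast
    then have c: "v i (Suc l + k) = v i (l + k) + int p ^ k * (int p ^ l * c)" by (simp add: power_add)
    have "v i (Suc l + k) div int p ^ k = v i (l + k) div int p ^ k + int p ^ l * c"
      unfolding c using p by simp
    then show "v i (Suc l + k) div int p ^ k mod int p ^ l = v i (l + k) div int p ^ k"
      using 0 lt by simp
  qed
  then show u: "?u \<in> carrier (padic_prod p I)" by (auto simp: padic_prod_carrier)
  show "v = ?u [^]\<^bsub>padic_prod p I\<^esub> (p ^ k)"
  proof (rule padic_prod_eqI[OF v])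
    fix i l assume i: "i \<in> I"
    have "int p ^ k dvd v i (l + k)"
      using padic_int_level[OF vi[OF i], of k "l + k"] 0[OF i] by (simp add: dvd_eq_mod_eq_0)
    then have "int p ^ k * (v i (l + k) div int p ^ k) mod int p ^ l = v i (l + k) mod int p ^ l" by simp
    also have "\<dots> = v i l" by (rule padic_int_level[OF vi[OF i]]) simp
    finally show "[v i l = (?u [^]\<^bsub>padic_prod p I\<^esub> (p ^ k)) i l] (mod int p ^ l)"
      using i by (simp add: pow_padic_prod_level[OF p i] cong_def)
  qed (use u in simp)
qed

section \<open>Nakayama's lemma for cokernels\<close>

lemma Mod_iso_exponent:
  fixes m :: nat
  assumes N: "normal N G" and H: "group H" and iso: "G Mod N \<cong> H"
    and exp: "\<And>x. x \<in> carrier H \<Longrightarrow> x [^]\<^bsub>H\<^esub> m = \<one>\<^bsub>H\<^esub>" and g: "g \<in> carrier G"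
  shows "g [^]\<^bsub>G\<^esub> m \<in> N"
proof -
  interpret N: normal N G by fact
  interpret Q: group "G Mod N" by (rule N.factorgroup_is_group)
  obtain \<psi> where \<psi>: "\<psi> \<in> hom (G Mod N) H" "bij_betw \<psi> (carrier (G Mod N)) (carrier H)"
    using iso by (auto simp: is_iso_def iso_def)
  interpret \<psi>: group_hom "G Mod N" H \<psi> using \<psi>(1) H by (intro group_hom.intro group_hom_axioms.intro Q.group_axioms)
  let ?c = "N #>\<^bsub>G\<^esub> g"
  have c: "?c \<in> carrier (G Mod N)" using g by (auto simp: carrier_FactGroup)
  have "\<psi> (?c [^]\<^bsub>G Mod N\<^esub> m) = \<one>\<^bsub>H\<^esub>"
    using exp[OF \<psi>.hom_closed[OF c]] c by (simp add: \<psi>.hom_nat_pow)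
  then have "\<psi> (?c [^]\<^bsub>G Mod N\<^esub> m) = \<psi> \<one>\<^bsub>G Mod N\<^esub>" using \<psi>.hom_one by simp
  then have "?c [^]\<^bsub>G Mod N\<^esub> m = \<one>\<^bsub>G Mod N\<^esub>"
    using inj_onD[OF bij_betw_imp_inj_on[OF \<psi>(2)]] Q.nat_pow_closed[OF c] Q.one_closed by blast
  then have "N #>\<^bsub>G\<^esub> (g [^]\<^bsub>G\<^esub> m) = N" using N.FactGroup_pow[OF g, of m] by simp
  then show ?thesis using N.rcos_self[OF N.nat_pow_closed[OF g, of m] N.subgroup_axioms] by simp
qed


text \<open>In additive terms \<open>p^k u\<close> is \<open>p\<close> times
  \<open>p^(k-1) u\<close>, so the hypothesis applies again to \<open>u\<close>. Iteration gives
  \<open>p^(k-1) v = A (y_0 + p y_1 + p^2 y_2 + ...)\<close>, and p-adic completeness makes the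
  series an actual preimage. Group powers here are integer multiples.\<close>

lemma padic_image_Nakayama:
  fixes p n k :: nat and A :: "nat \<times> nat \<Rightarrow> nat \<Rightarrow> int"
  assumes p: "p > 0" and k: "k > 0" and A: "A \<in> carrier (padic_mat p n)"
  defines "V \<equiv> padic_prod p {..<n}"
  assumes step: "\<And>v. v \<in> carrier V \<Longrightarrow> \<exists>y\<in>carrier V. \<exists>u\<in>carrier V.
      v [^]\<^bsub>V\<^esub> (p ^ (k - 1)) = padic_mult_mat_vec p n A y \<otimes>\<^bsub>V\<^esub> u [^]\<^bsub>V\<^esub> (p ^ k)"
    and v: "v \<in> carrier V"
  shows "v [^]\<^bsub>V\<^esub> (p ^ (k - 1)) \<in> padic_mult_mat_vec p n A ` carrier V"
proof -
  interpret V: group V unfolding V_def by (rule padic_prod_group[OF p])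
  have pk: "int p ^ k = int p * int p ^ (k - 1)" using k by (cases k) auto
  obtain Y U where YU: "\<And>v. v \<in> carrier V \<Longrightarrow> Y v \<in> carrier V" "\<And>v. v \<in> carrier V \<Longrightarrow> U v \<in> carrier V"
    "\<And>v. v \<in> carrier V \<Longrightarrow>
      v [^]\<^bsub>V\<^esub> (p ^ (k - 1)) = padic_mult_mat_vec p n A (Y v) \<otimes>\<^bsub>V\<^esub> U v [^]\<^bsub>V\<^esub> (p ^ k)"
    using step by metis
  \<comment> \<open>\<open>x t\<close> is the remainder after \<open>t\<close> rounds, and
    \<open>y t\<close> the vector split off from it in the next round.\<close>
  define x where "x = (\<lambda>t. (U ^^ t) v)"
  define y where "y = (\<lambda>t. Y (x t))"
  have x: "x t \<in> carrier V" for t by (induction t) (simp_all add: x_def v YU(2))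
  have y: "y t \<in> carrier V" for t unfolding y_def by (rule YU(1)[OF x])
  have eq: "[(\<Sum>j<n. A (i, j) l * y t j l) = int p ^ (k - 1) * x t i l - int p ^ k * x (Suc t) i l] (mod int p ^ l)"
    if i: "i < n" for i l t
  proof -
    have "x t [^]\<^bsub>V\<^esub> (p ^ (k - 1)) = padic_mult_mat_vec p n A (y t) \<otimes>\<^bsub>V\<^esub> x (Suc t) [^]\<^bsub>V\<^esub> (p ^ k)"
      using YU(3)[OF x[of t]] by (simp add: y_def x_def)
    from arg_cong[OF this, of "\<lambda>w. w i l"]
    have "[int p ^ (k - 1) * x t i l = padic_mult_mat_vec p n A (y t) i l + int p ^ k * x (Suc t) i l] (mod int p ^ l)"
      using i p by (simp add: V_def pow_padic_prod_level padic_prod_mult_level cong_def mod_add_right_eq)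
    moreover have "padic_mult_mat_vec p n A (y t) i l = (\<Sum>j<n. A (i, j) l * y t j l) mod int p ^ l"
      using fun_cong[OF level_padic_mult_mat_vec[OF p A y[unfolded V_def], of l t], of i] i
      by (simp add: level_def mvec_def)
    ultimately have "[int p ^ (k - 1) * x t i l = (\<Sum>j<n. A (i, j) l * y t j l) + int p ^ k * x (Suc t) i l] (mod int p ^ l)"
      by (simp add: cong_def mod_add_left_eq)
    from cong_diff[OF this cong_refl[of "int p ^ k * x (Suc t) i l"]]
    show ?thesis by (simp add: cong_sym)
  qed
  \<comment> \<open>The series \<open>\<Sum>t. p\<^sup>t y\<^sub>t\<close>, truncated at each level.\<close>
  define z where "z = (\<lambda>j\<in>{..<n}. \<lambda>l. (\<Sum>t<l. int p ^ t * y t j l) mod int p ^ l)"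
  have z: "z \<in> carrier V"
  proof -
    have "(\<lambda>l. (\<Sum>t<l. int p ^ t * y t j l) mod int p ^ l) \<in> carrier (padic_int p)" if j: "j < n" for j
    proof (rule padic_int_closed_aux[OF p])
      fix l
      have "[y t j (Suc l) = y t j l] (mod int p ^ l)" for t
      proof -
        have "y t j \<in> carrier (padic_int p)" using y[of t] j by (auto simp: V_def padic_prod_carrier)
        then have "y t j (Suc l) mod int p ^ l = y t j l" "y t j l mod int p ^ l = y t j l"
          by (rule padic_int_level, simp)+
        then show ?thesis by (simp only: cong_def)
      qed
      \<comment> \<open>The additional term at \<open>t = l\<close> carries the factor
        \<open>p^l\<close>, so consecutive truncations are compatible.\<close>
      then have "[(\<Sum>t<l. int p ^ t * y t j (Suc l)) + int p ^ l * y l j (Suc l) = (\<Sum>t<l. int p ^ t * y t j l) + 0] (mod int p ^ l)"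
        by (intro cong_add cong_sum cong_mult cong_refl) (simp_all add: cong_0_iff)
      then show "(\<Sum>t<Suc l. int p ^ t * y t j (Suc l)) mod int p ^ l = (\<Sum>t<l. int p ^ t * y t j l) mod int p ^ l"
        by (simp add: cong_def)
    qed
    then show ?thesis by (auto simp: V_def padic_prod_carrier z_def)
  qed
  have "v [^]\<^bsub>V\<^esub> (p ^ (k - 1)) = padic_mult_mat_vec p n A z"
  proof (rule padic_prod_eqI[of _ p "{..<n}"])
    show "v [^]\<^bsub>V\<^esub> (p ^ (k - 1)) \<in> carrier (padic_prod p {..<n})" using v by (simp flip: V_def)
    show "padic_mult_mat_vec p n A z \<in> carrier (padic_prod p {..<n})"
      using z unfolding V_def by (rule padic_mult_mat_vec_in[OF p A])
    fix i l assume i: "i \<in> {..<n}"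
    have "[padic_mult_mat_vec p n A z i l = (\<Sum>j<n. A (i, j) l * z j l)] (mod int p ^ l)"
      using fun_cong[OF level_padic_mult_mat_vec[OF p A z[unfolded V_def], of l], of i] i
      by (simp add: level_def mvec_def cong_def)
    moreover have "[(\<Sum>j<n. A (i, j) l * z j l) = (\<Sum>j<n. A (i, j) l * (\<Sum>t<l. int p ^ t * y t j l))] (mod int p ^ l)"
      by (intro cong_sum cong_mult cong_refl) (simp add: z_def cong_def)
    moreover have "(\<Sum>j<n. A (i, j) l * (\<Sum>t<l. int p ^ t * y t j l)) =
        (\<Sum>t<l. int p ^ t * (\<Sum>j<n. A (i, j) l * y t j l))"
      unfolding sum_distrib_left by (subst sum.swap) (simp add: mult_ac)
    moreover have "[(\<Sum>t<l. int p ^ t * (\<Sum>j<n. A (i, j) l * y t j l)) =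
        (\<Sum>t<l. int p ^ t * (int p ^ (k - 1) * x t i l - int p ^ k * x (Suc t) i l))] (mod int p ^ l)"
      using i by (intro cong_sum cong_mult cong_refl eq) simp
    \<comment> \<open>Telescoping, because \<open>p^t * p^k = p^(t+1) * p^(k-1)\<close>; the
      surviving last remainder is divisible by \<open>p^l\<close>.\<close>
    moreover have "(\<Sum>t<l. int p ^ t * (int p ^ (k - 1) * x t i l - int p ^ k * x (Suc t) i l)) =
        int p ^ (k - 1) * x 0 i l - int p ^ l * (int p ^ (k - 1) * x l i l)"
    proof -
      have "(\<Sum>t<m. int p ^ t * (int p ^ (k - 1) * x t i l - int p ^ k * x (Suc t) i l)) =
          int p ^ (k - 1) * x 0 i l - int p ^ m * (int p ^ (k - 1) * x m i l)" for m
        by (induction m) (simp_all add: pk algebra_simps)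
      then show ?thesis .
    qed
    moreover have "[int p ^ (k - 1) * x 0 i l - int p ^ l * (int p ^ (k - 1) * x l i l) = int p ^ (k - 1) * x 0 i l] (mod int p ^ l)"
      by (simp add: cong_iff_dvd_diff)
    moreover have "[(v [^]\<^bsub>V\<^esub> (p ^ (k - 1))) i l = int p ^ (k - 1) * x 0 i l] (mod int p ^ l)"
      using i by (simp add: V_def pow_padic_prod_level[OF p] cong_def x_def)
    ultimately show "[(v [^]\<^bsub>V\<^esub> (p ^ (k - 1))) i l = padic_mult_mat_vec p n A z i l] (mod int p ^ l)"
      unfolding cong_def by (simp only:)
  qed
  then show ?thesis using z by blast
qed

text \<open>Either isomorphism puts \<open>p^(k-1) V\<close> into the image of \<open>A\<close>:
  directly for the cokernel, and for the reduction first modulo \<open>p^k V\<close> and then by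
  Nakayama. So the image contains the kernel \<open>p^k V\<close> of the reduction, and the two
  quotients agree.\<close>

theorem cok_iso_iff:
  assumes p: "p > 0" and k: "k > 0" and A: "A \<in> carrier (padic_mat p n)" and H: "group H"
    and exp: "\<And>x. x \<in> carrier H \<Longrightarrow> x [^]\<^bsub>H\<^esub> (p ^ (k - 1)) = \<one>\<^bsub>H\<^esub>"
  shows "cok p n A \<cong> H \<longleftrightarrow> zvec (p ^ k) n Mod mimg (p ^ k) n (level (sq n) k A) \<cong> H"
proof -
  let ?V = "padic_prod p {..<n}" and ?Z = "zvec (p ^ k) n" and ?f = "padic_mult_mat_vec p n A"
  let ?Im = "?f ` carrier ?V" and ?\<pi> = "level {..<n} k" and ?M = "mimg (p ^ k) n (level (sq n) k A)"
  have q0: "p ^ k > 0" using p by simp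
  interpret V: comm_group ?V by (rule comm_group_padic_prod[OF p])
  interpret Z: comm_group ?Z by (rule comm_group_zvec)
  interpret \<pi>: group_hom ?V ?Z ?\<pi> using level_hom[OF p] by unfold_locales
  have Im: "subgroup ?Im ?V" by (rule subgroup_padic_image[OF p A])
  have M: "subgroup ?M ?Z" by (rule subgroup_mimg[OF q0])
  have \<pi>Im: "?\<pi> ` ?Im = ?M" by (rule level_padic_image[OF p A])
  have \<pi>surj: "?\<pi> ` carrier ?V = carrier ?Z" using p by (simp add: level_image carrier_zvec)
  have cok: "cok p n A = ?V Mod ?Im" by (simp add: cok_def padic_vec_prod)
  have kernel: "\<exists>u\<in>carrier ?V. w = u [^]\<^bsub>?V\<^esub> (p ^ k)" if "w \<in> kernel ?V ?Z ?\<pi>" for w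
  proof (rule level_kernel_pow[OF p])
    show "w \<in> carrier ?V" using that by (simp add: kernel_def)
    have w: "?\<pi> w = \<one>\<^bsub>?Z\<^esub>" using that by (simp add: kernel_def)
    show "w i k = 0" if "i \<in> {..<n}" for i
      using fun_cong[OF w, of i] that by (simp add: level_def one_zvec)
  qed
  have iso: "cok p n A \<cong> ?Z Mod ?M" if pow: "\<And>v. v \<in> carrier ?V \<Longrightarrow> v [^]\<^bsub>?V\<^esub> (p ^ (k - 1)) \<in> ?Im"
  proof -
    have "kernel ?V ?Z ?\<pi> \<subseteq> ?Im"
    proof
      fix w assume "w \<in> kernel ?V ?Z ?\<pi>"
      then obtain u where u: "u \<in> carrier ?V" "w = u [^]\<^bsub>?V\<^esub> (p ^ k)" using kernel by blast
      have "p ^ k = p * p ^ (k - 1)" using k by (cases k) auto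
      then have "w = (u [^]\<^bsub>?V\<^esub> p) [^]\<^bsub>?V\<^esub> (p ^ (k - 1))" using u by (simp add: V.nat_pow_pow)
      then show "w \<in> ?Im" using pow[of "u [^]\<^bsub>?V\<^esub> p"] u(1) by simp
    qed
    from \<pi>.Mod_image_iso[OF \<pi>surj V.subgroup_imp_normal[OF Im] this comm_group_zvec]
    show ?thesis by (simp only: cok \<pi>Im)
  qed
  show ?thesis
  proof
    assume H': "cok p n A \<cong> H"
    have "cok p n A \<cong> ?Z Mod ?M"
      by (rule iso) (rule Mod_iso_exponent[OF V.subgroup_imp_normal[OF Im] H H'[unfolded cok] exp])
    then have "?Z Mod ?M \<cong> cok p n A"
      unfolding cok by (rule group.iso_sym[OF normal.factorgroup_is_group[OF V.subgroup_imp_normal[OF Im]]])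
    then show "?Z Mod ?M \<cong> H" using H' by (rule iso_trans)
  next
    assume H': "?Z Mod ?M \<cong> H"
    have "v [^]\<^bsub>?V\<^esub> (p ^ (k - 1)) \<in> ?Im" if v: "v \<in> carrier ?V" for v
    proof (rule padic_image_Nakayama[OF p k A _ v])
      fix v assume v: "v \<in> carrier ?V"
      have "?\<pi> v [^]\<^bsub>?Z\<^esub> (p ^ (k - 1)) \<in> ?M"
        by (rule Mod_iso_exponent[OF Z.subgroup_imp_normal[OF M] H H' exp \<pi>.hom_closed[OF v]])
      then have "?\<pi> (v [^]\<^bsub>?V\<^esub> (p ^ (k - 1))) \<in> ?\<pi> ` ?Im" using v by (simp add: \<pi>.hom_nat_pow \<pi>Im)
      then obtain y where y: "y \<in> carrier ?V" "?\<pi> (v [^]\<^bsub>?V\<^esub> (p ^ (k - 1))) = ?\<pi> (?f y)" by blast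
      let ?a = "v [^]\<^bsub>?V\<^esub> (p ^ (k - 1))"
      have a: "?a \<in> carrier ?V" using v by simp
      have fy: "?f y \<in> carrier ?V" using y(1) by (rule padic_mult_mat_vec_in[OF p A])
      have "?a \<otimes>\<^bsub>?V\<^esub> inv\<^bsub>?V\<^esub> ?f y \<in> kernel ?V ?Z ?\<pi>"
        using \<pi>.eq_iff_kernel[OF a fy] y(2) by simp
      then obtain u where u: "u \<in> carrier ?V" "?a \<otimes>\<^bsub>?V\<^esub> inv\<^bsub>?V\<^esub> ?f y = u [^]\<^bsub>?V\<^esub> (p ^ k)"
        using kernel by blast
      then have "?a = ?f y \<otimes>\<^bsub>?V\<^esub> u [^]\<^bsub>?V\<^esub> (p ^ k)"
        using a fy by (metis V.inv_closed V.m_assoc V.m_comm V.l_inv V.r_one V.m_closed)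
      then show "\<exists>y\<in>carrier ?V. \<exists>u\<in>carrier ?V. ?a = ?f y \<otimes>\<^bsub>?V\<^esub> u [^]\<^bsub>?V\<^esub> (p ^ k)"
        using y(1) u(1) by blast
    qed
    then have "cok p n A \<cong> ?Z Mod ?M" by (rule iso)
    then show "cok p n A \<cong> H" using H' by (rule iso_trans)
  qed
qed

section \<open>The p-rank, the Haar measure and the limit\<close>

text \<open>\<open>dim\<close> is the least size of a finite spanning set, and the linear
  combinations of such a set exhaust the space.\<close>

lemma (in vectorspace) card_carrier_le:
  assumes fin: "finite (carrier V)" and finK: "finite (carrier K)"
  shows "card (carrier V) \<le> card (carrier K) ^ dim"
proof -
  have "gen_set (carrier V)"
    using span_is_subset2[of "carrier V"] in_own_span[of "carrier V"] by auto
  then have "\<exists>n A. finite A \<and> card A = n \<and> A \<subseteq> carrier V \<and> gen_set A"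
    using fin by blast
  then have "\<exists>A. finite A \<and> card A = dim \<and> A \<subseteq> carrier V \<and> gen_set A"
    unfolding dim_def by (rule LeastI_ex)
  then obtain A where A: "finite A" "card A = dim" "A \<subseteq> carrier V" "span A = carrier V" by blast
  have "carrier V \<subseteq> (\<lambda>a. lincomb a A) ` (A \<rightarrow>\<^sub>E carrier K)"
  proof
    fix v assume "v \<in> carrier V"
    then obtain a where a: "a \<in> A \<rightarrow> carrier K" "lincomb a A = v"
      using finite_in_span[OF A(1,3)] A(4) by blast
    have "lincomb (restrict a A) A = v"
      unfolding a(2)[symmetric] lincomb_def using a(1) A(3) by (intro M.finsum_cong') auto
    then show "v \<in> (\<lambda>a. lincomb a A) ` (A \<rightarrow>\<^sub>E carrier K)"
      using a(1) by (intro image_eqI[of _ _ "restrict a A"]) auto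
  qed
  then have "card (carrier V) \<le> card (A \<rightarrow>\<^sub>E carrier K)"
    using A(1) finK by (intro surj_card_le finite_PiE) auto
  then show ?thesis using A by (simp add: card_PiE)
qed

lemma iso_card_eq: "G \<cong> H \<Longrightarrow> card (carrier G) = card (carrier H)"
  by (auto simp: is_iso_def iso_def dest: bij_betw_same_card)

text \<open>Both groups are \<open>V / (A V + p V)\<close> for \<open>V\<close> the p-adic vectors:
  one divides by \<open>A V\<close> first, the other by \<open>p V\<close>.\<close>

lemma card_cok_mod_p:
  assumes p: "p > 0" and A: "A \<in> carrier (padic_mat p n)"
  defines "N \<equiv> cok p n A"
  shows "card (carrier (N Mod ((\<lambda>x. x [^]\<^bsub>N\<^esub> p) ` carrier N))) =
    card (carrier (zvec p n Mod mimg p n (level (sq n) 1 A)))"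
proof -
  let ?V = "padic_prod p {..<n}" and ?Z = "zvec p n" and ?f = "padic_mult_mat_vec p n A"
  let ?Im = "?f ` carrier ?V" and ?\<pi> = "level {..<n} 1" and ?M = "mimg p n (level (sq n) 1 A)"
  let ?P = "(\<lambda>x. x [^]\<^bsub>N\<^esub> p) ` carrier N"
  interpret V: comm_group ?V by (rule comm_group_padic_prod[OF p])
  interpret Z: comm_group ?Z by (rule comm_group_zvec)
  interpret \<pi>: group_hom ?V ?Z ?\<pi> using level_hom[OF p, of n 1] by unfold_locales simp
  have Im: "subgroup ?Im ?V" by (rule subgroup_padic_image[OF p A])
  interpret Im: normal ?Im ?V by (rule V.subgroup_imp_normal[OF Im])
  have N: "N = ?V Mod ?Im" by (simp add: N_def cok_def padic_vec_prod)
  interpret N: comm_group N unfolding N by (rule V.abelian_FactGroup[OF Im])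
  have P: "subgroup ?P N" by (rule subgroup_pow_image[OF N.comm_group_axioms])
  interpret P: normal ?P N by (rule N.subgroup_imp_normal[OF P])
  interpret W: group "N Mod ?P" by (rule P.factorgroup_is_group)
  let ?c = "\<lambda>v. ?Im #>\<^bsub>?V\<^esub> v"
  let ?\<rho> = "\<lambda>v. ?P #>\<^bsub>N\<^esub> ?c v"
  have c: "?c \<in> hom ?V N" unfolding N by (rule homI) (auto simp: carrier_FactGroup Im.rcos_sum)
  interpret c: group_hom ?V N ?c using c by unfold_locales
  have c_surj: "?c ` carrier ?V = carrier N" unfolding N carrier_FactGroup ..
  have "?\<rho> \<in> hom ?V (N Mod ?P)"
    by (rule homI) (auto simp: carrier_FactGroup P.rcos_sum)
  then interpret \<rho>: group_hom ?V "N Mod ?P" ?\<rho> by unfold_locales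
  have \<rho>_surj: "?\<rho> ` carrier ?V = carrier (N Mod ?P)"
    unfolding carrier_FactGroup c_surj[symmetric] image_image ..
  have \<rho>_one: "?\<rho> v = ?P \<longleftrightarrow> ?c v \<in> ?P" if "v \<in> carrier ?V" for v
    using P.rcos_const[OF N.is_group, of "?c v"] N.rcos_self[OF c.hom_closed[OF that] P] by auto
  have ker\<rho>: "v \<in> kernel ?V (N Mod ?P) ?\<rho> \<longleftrightarrow> v \<in> carrier ?V \<and> ?c v \<in> ?P" for v
    using \<rho>_one by (auto simp: kernel_def)
  have sub1: "kernel ?V ?Z ?\<pi> \<subseteq> kernel ?V (N Mod ?P) ?\<rho>"
  proof
    fix w assume "w \<in> kernel ?V ?Z ?\<pi>"
    then have w: "w \<in> carrier ?V" "?\<pi> w = \<one>\<^bsub>?Z\<^esub>" by (auto simp: kernel_def)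
    have "w i 1 = 0" if "i \<in> {..<n}" for i
      using fun_cong[OF w(2), of i] that by (simp add: level_def one_zvec)
    then obtain u where u: "u \<in> carrier ?V" "w = u [^]\<^bsub>?V\<^esub> p"
      using level_kernel_pow[OF p w(1), of 1] by auto
    then have "?c w = ?c u [^]\<^bsub>N\<^esub> p" by (simp only: c.hom_nat_pow)
    then have "?c w \<in> ?P" using u(1) by auto
    then show "w \<in> kernel ?V (N Mod ?P) ?\<rho>" using w(1) by (simp only: ker\<rho> simp_thms)
  qed
  have \<pi>Im: "?\<pi> ` ?Im = ?M" using level_padic_image[OF p A, of 1] by simp
  have img: "?\<pi> ` kernel ?V (N Mod ?P) ?\<rho> = ?M"
  proof
    have "?Im \<subseteq> kernel ?V (N Mod ?P) ?\<rho>"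
    proof
      fix v assume v: "v \<in> ?Im"
      then have vc: "v \<in> carrier ?V" using subgroup.subset[OF Im] by blast
      have "?c v = ?c \<one>\<^bsub>?V\<^esub>" using Im.rcos_const[OF V.is_group v] Im.rcos_const[OF V.is_group subgroup.one_closed[OF Im]]
        by (simp only:)
      also have "\<dots> = \<one>\<^bsub>N\<^esub>" by (rule c.hom_one)
      also have "\<dots> \<in> ?P" by (rule subgroup.one_closed[OF P])
      finally show "v \<in> kernel ?V (N Mod ?P) ?\<rho>" using vc by (simp only: ker\<rho> simp_thms)
    qed
    then show "?M \<subseteq> ?\<pi> ` kernel ?V (N Mod ?P) ?\<rho>" unfolding \<pi>Im[symmetric] by (rule image_mono)
    show "?\<pi> ` kernel ?V (N Mod ?P) ?\<rho> \<subseteq> ?M"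
    proof (rule image_subsetI)
      fix v assume "v \<in> kernel ?V (N Mod ?P) ?\<rho>"
      then have v: "v \<in> carrier ?V" "?c v \<in> ?P" by (simp_all only: ker\<rho>)
      then obtain X where X: "X \<in> carrier N" "?c v = X [^]\<^bsub>N\<^esub> p" by blast
      then obtain g where g: "g \<in> carrier ?V" "X = ?c g" using c_surj by blast
      have eq: "?c v = ?c (g [^]\<^bsub>?V\<^esub> p)" using X g by (simp only: c.hom_nat_pow)
      have "v \<in> ?c v" by (rule V.rcos_self[OF v(1) Im])
      then have "v \<in> ?c (g [^]\<^bsub>?V\<^esub> p)" by (simp only: eq)
      then obtain m where m: "m \<in> ?Im" "v = m \<otimes>\<^bsub>?V\<^esub> g [^]\<^bsub>?V\<^esub> p" by (auto simp: r_coset_def)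
      have mc: "m \<in> carrier ?V" using m(1) subgroup.subset[OF Im] by blast
      have "?\<pi> v = ?\<pi> m \<otimes>\<^bsub>?Z\<^esub> ?\<pi> g [^]\<^bsub>?Z\<^esub> p" using mc g(1)
        by (simp only: m(2) \<pi>.hom_mult \<pi>.hom_nat_pow V.nat_pow_closed)
      also have "?\<pi> g [^]\<^bsub>?Z\<^esub> p = \<one>\<^bsub>?Z\<^esub>" using \<pi>.hom_closed[OF g(1)] by (rule pow_order_zvec)
      finally have "?\<pi> v = ?\<pi> m" using \<pi>.hom_closed[OF mc] by simp
      then show "?\<pi> v \<in> ?M" using m(1) \<pi>Im by blast
    qed
  qed
  have \<pi>surj: "?\<pi> ` carrier ?V = carrier ?Z" using level_image[OF p, of "{..<n}" 1] p by (simp add: carrier_zvec)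
  have i1: "?V Mod kernel ?V (N Mod ?P) ?\<rho> \<cong> ?Z Mod ?M"
    using \<pi>.Mod_image_iso[OF \<pi>surj \<rho>.normal_kernel sub1 comm_group_zvec] by (simp only: img)
  have i2: "?V Mod kernel ?V (N Mod ?P) ?\<rho> \<cong> N Mod ?P" by (rule \<rho>.FactGroup_iso[OF \<rho>_surj])
  show ?thesis using iso_card_eq[OF i1] iso_card_eq[OF i2] by (rule trans[OF sym, rotated])
qed

text \<open>Rank-nullity by counting: kernel and cokernel of an endomorphism of a finite abelian
  group have the same order.\<close>

lemma card_kernel_mvec:
  assumes q: "q > 0"
  shows "card {x \<in> mod_box {..<n} (int q). \<forall>a<n. int q dvd (\<Sum>b<n. B (a, b) * x b)} =
    card (carrier (zvec q n Mod mimg q n B))"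
proof -
  let ?Z = "zvec q n" and ?M = "mimg q n B"
  interpret Z: comm_group "?Z" by (rule comm_group_zvec)
  interpret M: group_hom "?Z" "?Z" "mvec q n B" using mvec_hom[OF q] by unfold_locales
  have "mvec q n B x = \<one>\<^bsub>?Z\<^esub> \<longleftrightarrow> (\<forall>a<n. int q dvd (\<Sum>b<n. B (a, b) * x b))" for x
    by (auto simp: mvec_def one_zvec fun_eq_iff dvd_eq_mod_eq_0)
  then have K: "kernel (?Z) (?Z) (mvec q n B) =
      {x \<in> mod_box {..<n} (int q). \<forall>a<n. int q dvd (\<Sum>b<n. B (a, b) * x b)}"
    by (simp add: kernel_def carrier_zvec[OF q])
  have fin: "finite (carrier (?Z))" by (simp add: carrier_zvec[OF q])
  have "card (rcosets\<^bsub>?Z\<^esub> ?M) * card (?M) = order (?Z)"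
    using Z.lagrange[OF subgroup_mimg[OF q]] by simp
  moreover have "order (?Z) = card (kernel (?Z) (?Z) (mvec q n B)) * card (?M)"
    unfolding mimg_def by (rule M.order_eq_kernel_image)
  moreover have "card (?M) > 0"
    using finite_subset[OF subgroup.subset[OF subgroup_mimg[OF q]] fin]
      subgroup.one_closed[OF subgroup_mimg[OF q, of n B]]
    by (auto simp: card_gt_0_iff)
  ultimately show ?thesis by (simp add: K FactGroup_def)
qed

text \<open>The kernel modulo \<open>p\<close> is as large as the cokernel modulo \<open>p\<close>,
  which is a vector space whose dimension is the p-rank.\<close>

lemma card_kernel_le_p_rank:
  assumes p: "prime p" and B: "B \<in> carrier (padic_mat p n)"
  shows "card {x \<in> mod_box {..<n} (int p). \<forall>a<n. int p dvd (\<Sum>b<n. B (a, b) 1 * x b)} \<le> p ^ p_rank p (cok p n B)"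
proof -
  let ?N = "cok p n B"
  have p0: "p > 0" using p by (rule prime_gt_0_nat)
  interpret W: vectorspace "residue_ring (int p)" "mod_p p ?N"
    by (rule mod_p_vectorspace[OF p cok_comm_group[OF p0 B]])
  have car: "carrier (mod_p p ?N) = carrier (?N Mod ((\<lambda>x. x [^]\<^bsub>?N\<^esub> p) ` carrier ?N))"
    by (simp add: mod_p_def Let_def)
  have "(\<Sum>b<n. level (sq n) 1 B (a, b) * x b) = (\<Sum>b<n. B (a, b) 1 * x b)" if "a < n" for a x
    using that by (intro sum.cong) (auto simp: level_def)
  then have eq: "card {x \<in> mod_box {..<n} (int p). \<forall>a<n. int p dvd (\<Sum>b<n. B (a, b) 1 * x b)} =
      card (carrier (mod_p p ?N))"
    using card_kernel_mvec[OF p0, of n "level (sq n) 1 B"] card_cok_mod_p[OF p0 B] car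
    by (simp cong: conj_cong)
  show ?thesis
  proof (cases "finite (carrier (mod_p p ?N))")
    case True
    have "card (carrier (residue_ring (int p))) = p" by (simp add: residue_ring_def)
    moreover have "finite (carrier (residue_ring (int p)))" by (simp add: residue_ring_def)
    ultimately show ?thesis using W.card_carrier_le[OF True] eq by (simp add: p_rank_def)
  next
    case False
    \<comment> \<open>The cardinality of an infinite set is 0.\<close>
    then show ?thesis unfolding eq by simp
  qed
qed

text \<open>Writing \<open>x = y + p z\<close> coordinatewise separates the residue \<open>y\<close>
  from the free quotient \<open>z\<close>.\<close>

lemma card_mod_box_reduce:
  assumes "finite I" "p > 0" "m > 0"
  shows "card {x \<in> mod_box I (p * m). P (\<lambda>i\<in>I. x i mod p)} = card {y \<in> mod_box I p. P y} * card (mod_box I m)"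
proof -
  let ?X = "{x \<in> mod_box I (p * m). P (\<lambda>i\<in>I. x i mod p)}"
  let ?Y = "{y \<in> mod_box I p. P y} \<times> mod_box I m"
  let ?f = "\<lambda>(y, z). \<lambda>i\<in>I. y i + p * z i"
  let ?g = "\<lambda>x. (\<lambda>i\<in>I. x i mod p, \<lambda>i\<in>I. x i div p)"
  have "bij_betw ?f ?Y
      ?X"
  proof (rule bij_betw_byWitness[where f' = ?g])
    have a: "(\<lambda>i\<in>I. (\<lambda>i\<in>I. y i + p * z i) i mod p) = y" if "y \<in> mod_box I p" for y z
      using that mod_box_D[OF that] by (intro extensionalityI[of _ I]) (auto simp: mod_box_def PiE_def)
    have b: "(\<lambda>i\<in>I. (\<lambda>i\<in>I. y i + p * z i) i div p) = z" if "y \<in> mod_box I p" "z \<in> mod_box I m" for y z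
      using that mod_box_D[OF that(1)] assms by (intro extensionalityI[of _ I]) (auto simp: mod_box_def PiE_def)
    show "\<forall>yz\<in>?Y.
        ?g (?f yz) = yz"
    proof
      fix yz assume "yz \<in> ?Y"
      then obtain y z where "yz = (y, z)" "y \<in> mod_box I p" "z \<in> mod_box I m" by blast
      then show "?g (?f yz) = yz"
        using a b by (simp only: case_prod_conv)
    qed
    show "\<forall>x\<in>?X.
        ?f ((\<lambda>i\<in>I. x i mod p, \<lambda>i\<in>I. x i div p)) = x"
    proof
      fix x assume "x \<in> ?X"
      then have "x \<in> extensional I" by (simp add: mod_box_def PiE_def)
      then show "?f ((\<lambda>i\<in>I. x i mod p, \<lambda>i\<in>I. x i div p)) = x"
        by (intro extensionalityI[of _ I]) auto
    qed
    show "?f ` ?Y \<subseteq>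
        ?X"
    proof (rule image_subsetI)
      fix yz assume "yz \<in> ?Y"
      then obtain y z where yz: "yz = (y, z)" "y \<in> mod_box I p" "P y" "z \<in> mod_box I m" by blast
      have "0 \<le> y i + p * z i \<and> y i + p * z i < p * m" if "i \<in> I" for i
      proof -
        have 1: "0 \<le> y i" "y i < p" "0 \<le> z i" "z i + 1 \<le> m"
          using mod_box_D[OF yz(2) that] mod_box_D[OF yz(4) that] by auto
        have "p * (z i + 1) \<le> p * m" using 1(4) assms(2) by (intro mult_left_mono) auto
        then show ?thesis using 1 assms(2) by (simp add: distrib_left)
      qed
      then have "(\<lambda>i\<in>I. y i + p * z i) \<in> mod_box I (p * m)" by (simp add: mod_box_def)
      then show "?f yz \<in> ?X"
        using a[OF yz(2), of z] yz(1,3) by (simp only: case_prod_conv mem_Collect_eq simp_thms)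
    qed
    show "?g ` ?X \<subseteq>
        ?Y"
    proof (rule image_subsetI)
      fix x assume "x \<in> ?X"
      then have x: "x \<in> mod_box I (p * m)" "P (\<lambda>i\<in>I. x i mod p)" by auto
      have "0 \<le> x i div p \<and> x i div p < m" if "i \<in> I" for i
      proof -
        have 1: "0 \<le> x i" "x i < p * m" using mod_box_D[OF x(1) that] by auto
        have "p * (x i div p) \<le> x i" using assms(2) by (simp add: minus_mod_eq_mult_div[symmetric])
        then have "p * (x i div p) < p * m" using 1(2) by linarith
        then show ?thesis using 1(1) assms(2) by (simp add: pos_imp_zdiv_nonneg_iff)
      qed
      then have "(\<lambda>i\<in>I. x i div p) \<in> mod_box I m" by (simp add: mod_box_def)
      moreover have "(\<lambda>i\<in>I. x i mod p) \<in> mod_box I p" using assms(2) by (simp add: mod_box_def)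
      ultimately show "(\<lambda>i\<in>I. x i mod p, \<lambda>i\<in>I. x i div p) \<in> ?Y"
        using x(2) by blast
    qed
  qed
  then have "card ?X = card (?Y)"
    by (rule bij_betw_same_card[symmetric])
  then show ?thesis by (simp add: card_cartesian_product)
qed

text \<open>The levels \<open>k\<close> and 1 of \<open>B\<close> agree modulo \<open>p\<close>, and
  the condition sees \<open>x\<close> only modulo \<open>p\<close>, so the proportion is the one
  among the \<open>p^n\<close> residue vectors modulo \<open>p\<close>.\<close>

lemma avg_kernel_le_p_rank:
  assumes p: "prime p" and k: "k > 0" and B: "B \<in> carrier (padic_mat p n)"
  shows "avg (mod_box {..<n} (int p ^ k)) (\<lambda>x. of_bool (\<forall>a<n. int p dvd (\<Sum>b<n. level (sq n) k B (a, b) * x b))) \<le>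
    real p ^ p_rank p (cok p n B) / real p ^ n"
proof -
  have p0: "p > 0" using p by (rule prime_gt_0_nat)
  let ?P = "\<lambda>x. \<forall>a<n. int p dvd (\<Sum>b<n. B (a, b) 1 * x b)"
  have pk: "int p ^ k = int p * int p ^ (k - 1)" using k by (cases k) auto
  have cong: "int p dvd (\<Sum>b<n. level (sq n) k B (a, b) * x b) \<longleftrightarrow> int p dvd (\<Sum>b<n. B (a, b) 1 * (\<lambda>i\<in>{..<n}. x i mod int p) b)"
    if a: "a < n" for a x
  proof -
    have "[(\<Sum>b<n. level (sq n) k B (a, b) * x b) = (\<Sum>b<n. B (a, b) 1 * (\<lambda>i\<in>{..<n}. x i mod int p) b)] (mod int p)"
    proof (intro cong_sum cong_mult)
      fix b assume b: "b \<in> {..<n}"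
      have "B (a, b) \<in> carrier (padic_int p)" using a b B by (auto simp: padic_mat_def)
      then have "B (a, b) k mod int p = B (a, b) 1" "B (a, b) 1 mod int p = B (a, b) 1"
        using padic_int_level[of "B (a, b)" p 1 k] padic_int_level[of "B (a, b)" p 1 1] k by auto
      then show "[level (sq n) k B (a, b) = B (a, b) 1] (mod int p)" using a b by (simp add: level_def cong_def)
      show "[x b = (\<lambda>i\<in>{..<n}. x i mod int p) b] (mod int p)" using b by (simp add: cong_def)
    qed
    then show ?thesis by (rule cong_dvd_iff)
  qed
  have "card {x \<in> mod_box {..<n} (int p ^ k). \<forall>a<n. int p dvd (\<Sum>b<n. level (sq n) k B (a, b) * x b)} =
      card {x \<in> mod_box {..<n} (int p * int p ^ (k - 1)). ?P (\<lambda>i\<in>{..<n}. x i mod int p)}"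
    unfolding pk[symmetric] using cong by (intro arg_cong[of _ _ card] Collect_cong conj_cong refl) blast
  also have "\<dots> = card {y \<in> mod_box {..<n} (int p). ?P y} * card (mod_box {..<n} (int p ^ (k - 1)))"
    using p0 by (intro card_mod_box_reduce) auto
  also have "\<dots> \<le> p ^ p_rank p (cok p n B) * card (mod_box {..<n} (int p ^ (k - 1)))"
    by (intro mult_right_mono card_kernel_le_p_rank[OF p B]) auto
  finally have "real (card {x \<in> mod_box {..<n} (int p ^ k). \<forall>a<n. int p dvd (\<Sum>b<n. level (sq n) k B (a, b) * x b)}) \<le>
      real (p ^ p_rank p (cok p n B) * card (mod_box {..<n} (int p ^ (k - 1))))"
    by (simp only: of_nat_le_iff)
  moreover have "card (mod_box {..<n} (int p ^ k)) = p ^ n * card (mod_box {..<n} (int p ^ (k - 1)))"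
    using p0 by (simp add: card_mod_box pk nat_mult_distrib power_mult_distrib nat_power_eq)
  moreover have "card (mod_box {..<n} (int p ^ (k - 1))) > 0" using p0 by (intro card_mod_box_pos) auto
  ultimately show ?thesis using p0
    by (simp add: avg_of_bool field_simps)
qed

section \<open>Haar probabilities as finite averages, and the limit\<close>

text \<open>The fibres of \<open>level\<close> are the cylinders, which have equal measure by
  translation invariance; the event is a finite disjoint union of them.\<close>

lemma haar_level_prob:
  assumes p: "p > 0"
  shows "\<P>(A in padic_mat_haar p n. Q (level (sq n) k A)) = avg (mod_box (sq n) (int p ^ k)) (\<lambda>a. of_bool (Q a))"
proof -
  let ?\<mu> = "padic_mat_haar p n" and ?G = "padic_prod p (sq n)" and ?X = "mod_box (sq n) (int p ^ k)"
  let ?T = "product_topology (\<lambda>_. padic_topology p) (sq n)"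
  have haar: "haar_probability ?G ?T ?\<mu>"
    using haar_probability_padic_mat[OF p, of n] by (simp add: padic_mat_prod padic_mat_topology_def)
  interpret prob_space ?\<mu> using haar by (simp add: haar_probability_def)
  have sets: "sets ?\<mu> = sigma_sets (carrier ?G) (padic_basis p (sq n))"
    using haar padic_borel_generator[of "sq n" p] by (simp add: haar_probability_def)
  have space: "space ?\<mu> = carrier ?G"
    using sets_eq_imp_space_eq[of ?\<mu> "sigma (carrier ?G) (padic_basis p (sq n))"] sets
      padic_basis_Pow[of p "sq n"] by (simp add: sets_measure_of space_measure_of)
  define c where "c = (\<lambda>a. {M \<in> carrier ?G. level (sq n) k M = a})"
  have cyl: "padic_cyl p (sq n) k A = c (level (sq n) k A)" for A
    by (auto simp: padic_cyl_def c_def level_def fun_eq_iff)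
  have rep: "\<exists>A\<in>carrier ?G. level (sq n) k A = a" if "a \<in> ?X" for a
    using level_surj[OF p that] by blast
  have inj: "inj_on c ?X"
  proof (rule inj_onI)
    fix a b assume ab: "a \<in> ?X" "b \<in> ?X" "c a = c b"
    obtain A where "A \<in> carrier ?G" "level (sq n) k A = a" using rep[OF ab(1)] by blast
    then have "A \<in> c b" using ab(3) by (auto simp: c_def)
    then show "a = b" using \<open>level (sq n) k A = a\<close> by (simp add: c_def)
  qed
  have "padic_cyls p (sq n) k = c ` ?X"
    unfolding padic_cyls_def cyl level_image[OF p, symmetric] image_image ..
  then have card: "card (padic_cyls p (sq n) k) = card ?X" using inj by (simp add: card_image)
  have sets_c: "c a \<in> sets ?\<mu>" if a: "a \<in> ?X" for a
  proof -
    obtain A where A: "A \<in> carrier ?G" "level (sq n) k A = a" using rep[OF a] by blast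
    then have "c a \<in> padic_basis p (sq n)" using cyl[of A] by (auto simp: padic_basis_def padic_cyls_def)
    then show ?thesis unfolding sets by (rule sigma_sets.Basic)
  qed
  have meas: "measure ?\<mu> (c a) = 1 / real (card ?X)" if a: "a \<in> ?X" for a
  proof -
    obtain A where A: "A \<in> carrier ?G" "level (sq n) k A = a" using rep[OF a] by blast
    have "emeasure ?\<mu> (c a) = 1 / of_nat (card ?X)"
      using haar_probability_cyl[OF _ p haar A(1), of k] A(2) by (simp add: cyl card)
    also have "\<dots> = ennreal (1 / real (card ?X))"
      using card_mod_box_pos[of "sq n" "int p ^ k"] p
      by (simp add: divide_ennreal[symmetric] ennreal_of_nat_eq_real_of_nat)
    finally show ?thesis by (simp add: measure_def)
  qed
  have "{A \<in> space ?\<mu>. Q (level (sq n) k A)} = (\<Union>a\<in>{a \<in> ?X. Q a}. c a)"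
    using level_in[of _ p "sq n" k] by (auto simp: space c_def)
  then have "measure ?\<mu> {A \<in> space ?\<mu>. Q (level (sq n) k A)} = measure ?\<mu> (\<Union>a\<in>{a \<in> ?X. Q a}. c a)"
    by (rule arg_cong)
  also have "\<dots> = (\<Sum>a\<in>{a \<in> ?X. Q a}. measure ?\<mu> (c a))"
  proof (rule finite_measure_finite_Union)
    show "disjoint_family_on c {a \<in> ?X. Q a}" by (auto simp: disjoint_family_on_def c_def)
  qed (use sets_c in auto)
  also have "\<dots> = real (card {a \<in> ?X. Q a}) / real (card ?X)" by (simp add: meas)
  finally show ?thesis by (simp add: avg_of_bool)
qed


lemma finite_abelian_p_group_exponent:
  assumes "finite_abelian_p_group p H"
  obtains e where "\<And>k x. e \<le> k \<Longrightarrow> x \<in> carrier H \<Longrightarrow> x [^]\<^bsub>H\<^esub> (p ^ k) = \<one>\<^bsub>H\<^esub>"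
proof -
  interpret comm_group H using assms by (simp add: finite_abelian_p_group_def)
  obtain e where e: "order H = p ^ e" using assms by (auto simp: finite_abelian_p_group_def)
  have "x [^]\<^bsub>H\<^esub> (p ^ k) = \<one>\<^bsub>H\<^esub>" if "e \<le> k" "x \<in> carrier H" for k x
  proof -
    have "p ^ k = p ^ e * p ^ (k - e)" using that(1) by (simp flip: power_add)
    then have "x [^]\<^bsub>H\<^esub> (p ^ k) = (x [^]\<^bsub>H\<^esub> order H) [^]\<^bsub>H\<^esub> (p ^ (k - e))"
      using that(2) by (simp add: nat_pow_pow e)
    also have "\<dots> = \<one>\<^bsub>H\<^esub>" unfolding pow_order_eq_1[OF that(2)] by (rule nat_pow_one)
    finally show ?thesis .
  qed
  then show ?thesis by (rule that)
qed

lemma tendsto_cok_prob: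
  fixes p :: nat and H :: "'a monoid"
  assumes p: "prime p" and k: "k > 0" and H: "finite_abelian_p_group p H"
    and exp: "\<And>x. x \<in> carrier H \<Longrightarrow> x [^]\<^bsub>H\<^esub> (p ^ (k - 1)) = \<one>\<^bsub>H\<^esub>"
  shows "(\<lambda>n. avg (mod_box (sq n) (int p ^ k)) (\<lambda>a. of_bool (zvec (p ^ k) n Mod mimg (p ^ k) n a \<cong> H)))
    \<longlonglongrightarrow> 1 / real (order (AutoGroup H)) * prodinf (\<lambda>i. 1 - 1 / real p ^ (i + 1))"
proof -
  have q1: "p ^ k > 1" using prime_gt_1_nat[OF p] k by (rule one_less_power)
  have H': "comm_group H" "finite (carrier H)" using H by (auto simp: finite_abelian_p_group_def)
  have "avg (mod_box (sq n) (int p ^ k)) (\<lambda>a. of_bool (zvec (p ^ k) n Mod mimg (p ^ k) n a \<cong> H)) =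
      real (card {x \<in> {..<n} \<rightarrow>\<^sub>E carrier (zvec (p ^ k) n).
        zvec (p ^ k) n Mod generate (zvec (p ^ k) n) (x ` {..<n}) \<cong> H}) / real (p ^ k) ^ (n * n)" for n
    using card_mod_box_quotient[OF q1, of n H]
    by (simp add: avg_of_bool card_mod_box card_cartesian_product nat_power_eq)
  then show ?thesis using tendsto_quotient_tuples[OF p k H' exp] by simp
qed

theorem theorem1p3:
  fixes p :: nat
    and B :: "nat \<Rightarrow> nat \<times> nat \<Rightarrow> nat \<Rightarrow> int"
    and H1 :: "'a monoid"
    and H2 :: "'b monoid"
  assumes "prime p"
    and "\<And>n. n \<ge> 1 \<Longrightarrow> B n \<in> carrier (padic_mat p n)"
    and "filterlim (\<lambda>n. real n - log (real p) (real n) - real (p_rank p (cok p n (B n))))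
           at_top sequentially"
    and "finite_abelian_p_group p H1"
    and "finite_abelian_p_group p H2"
  shows "(\<lambda>n. \<P>(A in padic_mat_haar p n.
              cok p n A \<cong> H1 \<and> cok p n (A \<otimes>\<^bsub>padic_mat p n\<^esub> B n) \<cong> H2))
         \<longlonglongrightarrow>
           (1 / real (order (AutoGroup H1)) * prodinf (\<lambda>i. 1 - 1 / real p ^ (i + 1))) *
           (1 / real (order (AutoGroup H2)) * prodinf (\<lambda>i. 1 - 1 / real p ^ (i + 1)))"
proof -
  have p0: "p > 0" using assms(1) by (rule prime_gt_0_nat)
  have p1: "p > 1" using assms(1) by (rule prime_gt_1_nat)
  obtain e1 where e1: "\<And>k x. e1 \<le> k \<Longrightarrow> x \<in> carrier H1 \<Longrightarrow> x [^]\<^bsub>H1\<^esub> (p ^ k) = \<one>\<^bsub>H1\<^esub>"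
    using finite_abelian_p_group_exponent[OF assms(4)] by blast
  obtain e2 where e2: "\<And>k x. e2 \<le> k \<Longrightarrow> x \<in> carrier H2 \<Longrightarrow> x [^]\<^bsub>H2\<^esub> (p ^ k) = \<one>\<^bsub>H2\<^esub>"
    using finite_abelian_p_group_exponent[OF assms(5)] by blast
  \<comment> \<open>One more than both exponents, so that \<open>p^(k-1)\<close> kills
    \<open>H1\<close> and \<open>H2\<close>.\<close>
  define k where "k = Suc (max e1 e2)"
  have k: "k > 0" by (simp add: k_def)
  have exp1: "x [^]\<^bsub>H1\<^esub> (p ^ (k - 1)) = \<one>\<^bsub>H1\<^esub>" if "x \<in> carrier H1" for x
    using e1 that by (simp add: k_def)
  have exp2: "x [^]\<^bsub>H2\<^esub> (p ^ (k - 1)) = \<one>\<^bsub>H2\<^esub>" if "x \<in> carrier H2" for x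
    using e2 that by (simp add: k_def)
  have gr: "group H1" "group H2"
    using assms(4,5) by (simp_all add: finite_abelian_p_group_def comm_group.axioms(2))
  have q0: "p ^ k > 0" using p0 by simp
  define E1 where "E1 = (\<lambda>n a. zvec (p ^ k) n Mod mimg (p ^ k) n a \<cong> H1)"
  define E2 where "E2 = (\<lambda>n a. zvec (p ^ k) n Mod mimg (p ^ k) n a \<cong> H2)"
  let ?X = "\<lambda>n. mod_box (sq n) (int p ^ k)"
  let ?L1 = "1 / real (order (AutoGroup H1)) * prodinf (\<lambda>i. 1 - 1 / real p ^ (i + 1))"
  let ?L2 = "1 / real (order (AutoGroup H2)) * prodinf (\<lambda>i. 1 - 1 / real p ^ (i + 1))"
  define J where "J = (\<lambda>n. \<P>(A in padic_mat_haar p n.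
      cok p n A \<cong> H1 \<and> cok p n (A \<otimes>\<^bsub>padic_mat p n\<^esub> B n) \<cong> H2))"
  define a1 where "a1 = (\<lambda>n. avg (?X n) (\<lambda>a. of_bool (E1 n a)) :: real)"
  define a2 where "a2 = (\<lambda>n. avg (?X n) (\<lambda>a. of_bool (E2 n a)) :: real)"
  \<comment> \<open>The error of \<open>biinvariant_decorrelation\<close>, with the proportion of
    killed vectors replaced by its bound through the p-rank.\<close>
  define \<epsilon> where "\<epsilon> = (\<lambda>n. real p ^ p_rank p (cok p n (B n)) / real p ^ n + 2 * (1 / real p) ^ (n div 2))"
  have lim: "(\<lambda>n. a1 n * a2 n) \<longlonglongrightarrow> ?L1 * ?L2"
    unfolding a1_def a2_def E1_def E2_def
    by (intro tendsto_mult tendsto_cok_prob[OF assms(1) k] assms(4,5) exp1 exp2)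
  \<comment> \<open>The type variable of \<open>H\<close> is fresh, so the fact is polymorphic and
    serves \<open>H1\<close> and \<open>H2\<close> alike.\<close>
  have inv: "zvec (p ^ k) n Mod mimg (p ^ k) n (mred (int p ^ k) n (mmul n U (mmul n a V))) \<cong> H \<longleftrightarrow>
      zvec (p ^ k) n Mod mimg (p ^ k) n a \<cong> H"
    if "unimod n U" "unimod n V" for n U V a and H :: "'c monoid"
  proof -
    interpret Z: comm_group "zvec (p ^ k) n" by (rule comm_group_zvec)
    have iso: "zvec (p ^ k) n Mod mimg (p ^ k) n (mred (int p ^ k) n (mmul n U (mmul n a V))) \<cong>
        zvec (p ^ k) n Mod mimg (p ^ k) n a"
      using zvec_Mod_sandwich[OF q0 that, of a] by simp
    have "group (zvec (p ^ k) n Mod mimg (p ^ k) n (mred (int p ^ k) n (mmul n U (mmul n a V))))"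
      by (intro normal.factorgroup_is_group Z.subgroup_imp_normal subgroup_mimg[OF q0])
    from group.iso_sym[OF this iso] iso show ?thesis using iso_trans by blast
  qed
  \<comment> \<open>Restricted to \<open>n >= 1\<close> because \<open>B 0\<close> is
    unconstrained.\<close>
  have bound: "\<bar>J n - a1 n * a2 n\<bar> \<le> \<epsilon> n" if n: "n \<ge> 1" for n
  proof -
    let ?b = "level (sq n) k (B n)"
    have Bn: "B n \<in> carrier (padic_mat p n)" by (rule assms(2)[OF n])
    interpret G: group "padic_prod p (sq n)" by (rule padic_prod_group[OF p0])
    have space: "space (padic_mat_haar p n) = carrier (padic_mat p n)"
    proof -
      have "sets (padic_mat_haar p n) = sigma_sets (carrier (padic_mat p n)) (padic_basis p (sq n))"
        using haar_probability_padic_mat[OF p0, of n] padic_borel_generator[of "sq n" p]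
        by (simp add: haar_probability_def padic_mat_prod padic_mat_topology_def)
      then show ?thesis
        using sets_eq_imp_space_eq[of "padic_mat_haar p n" "sigma (carrier (padic_mat p n)) (padic_basis p (sq n))"]
          padic_basis_Pow[of p "sq n"] by (simp add: sets_measure_of space_measure_of padic_mat_prod)
    qed
    \<comment> \<open>Both conditions are read off at level \<open>k\<close>, where adding
      \<open>B n\<close> becomes a shift by its residue matrix.\<close>
    have "J n = \<P>(A in padic_mat_haar p n. E1 n (level (sq n) k A) \<and> E2 n (mod_shift (sq n) (int p ^ k) ?b (level (sq n) k A)))"
      unfolding J_def
    proof (intro arg_cong[of _ _ "measure (padic_mat_haar p n)"] Collect_cong conj_cong refl)
      fix A assume "A \<in> space (padic_mat_haar p n)"
      then have A: "A \<in> carrier (padic_mat p n)" by (simp only: space)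
      then have AB: "A \<otimes>\<^bsub>padic_mat p n\<^esub> B n \<in> carrier (padic_mat p n)"
        using Bn by (simp add: padic_mat_prod)
      show "cok p n A \<cong> H1 \<longleftrightarrow> E1 n (level (sq n) k A)"
        unfolding E1_def by (rule cok_iso_iff[OF p0 k A gr(1) exp1])
      show "cok p n (A \<otimes>\<^bsub>padic_mat p n\<^esub> B n) \<cong> H2 \<longleftrightarrow>
          E2 n (mod_shift (sq n) (int p ^ k) ?b (level (sq n) k A))"
        unfolding E2_def using cok_iso_iff[OF p0 k AB gr(2) exp2]
        by (simp add: padic_mat_prod level_mult)
    qed
    also have "\<dots> = avg (?X n) (\<lambda>a. of_bool (E1 n a \<and> E2 n (mod_shift (sq n) (int p ^ k) ?b a)))"
      by (rule haar_level_prob[OF p0])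
    finally have J: "J n = \<dots>" .
    have "\<bar>J n - a1 n * a2 n\<bar> \<le>
        avg (mod_box {..<n} (int p ^ k)) (\<lambda>x. of_bool (\<forall>a<n. int p dvd (\<Sum>b<n. ?b (a, b) * x b))) +
        2 * (1 / real p) ^ (n div 2)"
      unfolding J a1_def a2_def E1_def E2_def
      by (rule biinvariant_decorrelation[OF assms(1) k refl]) (simp_all only: inv)
    also have "\<dots> \<le> \<epsilon> n"
      unfolding \<epsilon>_def by (intro add_right_mono avg_kernel_le_p_rank[OF assms(1) k Bn])
    finally show ?thesis .
  qed
  have "\<epsilon> \<longlonglongrightarrow> 0 + 2 * 0"
    unfolding \<epsilon>_def
  proof (intro tendsto_add tendsto_mult tendsto_const)
    define g where "g = (\<lambda>n. real n - log (real p) (real n) - real (p_rank p (cok p n (B n))))"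
    have "((\<lambda>x. real p powr (- x)) \<longlongrightarrow> 0) at_top"
      using p1 by real_asymp
    then have g: "(\<lambda>n. real p powr (- g n)) \<longlonglongrightarrow> 0"
      using assms(3) unfolding g_def by (rule filterlim_compose)
    show "(\<lambda>n. real p ^ p_rank p (cok p n (B n)) / real p ^ n) \<longlonglongrightarrow> 0"
    proof (rule tendsto_sandwich[OF _ _ tendsto_const g])
      \<comment> \<open>With \<open>r\<close> the p-rank, \<open>r - n <= - g n\<close> because the
        logarithm of \<open>n\<close> is nonnegative for \<open>n >= 1\<close>.\<close>
      show "\<forall>\<^sub>F n in sequentially. real p ^ p_rank p (cok p n (B n)) / real p ^ n \<le> real p powr (- g n)"
        using eventually_ge_at_top[of 1]
      proof eventually_elim
        case (elim n)
        have "real p ^ p_rank p (cok p n (B n)) / real p ^ n = real p powr (real (p_rank p (cok p n (B n))) - real n)"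
          using p0 by (simp add: powr_diff powr_realpow)
        also have "\<dots> \<le> real p powr (- g n)"
          using p1 elim by (intro powr_mono) (simp_all add: g_def)
        finally show ?case .
      qed
    qed simp
    show "(\<lambda>n. (1 / real p) ^ (n div 2)) \<longlonglongrightarrow> 0"
    proof (rule filterlim_compose[OF LIMSEQ_realpow_zero])
      show "filterlim (\<lambda>n::nat. n div 2) at_top sequentially"
        unfolding filterlim_at_top
      proof
        fix Z :: nat
        show "\<forall>\<^sub>F n in sequentially. Z \<le> n div 2"
          using eventually_ge_at_top[of "2 * Z"] by eventually_elim simp
      qed
    qed (use p1 in auto)
  qed
  then have "\<epsilon> \<longlonglongrightarrow> 0" by simp
  then have "(\<lambda>n. J n - a1 n * a2 n) \<longlonglongrightarrow> 0"
    by (rule Lim_null_comparison[rotated]) (use bound in \<open>auto intro: eventually_sequentiallyI[of 1]\<close>)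
  from tendsto_add[OF this lim] show ?thesis unfolding J_def by simp
qed

end
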